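(* Let $X$ be a Banach space with an unconditional basis $\{e_i\}_{i\in\mathbb{N}}$. Then either (1) or (2) holds: (1) There exists a perfect set $P\subset 2^\omega$ of infinite subsets of $\mathbb{N}$ such that for any two distinct $A,B\in P$, $$[e_i]_{i\in A}\not\cong[e_i]_{i\in B},\qquad [e_i]_{i\in A}\not\cong[e_i]_{i\in \mathbb{N}\setminus B},\qquad [e_i]_{i\in \mathbb{N}\setminus A}\not\cong[e_i]_{i\in \mathbb{N}\setminus B}.$$ (2) For all $A$ in a residual subset of $2^\omega$, $[e_i]_{i\in A}$ is isomorphic to $X$; moreover $X$ is isomorphic to its hyperplanes; $X$ is isomorphic to its square $X\oplus X$; $X$ is uniformly isomorphic to $X\oplus[e_i]_{i\in D}$ for $D\subset\mathbb{N}$ (i.e. there is a constant $K$ such that $X\oplus [e_i]_{i\in D}$ is $K$-isomorphic to $X$ for every $D\subset\mathbb{N}$); and $X$ is isomorphic to a denumerable unconditional Schauder decomposition into uniformly isomorphic copies of itself, $X\cong\sum_{k\in\mathbb{N}}\oplus\,[e_i]_{i\in B_k}$, for some pairwise disjoint sets $B_k\subset\mathbb{N}$, $k\in\mathbb{N}$ (i.e. there is a constant $K'$ such that each $[e_i]_{i\in B_k}$ is $K'$-isomorphic to $X$, and $X$ is isomorphic to $[e_i]_{i\in\bigcup_k B_k}$, of which $([e_i]_{i\in B_k})_{k\in\mathbb{N}}$ is an unconditional Schauder decomposition).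
   Context: Banach spaces are real. A basis $\{e_i\}_{i\in\mathbb{N}}$ of $X$ is a sequence of nonzero vectors such that every $x\in X$ is uniquely a norm-convergent series $\sum a_ie_i$; it is unconditional if all these series converge unconditionally. $[e_i]_{i\in A}$ denotes the closed linear span of $\{e_i: i\in A\}$. Subsets of $\mathbb{N}$ are identified with points of the Cantor space $2^\omega$ via characteristic functions; "residual" (comeager) and "perfect" (nonempty, closed, without isolated points) refer to its usual topology. $Y\cong Z$ means that there is a linear bijection $T:Y\to Z$ with $T$ and $T^{-1}$ continuous; $Y$ and $Z$ are $K$-isomorphic if $T$ can be chosen with $\|T\|\,\|T^{-1}\|\le K$. A hyperplane is a closed subspace of codimension $1$. Direct sums of two spaces may be taken with the $\ell_1$-sum norm. A sequence $(Y_k)_{k\in\mathbb{N}}$ of closed subspaces of $Y$ is an unconditional Schauder decomposition of $Y$ if every $y\in Y$ has a unique expansion $y=\sum_k y_k$ with $y_k\in Y_k$, and these series converge unconditionally. *)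

theory Defs
  imports "HOL-Analysis.Analysis"
begin

section \<open>Unconditional bases and closed spans\<close>

definition schauder_basis :: "(nat \<Rightarrow> 'a::real_normed_vector) \<Rightarrow> bool" where
  "schauder_basis e \<longleftrightarrow>
     (\<forall>i. e i \<noteq> 0) \<and> (\<forall>x. \<exists>!a :: nat \<Rightarrow> real. (\<lambda>i. a i *\<^sub>R e i) sums x)"

text \<open>Unconditional convergence is the library's \<^const>\<open>has_sum\<close> (convergence of the net of
  finite partial sums), as opposed to \<^const>\<open>sums\<close>, which respects the order of the terms.\<close>

definition unconditional_basis :: "(nat \<Rightarrow> 'a::real_normed_vector) \<Rightarrow> bool" where
  "unconditional_basis e \<longleftrightarrow>
     schauder_basis e \<and>
     (\<forall>x (a :: nat \<Rightarrow> real). (\<lambda>i. a i *\<^sub>R e i) sums x \<longrightarrow> ((\<lambda>i. a i *\<^sub>R e i) has_sum x) UNIV)"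

definition closed_span :: "(nat \<Rightarrow> 'a::real_normed_vector) \<Rightarrow> nat set \<Rightarrow> 'a set" where
  "closed_span e A = closure (span (e ` A))"


section \<open>Isomorphisms between subspaces\<close>

definition linear_map_on ::
  "'a::real_vector set \<Rightarrow> ('a \<Rightarrow> 'b::real_vector) \<Rightarrow> bool" where
  "linear_map_on Y T \<longleftrightarrow>
     (\<forall>x\<in>Y. \<forall>y\<in>Y. T (x + y) = T x + T y) \<and> (\<forall>c. \<forall>x\<in>Y. T (c *\<^sub>R x) = c *\<^sub>R T x)"

text \<open>Here \<open>T'\<close> is the inverse of \<open>T\<close>; it is determined by \<open>T\<close> on \<open>Z\<close>.\<close>

definition isomorphism_pair ::
  "'a::real_normed_vector set \<Rightarrow> 'b::real_normed_vector set \<Rightarrow> ('a \<Rightarrow> 'b) \<Rightarrow> ('b \<Rightarrow> 'a) \<Rightarrow> bool" where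
  "isomorphism_pair Y Z T T' \<longleftrightarrow> linear_map_on Y T \<and> homeomorphism Y Z T T'"

definition isomorphic ::
  "'a::real_normed_vector set \<Rightarrow> 'b::real_normed_vector set \<Rightarrow> bool" where
  "isomorphic Y Z \<longleftrightarrow> (\<exists>T T'. isomorphism_pair Y Z T T')"

text \<open>The operator norm of a continuous linear map on a subspace, in the form used by the
  library's \<^const>\<open>onorm\<close> (the quotient at \<open>x = 0\<close> is \<open>0 / 0 = 0\<close>). The supremum is only
  meaningful when it is bounded, which holds for continuous linear maps.\<close>

definition onorm_on ::
  "'a::real_normed_vector set \<Rightarrow> ('a \<Rightarrow> 'b::real_normed_vector) \<Rightarrow> real" where
  "onorm_on Y T = (SUP x\<in>Y. norm (T x) / norm x)"

text \<open>Direct sums are rendered by the product type, whose norm is the Euclidean sum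
  \<open>sqrt (norm x ^ 2 + norm y ^ 2)\<close>. This is equivalent to the \<open>l_1\<close>-sum norm with constants
  \<open>1\<close> and \<open>sqrt 2\<close>, independently of the summands, so neither isomorphism nor the existence of a
  uniform isomorphism constant depends on the choice.\<close>

definition K_isomorphic ::
  "real \<Rightarrow> 'a::real_normed_vector set \<Rightarrow> 'b::real_normed_vector set \<Rightarrow> bool" where
  "K_isomorphic K Y Z \<longleftrightarrow>
     (\<exists>T T'. isomorphism_pair Y Z T T' \<and> onorm_on Y T * onorm_on Z T' \<le> K)"

definition hyperplane :: "'a::real_normed_vector set \<Rightarrow> bool" where
  "hyperplane H \<longleftrightarrow> subspace H \<and> closed H \<and> (\<exists>v. v \<notin> H \<and> span (insert v H) = UNIV)"

definition unconditional_schauder_decomposition ::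
  "(nat \<Rightarrow> 'a::real_normed_vector set) \<Rightarrow> 'a set \<Rightarrow> bool" where
  "unconditional_schauder_decomposition W Y \<longleftrightarrow>
     (\<forall>k. subspace (W k) \<and> closed (W k) \<and> W k \<subseteq> Y) \<and>
     (\<forall>y\<in>Y. \<exists>!f. (\<forall>k. f k \<in> W k) \<and> f sums y) \<and>
     (\<forall>y\<in>Y. \<forall>f. (\<forall>k. f k \<in> W k) \<and> f sums y \<longrightarrow> (f has_sum y) UNIV)"


section \<open>The Cantor space of subsets of the natural numbers\<close>

text \<open>The type \<^typ>\<open>nat \<Rightarrow> bool\<close> carries the product of the discrete topologies, i.e. it is the
  Cantor space. Families of subsets of the natural numbers are moved there by \<open>char_fun\<close>.\<close>

definition char_fun :: "nat set \<Rightarrow> nat \<Rightarrow> bool" where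
  "char_fun A = (\<lambda>i. i \<in> A)"

definition perfect_set :: "'a::topological_space set \<Rightarrow> bool" where
  "perfect_set P \<longleftrightarrow> P \<noteq> {} \<and> closed P \<and> (\<forall>x\<in>P. x islimpt P)"

definition residual :: "'a::topological_space set \<Rightarrow> bool" where
  "residual R \<longleftrightarrow>
     (\<exists>U :: nat \<Rightarrow> 'a set. (\<forall>n. open (U n) \<and> closure (U n) = UNIV) \<and> (\<Inter>n. U n) \<subseteq> R)"

end

theory Submission
  imports Defs
begin

text \<open>
  Code a pair \<open>(A, B)\<close> of subsets of the natural numbers by one point
  of the Cantor space of sequences in \<open>bool \<times> bool\<close>, and let \<open>E\<close> be the set of pairs with
  \<open>[e_i]_A\<close> isomorphic to \<open>[e_i]_B\<close>. Everything depends on whether \<open>E\<close> is meager.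

  If \<open>E\<close> is meager, so are its preimages under complementing one or both coordinates, and so is the
  union of the three sets. By \<open>perfect_set_avoiding_meager\<close> (Mycielski's theorem) there is a perfect
  set all of whose pairs of distinct points avoid this union, which is alternative (1).

  If \<open>E\<close> is not meager, some set \<open>E_K\<close> of pairs that are isomorphic with constant \<open>K\<close> is not meager.
  A non-meager set need not be comeager anywhere, but \<open>E_K\<close> is the projection of a closed set: an
  isomorphism is given by approximations to the images of the basis vectors with finitely supported
  rational coordinates, and being a \<open>K\<close>-isomorphism is a closed condition on these data and the pair
  (\<open>codes_isomorphism\<close>). Projections have the Baire property (\<open>projection_comeager_in_cylinder\<close>), so
  \<open>E_K\<close> is comeager in some basic open set.

  A comeager set contains all points that agree, on infinitely many blocks of a suitable partition
  into intervals, with a suitable fixed pattern (\<open>meager_avoiding_pattern\<close>). Fixing the first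
  coordinate to be the pattern itself gives one space \<open>Z\<close> and a pattern for the second coordinate
  such that every set \<open>B\<close> with a prescribed beginning that matches the pattern on infinitely many
  blocks spans a \<open>K\<close>-isomorphic copy of \<open>Z\<close>. Call sets that match infinitely often generic. The
  beginning is irrelevant, at the price of a larger constant, because unconditional bases allow
  finitely many basis vectors to be exchanged (\<open>generic_uniformly_isomorphic\<close>).

  Genericity is so flexible that alternative (2) becomes bookkeeping
  (\<open>generic_uniformly_isomorphic_imp_decomposable\<close>): a generic set can be split into two generic sets,
  the set of all indices can be split into two generic sets, and a generic set stays generic when it
  is changed off infinitely many of its matching blocks. Hence \<open>X \<cong> Z \<times> Z \<cong> Z\<close>, and so on. The only
  tool is that \<open>[e_i]_A \<times> [e_i]_B\<close> is isomorphic to \<open>[e_i]_{A \<union> B}\<close> for disjoint \<open>A\<close>, \<open>B\<close>, with one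
  constant for all \<open>A\<close> and \<open>B\<close> (\<open>iso_within_closed_span_Un\<close>). That constant comes from the uniform
  boundedness of the partial sum operators of an unconditional basis, which is derived from a
  Baire category argument about countably subadditive functionals (Zabreiko's lemma).
\<close>

section \<open>Baire category in sequence spaces, by cylinders\<close>

text \<open>
  The cylinders are the basic open sets of the product topology when the factors are discrete.
  Nowhere dense and meager sets are expressed through them directly, so that the category arguments
  apply to sequences over any countable type without a topology on that type.
\<close>

definition cylinder :: "nat \<Rightarrow> (nat \<Rightarrow> 'c) \<Rightarrow> (nat \<Rightarrow> 'c) set" where
  "cylinder n p = {q. \<forall>i<n. q i = p i}"

definition nowhere_dense :: "(nat \<Rightarrow> 'c) set \<Rightarrow> bool" where
  "nowhere_dense N \<longleftrightarrow> (\<forall>n p. \<exists>m q. q \<in> cylinder n p \<and> cylinder m q \<inter> N = {})"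

definition meager :: "(nat \<Rightarrow> 'c) set \<Rightarrow> bool" where
  "meager M \<longleftrightarrow> (\<exists>N :: nat \<Rightarrow> (nat \<Rightarrow> 'c) set. (\<forall>k. nowhere_dense (N k)) \<and> M \<subseteq> (\<Union>k. N k))"

definition cylinder_closed :: "(nat \<Rightarrow> 'c) set \<Rightarrow> bool" where
  "cylinder_closed F \<longleftrightarrow> (\<forall>p. (\<forall>n. cylinder n p \<inter> F \<noteq> {}) \<longrightarrow> p \<in> F)"

lemma cylinder_self [simp]: "p \<in> cylinder n p"
  by (simp add: cylinder_def)

lemma cylinder_eq: "q \<in> cylinder n p \<Longrightarrow> cylinder n q = cylinder n p"
  by (auto simp: cylinder_def)

lemma nowhere_dense_empty [simp]: "nowhere_dense {}"
  unfolding nowhere_dense_def using cylinder_self by fastforce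

lemma nowhere_dense_Un:
  assumes "nowhere_dense N" "nowhere_dense N'"
  shows "nowhere_dense (N \<union> N')"
  unfolding nowhere_dense_def
proof (intro allI)
  fix n and p :: "nat \<Rightarrow> 'a"
  obtain m q where q: "q \<in> cylinder n p" "cylinder m q \<inter> N = {}"
    using assms(1) unfolding nowhere_dense_def by blast
  obtain m' q' where q': "q' \<in> cylinder (max m n) q" "cylinder m' q' \<inter> N' = {}"
    using assms(2) unfolding nowhere_dense_def by blast
  have "q' \<in> cylinder n p"
    using q q' by (auto simp: cylinder_def)
  moreover have "cylinder (max m m') q' \<inter> (N \<union> N') = {}"
  proof -
    have "cylinder (max m m') q' \<subseteq> cylinder m q"
      using q' by (auto simp: cylinder_def)
    moreover have "cylinder (max m m') q' \<subseteq> cylinder m' q'"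
      by (auto simp: cylinder_def)
    ultimately show ?thesis using q q' by blast
  qed
  ultimately show "\<exists>m q. q \<in> cylinder n p \<and> cylinder m q \<inter> (N \<union> N') = {}" by blast
qed

lemma meager_subset: "meager M \<Longrightarrow> M' \<subseteq> M \<Longrightarrow> meager M'"
  unfolding meager_def by (elim exE conjE, rule exI, rule conjI, assumption) (rule subset_trans)

lemma nowhere_dense_imp_meager: "nowhere_dense N \<Longrightarrow> meager N"
  unfolding meager_def by (rule exI[of _ "\<lambda>_. N"]) simp

text \<open>
  The countably many nowhere dense sets that cover each of the countably many sets are renumbered by
  the pairing function.
\<close>

lemma meager_UN_nat:
  fixes M :: "nat \<Rightarrow> (nat \<Rightarrow> 'c) set"
  assumes "\<And>k. meager (M k)"
  shows "meager (\<Union>k. M k)"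
proof -
  obtain N where N: "\<And>k j. nowhere_dense (N k j)" "\<And>k. M k \<subseteq> (\<Union>j::nat. N k j)"
    using assms unfolding meager_def by metis
  have "(\<Union>k. M k) \<subseteq> (\<Union>i. case_prod N (prod_decode i))"
  proof
    fix p assume "p \<in> (\<Union>k. M k)"
    then obtain k j where "p \<in> N k j" using N(2) by blast
    then show "p \<in> (\<Union>i. case_prod N (prod_decode i))"
      by (intro UN_I[of "prod_encode (k, j)"]) auto
  qed
  moreover have "nowhere_dense (case_prod N (prod_decode i))" for i
    using N(1) by (simp split: prod.split)
  ultimately show ?thesis unfolding meager_def
    by (intro exI[of _ "\<lambda>i. case_prod N (prod_decode i)"] conjI allI)
qed

lemma meager_UN:
  assumes "countable I" "\<And>i. i \<in> I \<Longrightarrow> meager (M i)"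
  shows "meager (\<Union>i\<in>I. M i)"
proof (cases "I = {}")
  case True
  then show ?thesis by (simp add: nowhere_dense_imp_meager)
next
  case False
  have "meager (\<Union>k. M (from_nat_into I k))"
    by (intro meager_UN_nat assms(2) from_nat_into[OF False])
  moreover have "(\<Union>k. M (from_nat_into I k)) = \<Union> (M ` range (from_nat_into I))"
    by (simp add: image_image)
  ultimately show ?thesis by (simp only: range_from_nat_into[OF False assms(1)])
qed

lemma meager_Un: "meager M \<Longrightarrow> meager M' \<Longrightarrow> meager (M \<union> M')"
  using meager_UN[of "{M, M'}" "\<lambda>x. x"] by simp blast

lemma countable_cylinders: "countable (range (case_prod cylinder) :: (nat \<Rightarrow> 'c::countable) set set)"
proof (rule countable_subset)
  show "(range (case_prod cylinder) :: (nat \<Rightarrow> 'c) set set)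
      \<subseteq> range (\<lambda>s. {q. map q [0..<length s] = s})"
  proof clarify
    fix n and p :: "nat \<Rightarrow> 'c"
    have "cylinder n p = {q. map q [0..<length (map p [0..<n])] = map p [0..<n]}"
      by (auto simp: cylinder_def)
    then show "cylinder n p \<in> range (\<lambda>s. {q. map q [0..<length s] = s})" by blast
  qed
qed auto

text \<open>
  A bijection of the letters acts on sequences as a homeomorphism that maps cylinders to cylinders.
\<close>

lemma meager_vimage_coordinatewise:
  fixes h :: "'b \<Rightarrow> 'a"
  assumes "meager M" "bij h"
  shows "meager {q. (\<lambda>i. h (q i)) \<in> M}"
proof -
  have *: "nowhere_dense {q. (\<lambda>i. h (q i)) \<in> N}" if N: "nowhere_dense N" for N
    unfolding nowhere_dense_def
  proof (intro allI)
    fix n p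
    obtain m q where q: "q \<in> cylinder n (\<lambda>i. h (p i))" "cylinder m q \<inter> N = {}"
      using N unfolding nowhere_dense_def by blast
    have h: "h (inv h x) = x" "inv h (h y) = y" for x y
      using \<open>bij h\<close> by (auto simp: bij_is_surj bij_is_inj surj_f_inv_f)
    show "\<exists>m q. q \<in> cylinder n p \<and> cylinder m q \<inter> {q. (\<lambda>i. h (q i)) \<in> N} = {}"
    proof (intro exI conjI)
      show "(\<lambda>i. inv h (q i)) \<in> cylinder n p"
        using q(1) by (auto simp: cylinder_def h)
      show "cylinder m (\<lambda>i. inv h (q i)) \<inter> {q. (\<lambda>i. h (q i)) \<in> N} = {}"
        using q(2) by (auto simp: cylinder_def disjoint_iff h)
    qed
  qed
  obtain N where "\<And>k. nowhere_dense (N k)" "M \<subseteq> (\<Union>k::nat. N k)"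
    using assms(1) unfolding meager_def by metis
  then show ?thesis unfolding meager_def
    by (intro exI[of _ "\<lambda>k. {q. (\<lambda>i. h (q i)) \<in> N k}"] conjI allI *) auto
qed


section \<open>Projections of closed sets have the Baire property\<close>

text \<open>
  This is the smallest closed set that contains \<open>A\<close> up to a meager set; it is the hull used in the
  proof that projections have the Baire property.
\<close>

definition nonmeager_points :: "(nat \<Rightarrow> 'c) set \<Rightarrow> (nat \<Rightarrow> 'c) set" where
  "nonmeager_points A = {p. \<forall>n. \<not> meager (A \<inter> cylinder n p)}"

lemma cylinder_closed_nonmeager_points: "cylinder_closed (nonmeager_points A)"
  unfolding cylinder_closed_def
proof (intro allI impI)
  fix p assume p: "\<forall>n. cylinder n p \<inter> nonmeager_points A \<noteq> {}"
  then have "\<not> meager (A \<inter> cylinder n p)" for n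
  proof -
    obtain q where q: "q \<in> cylinder n p" "q \<in> nonmeager_points A" using p by blast
    have "\<not> meager (A \<inter> cylinder n q)" using q(2) by (simp add: nonmeager_points_def)
    then show ?thesis by (simp only: cylinder_eq[OF q(1)] not_False_eq_True)
  qed
  then show "p \<in> nonmeager_points A" by (simp add: nonmeager_points_def)
qed

text \<open>
  The points of \<open>A\<close> that are left out lie in cylinders in which \<open>A\<close> is meager, and there are only
  countably many cylinders.
\<close>

lemma meager_diff_nonmeager_points:
  fixes A :: "(nat \<Rightarrow> 'c::countable) set"
  shows "meager (A - nonmeager_points A)"
proof -
  let ?I = "{c \<in> range (case_prod cylinder). meager (A \<inter> c)}"
  have "meager (\<Union>c\<in>?I. A \<inter> c)"
    by (rule meager_UN, rule countable_subset[OF _ countable_cylinders]) auto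
  moreover have "A - nonmeager_points A \<subseteq> (\<Union>c\<in>?I. A \<inter> c)"
  proof
    fix p assume "p \<in> A - nonmeager_points A"
    then obtain n where "p \<in> A" "meager (A \<inter> cylinder n p)" by (auto simp: nonmeager_points_def)
    then show "p \<in> (\<Union>c\<in>?I. A \<inter> c)" by (intro UN_I[of "cylinder n p"]) auto
  qed
  ultimately show ?thesis by (rule meager_subset)
qed

lemma nonmeager_points_subset_closed:
  assumes "cylinder_closed F" "A \<subseteq> F"
  shows "nonmeager_points A \<subseteq> F"
proof
  fix p assume "p \<in> nonmeager_points A"
  then have "A \<inter> cylinder n p \<noteq> {}" for n
    using nowhere_dense_imp_meager[OF nowhere_dense_empty]
    unfolding nonmeager_points_def by (metis mem_Collect_eq)
  then show "p \<in> F" using assms unfolding cylinder_closed_def by blast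
qed

lemma cylinder_closed_dense_in_cylinder:
  assumes "cylinder_closed F" "\<And>m q. q \<in> cylinder n p \<Longrightarrow> cylinder m q \<inter> F \<noteq> {}"
  shows "cylinder n p \<subseteq> F"
  using assms unfolding cylinder_closed_def by blast

text \<open>
  The closed set \<open>nonmeager_points A\<close> contains all of \<open>A\<close> but a meager part. If it had no interior in
  the given cylinder, it would be nowhere dense there and \<open>A\<close> would be meager there.
\<close>

lemma nonmeager_contains_cylinder:
  fixes A :: "(nat \<Rightarrow> 'c::countable) set"
  assumes "\<not> meager (A \<inter> cylinder n p)"
  obtains m q where "q \<in> cylinder n p" "cylinder m q \<subseteq> cylinder n p" "cylinder m q \<subseteq> nonmeager_points A"
proof -
  have "\<not> nowhere_dense (nonmeager_points A \<inter> cylinder n p)"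
  proof
    assume "nowhere_dense (nonmeager_points A \<inter> cylinder n p)"
    then have "meager ((A - nonmeager_points A) \<union> (nonmeager_points A \<inter> cylinder n p))"
      by (intro meager_Un meager_diff_nonmeager_points nowhere_dense_imp_meager)
    then have "meager (A \<inter> cylinder n p)" by (rule meager_subset) blast
    then show False using assms by contradiction
  qed
  then obtain m q where mq: "\<And>m' q'. q' \<in> cylinder m q \<Longrightarrow> cylinder m' q' \<inter> (nonmeager_points A \<inter> cylinder n p) \<noteq> {}"
    unfolding nowhere_dense_def by blast
  have "cylinder m q \<subseteq> nonmeager_points A"
    by (rule cylinder_closed_dense_in_cylinder[OF cylinder_closed_nonmeager_points]) (use mq in blast)
  moreover obtain r where r: "r \<in> cylinder m q" "r \<in> cylinder n p"
    using mq[of q m] by auto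
  ultimately have "cylinder (max m n) r \<subseteq> nonmeager_points A" "cylinder (max m n) r \<subseteq> cylinder n p"
    by (auto simp: cylinder_def subset_iff)
  then show ?thesis using that r by blast
qed

text \<open>
  Passing to the hull nearly commutes with countable unions: where \<open>B\<close> is non-meager, one of the
  \<open>A i\<close> is non-meager, and its hull contains a cylinder.
\<close>

lemma nowhere_dense_nonmeager_points_UN:
  fixes A :: "'i \<Rightarrow> (nat \<Rightarrow> 'c::countable) set"
  assumes "countable I" "B \<subseteq> (\<Union>i\<in>I. A i)"
  shows "nowhere_dense (nonmeager_points B - (\<Union>i\<in>I. nonmeager_points (A i)))"
  unfolding nowhere_dense_def
proof (intro allI)
  fix n and p :: "nat \<Rightarrow> 'c"
  let ?G = "nonmeager_points B - (\<Union>i\<in>I. nonmeager_points (A i))"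
  show "\<exists>m q. q \<in> cylinder n p \<and> cylinder m q \<inter> ?G = {}"
  proof (cases "cylinder n p \<inter> nonmeager_points B = {}")
    case True
    then show ?thesis by (intro exI[of _ n] exI[of _ p]) auto
  next
    case False
    then obtain r where r: "r \<in> cylinder n p" "r \<in> nonmeager_points B" by blast
    have "\<not> meager (B \<inter> cylinder n r)" using r(2) by (simp add: nonmeager_points_def)
    then have "\<not> meager (B \<inter> cylinder n p)" by (simp only: cylinder_eq[OF r(1)] not_False_eq_True)
    then have "\<not> meager (\<Union>i\<in>I. A i \<inter> cylinder n p)"
      using meager_subset[of "\<Union>i\<in>I. A i \<inter> cylinder n p" "B \<inter> cylinder n p"] assms(2) by blast
    then obtain i where i: "i \<in> I" "\<not> meager (A i \<inter> cylinder n p)"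
      using meager_UN[OF assms(1), of "\<lambda>i. A i \<inter> cylinder n p"] by blast
    obtain m q where
      "q \<in> cylinder n p" "cylinder m q \<subseteq> nonmeager_points (A i)"
      using nonmeager_contains_cylinder[OF i(2)] .
    then show ?thesis using i(1) by blast
  qed
qed

text \<open>
  The set \<open>E = (\<Union>x. \<Inter>j. C j x)\<close> is the projection along \<open>x\<close> of a closed set: for each \<open>x\<close> the
  conditions \<open>C j x\<close> are closed, and each of them looks only at an initial segment of \<open>x\<close>. Let \<open>A s\<close> be
  the part of \<open>E\<close> that has a witness \<open>x\<close> beginning with the finite sequence \<open>s\<close>. Then \<open>A s\<close> is the
  union of the sets \<open>A (s @ [v])\<close>, so outside a meager set a point in the hull of \<open>A s\<close> is in the hull
  of some \<open>A (s @ [v])\<close>. Starting from the hull of \<open>E\<close> this builds a whole witness \<open>x\<close>, and the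
  point satisfies each condition because it is closed and decided by a finite part of \<open>x\<close>. So \<open>E\<close>
  contains its hull up to a meager set, and the hull of a non-meager set contains a cylinder.
\<close>

theorem projection_comeager_in_cylinder:
  fixes C :: "'j \<Rightarrow> (nat \<Rightarrow> 'q::countable) \<Rightarrow> (nat \<Rightarrow> 'c::countable) set"
  assumes closed: "\<And>j x. cylinder_closed (C j x)"
    and local: "\<And>j x. \<exists>m. \<forall>y\<in>cylinder m x. C j y = C j x"
    and nonmeager: "\<not> meager (\<Union>x. \<Inter>j. C j x)"
  obtains n p where "meager (cylinder n p - (\<Union>x. \<Inter>j. C j x))"
proof -
  define E where "E = (\<Union>x. \<Inter>j. C j x)"
  define A where "A s = (\<Union>x\<in>{x. map x [0..<length s] = s}. \<Inter>j. C j x)" for s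
  define G where "G s = nonmeager_points (A s) - (\<Union>v. nonmeager_points (A (s @ [v])))" for s
  have A_Nil: "A [] = E" by (simp add: A_def E_def)
  have A_split: "A s \<subseteq> (\<Union>v. A (s @ [v]))" for s
  proof
    fix p assume "p \<in> A s"
    then obtain x where x: "map x [0..<length s] = s" "p \<in> (\<Inter>j. C j x)"
      unfolding A_def by blast
    then have "p \<in> A (s @ [x (length s)])" unfolding A_def
      by (intro UN_I[of x]) auto
    then show "p \<in> (\<Union>v. A (s @ [v]))" by blast
  qed
  have "meager (\<Union>s. G s)"
    by (intro meager_UN nowhere_dense_imp_meager)
      (auto simp: G_def intro!: nowhere_dense_nonmeager_points_UN A_split)
  moreover have sub: "nonmeager_points E - (\<Union>s. G s) \<subseteq> E"
  proof
    fix p assume p: "p \<in> nonmeager_points E - (\<Union>s. G s)"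
    \<comment> \<open>Any letter that keeps the point in the hull will do; iterating the choice builds the witness.\<close>
    define next_v where "next_v s = (SOME v. p \<in> nonmeager_points (A (s @ [v])))" for s
    have step: "p \<in> nonmeager_points (A (s @ [next_v s]))" if "p \<in> nonmeager_points (A s)" for s
    proof -
      have "\<exists>v. p \<in> nonmeager_points (A (s @ [v]))" using p that unfolding G_def by blast
      then show ?thesis unfolding next_v_def by (rule someI_ex)
    qed
    define S where "S = rec_nat [] (\<lambda>_ s. s @ [next_v s])"
    have S: "S 0 = []" "\<And>n. S (Suc n) = S n @ [next_v (S n)]" by (auto simp: S_def)
    have len: "length (S n) = n" for n by (induction n) (auto simp: S)
    define x where "x i = next_v (S i)" for i
    have Sx: "S n = map x [0..<n]" for n
      by (induction n) (auto simp: S x_def)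
    have mem: "p \<in> nonmeager_points (A (S n))" for n
      by (induction n) (use p step in \<open>auto simp: S A_Nil\<close>)
    have "p \<in> C j x" for j
    proof -
      obtain m where m: "\<forall>y\<in>cylinder m x. C j y = C j x" using local by blast
      have "A (S m) \<subseteq> C j x"
      proof
        fix q assume "q \<in> A (S m)"
        then obtain y where y: "map y [0..<m] = map x [0..<m]" "q \<in> C j y"
          unfolding A_def by (auto simp: Sx)
        then have "y \<in> cylinder m x" by (auto simp: cylinder_def)
        then show "q \<in> C j x" using m y by blast
      qed
      then show ?thesis using nonmeager_points_subset_closed[OF closed] mem by blast
    qed
    then show "p \<in> E" unfolding E_def by blast
  qed
  moreover obtain n p where "cylinder n p \<subseteq> nonmeager_points E"
    using nonmeager_contains_cylinder[of E 0 undefined] nonmeager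
    by (auto simp: cylinder_def E_def)
  ultimately have "meager (cylinder n p - E)"
    by (elim meager_subset) blast
  then show ?thesis using that unfolding E_def by blast
qed


section \<open>Patterns that force a point out of a meager set\<close>

text \<open>
  In all uses \<open>f\<close> is strictly increasing and cuts the natural numbers, from \<open>f 0\<close> on, into consecutive
  blocks; \<open>a\<close> is a pattern of which only the restrictions to single blocks matter.
\<close>

definition matches :: "(nat \<Rightarrow> nat) \<Rightarrow> (nat \<Rightarrow> 'c) \<Rightarrow> nat \<Rightarrow> (nat \<Rightarrow> 'c) \<Rightarrow> bool" where
  "matches f a n q \<longleftrightarrow> (\<forall>i\<in>{f n..<f (Suc n)}. q i = a i)"

text \<open>
  There are finitely many words of length \<open>k\<close>. Deal with them one after the other: each time extend
  the block found so far until, put behind the next word, it leads out of \<open>N\<close>. Appending an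
  enumeration of all letters does no harm; it makes every letter occur in the block, which later
  yields infinite and coinfinite sets.
\<close>

lemma nowhere_dense_avoiding_block:
  fixes N :: "(nat \<Rightarrow> 'c::finite) set"
  assumes "nowhere_dense N"
  shows "\<exists>m>k. \<exists>a. (\<forall>c. \<exists>i\<in>{k..<m}. a i = c) \<and> (\<forall>q. (\<forall>i\<in>{k..<m}. q i = a i) \<longrightarrow> q \<notin> N)"
proof -
  have block: "\<exists>m\<ge>k. \<exists>a. \<forall>q. (\<exists>t\<in>S. map q [0..<k] = t) \<and> (\<forall>i\<in>{k..<m}. q i = a i) \<longrightarrow> q \<notin> N"
    if "finite S" for S :: "'c list set"
    using that
  proof induction
    case empty
    then show ?case by auto
  next
    case (insert t S)
    then obtain m a where m: "m \<ge> k"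
      "\<And>q. \<exists>t\<in>S. map q [0..<k] = t \<Longrightarrow> \<forall>i\<in>{k..<m}. q i = a i \<Longrightarrow> q \<notin> N" by metis
    define p where "p i = (if i < k then t ! i else a i)" for i
    obtain m' q where q: "q \<in> cylinder m p" "cylinder m' q \<inter> N = {}"
      using assms unfolding nowhere_dense_def by blast
    have "r \<notin> N" if r: "\<exists>t\<in>insert t S. map r [0..<k] = t" "\<forall>i\<in>{k..<max m m'}. r i = q i" for r
    proof (cases "map r [0..<k] = t")
      case True
      have "r i = q i" if "i < m'" for i
      proof (cases "i < k")
        case True
        then have "r i = t ! i" using \<open>map r [0..<k] = t\<close> by auto
        then show ?thesis using q(1) True m(1) by (auto simp: cylinder_def p_def)
      qed (use r(2) that in auto)
      then show ?thesis using q(2) by (auto simp: cylinder_def)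
    next
      case False
      then have "\<exists>t\<in>S. map r [0..<k] = t" using r(1) by blast
      moreover have "\<forall>i\<in>{k..<m}. r i = a i"
        using r(2) q(1) by (auto simp: cylinder_def p_def)
      ultimately show ?thesis using m(2) by blast
    qed
    then show ?case using m(1) by (intro exI[of _ "max m m'"]) (auto intro!: exI[of _ q])
  qed
  obtain m a where m: "m \<ge> k" "\<And>q. \<forall>i\<in>{k..<m}. q i = a i \<Longrightarrow> map q [0..<k] \<in> {t. length t = k} \<Longrightarrow> q \<notin> N"
    using block[of "{t. set t \<subseteq> UNIV \<and> length t = k}"] finite_lists_length_eq[of "UNIV::'c set" k]
    by auto
  obtain cs :: "'c list" where cs: "set cs = UNIV" using finite_list[OF finite] by blast
  then have "cs \<noteq> []" by auto
  \<comment> \<open>Behind the avoiding block, list all letters once.\<close>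
  define b where "b i = (if i < m then a i else cs ! (i - m))" for i
  have "\<exists>i\<in>{k..<m + length cs}. b i = c" for c
  proof -
    obtain j where "j < length cs" "cs ! j = c" using cs by (metis UNIV_I in_set_conv_nth)
    then show ?thesis by (intro bexI[of _ "m + j"]) (use m(1) in \<open>auto simp: b_def\<close>)
  qed
  moreover have "q \<notin> N" if "\<forall>i\<in>{k..<m + length cs}. q i = b i" for q
    using that by (intro m(2)) (auto simp: b_def)
  moreover have "k < m + length cs" using m(1) \<open>cs \<noteq> []\<close> by (cases cs) auto
  ultimately show ?thesis by (intro exI[of _ "m + length cs"] conjI exI[of _ b]) auto
qed

text \<open>
  If \<open>M\<close> is covered by an increasing sequence of nowhere dense sets, let the block number \<open>n\<close> lead out
  of the \<open>n\<close>-th of them, whatever comes before it. A point that matches infinitely many blocks is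
  outside all of them.
\<close>

lemma meager_avoiding_pattern:
  fixes M :: "(nat \<Rightarrow> 'c::finite) set"
  assumes "meager M"
  obtains f a where "strict_mono f" "f 0 = k" "\<And>n c. \<exists>i\<in>{f n..<f (Suc n)}. a i = c"
    "\<And>q. infinite {n. matches f a n q} \<Longrightarrow> q \<notin> M"
proof -
  obtain N where N: "\<And>k. nowhere_dense (N k)" "M \<subseteq> (\<Union>k::nat. N k)"
    using assms unfolding meager_def by metis
  define N' where "N' n = (\<Union>i\<le>n. N i)" for n
  have nd: "nowhere_dense (N' n)" for n
    unfolding N'_def by (induction n) (auto simp: atMost_Suc N intro: nowhere_dense_Un)
  define good where "good n k m a \<longleftrightarrow> (\<forall>c. \<exists>i\<in>{k..<m}. a i = c) \<and>
      (\<forall>q. (\<forall>i\<in>{k..<m}. q i = a i) \<longrightarrow> q \<notin> N' n)" for n k m and a :: "nat \<Rightarrow> 'c"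
  have "\<forall>n k. \<exists>m. k < m \<and> (\<exists>a. good n k m a)"
    using nowhere_dense_avoiding_block[OF nd] unfolding good_def by blast
  then obtain g where g: "\<And>n k. g n k > k" "\<And>n k. \<exists>a. good n k (g n k) a" by metis
  define f where "f = rec_nat k (\<lambda>n m. g n m)"
  have f: "f 0 = k" "\<And>n. f (Suc n) = g n (f n)" by (auto simp: f_def)
  have sm: "strict_mono f" by (rule strict_mono_Suc_iff[THEN iffD2]) (simp add: f g)
  have "\<forall>n. \<exists>b. good n (f n) (f (Suc n)) b"
    using g(2) by (simp add: f)
  then obtain b where "\<And>n. good n (f n) (f (Suc n)) (b n)" by metis
  then have b: "\<And>n c. \<exists>i\<in>{f n..<f (Suc n)}. b n i = c"
    "\<And>n q. \<forall>i\<in>{f n..<f (Suc n)}. q i = b n i \<Longrightarrow> q \<notin> N' n"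
    unfolding good_def by blast+
  define a where "a i = b (THE n. i \<in> {f n..<f (Suc n)}) i" for i
  have a: "a i = b n i" if "i \<in> {f n..<f (Suc n)}" for i n
  proof -
    have "(THE n. i \<in> {f n..<f (Suc n)}) = n"
    proof (rule the_equality[where P = "\<lambda>n. i \<in> {f n..<f (Suc n)}", OF that])
      fix n' assume n': "i \<in> {f n'..<f (Suc n')}"
      have "\<not> n' < n" "\<not> n < n'"
        using that n' strict_mono_less_eq[OF sm, of "Suc n" n'] strict_mono_less_eq[OF sm, of "Suc n'" n]
        by auto
      then show "n' = n" by simp
    qed
    then show ?thesis by (simp add: a_def)
  qed
  show ?thesis
  proof (rule that[OF sm f(1)])
    show "\<exists>i\<in>{f n..<f (Suc n)}. a i = c" for n c using b(1)[of n c] a by metis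
    fix q assume inf: "infinite {n. matches f a n q}"
    show "q \<notin> M"
    proof
      assume "q \<in> M"
      then obtain j where "q \<in> N j" using N(2) by blast
      obtain n where n: "n > j" "matches f a n q" using inf by (auto simp: infinite_nat_iff_unbounded)
      then have "q \<notin> N' n" using a by (intro b(2)) (auto simp: matches_def)
      then show False using \<open>q \<in> N j\<close> n(1) by (auto simp: N'_def)
    qed
  qed
qed


section \<open>The topology of the Cantor space and perfect sets avoiding meager sets\<close>

lemma open_coordinate: "open {q :: nat \<Rightarrow> bool. q i = b}"
proof -
  have "open ((\<lambda>q :: nat \<Rightarrow> bool. q i) -` {b})"
    by (intro open_vimage continuous_on_product_coordinates open_discrete)
  then show ?thesis by (simp add: vimage_def)
qed

lemma open_finitely_many_coordinates:
  assumes "finite F" shows "open {q :: nat \<Rightarrow> bool. \<forall>i\<in>F. q i = p i}"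
proof -
  have "open (\<Inter>i\<in>F. {q :: nat \<Rightarrow> bool. q i = p i})"
    using assms by (intro open_INT ballI open_coordinate)
  also have "(\<Inter>i\<in>F. {q :: nat \<Rightarrow> bool. q i = p i}) = {q. \<forall>i\<in>F. q i = p i}" by auto
  finally show ?thesis .
qed

lemma open_contains_cylinder:
  fixes U :: "(nat \<Rightarrow> bool) set"
  assumes "open U" "p \<in> U"
  shows "\<exists>n. cylinder n p \<subseteq> U"
proof -
  obtain V where V: "p \<in> Pi\<^sub>E UNIV V" "finite {i. V i \<noteq> topspace euclidean}" "Pi\<^sub>E UNIV V \<subseteq> U"
    using product_topology_open_contains_basis[of "\<lambda>_::nat. euclidean :: bool topology" UNIV U p] assms
    unfolding open_fun_def by blast
  obtain n where n: "\<And>i. V i \<noteq> UNIV \<Longrightarrow> i < n"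
    using V(2) finite_nat_iff_bounded by (auto simp: subset_iff)
  have "cylinder n p \<subseteq> Pi\<^sub>E UNIV V"
  proof
    fix q assume q: "q \<in> cylinder n p"
    have "q i \<in> V i" for i
    proof (cases "V i = UNIV")
      case False
      then have "q i = p i" using n q by (simp add: cylinder_def)
      then show ?thesis using V(1) by (auto simp: PiE_def)
    qed simp
    then show "q \<in> Pi\<^sub>E UNIV V" by (simp add: PiE_UNIV_domain)
  qed
  then show ?thesis using V(3) by blast
qed

lemma compact_Cantor_space: "compact (UNIV :: (nat \<Rightarrow> bool) set)"
proof -
  have "compact_space (euclidean :: bool topology)"
    by (simp add: compact_space_def finite_imp_compact)
  then have "compact_space (product_topology (\<lambda>_::nat. euclidean :: bool topology) UNIV)"
    by (simp add: compact_space_product_topology)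
  then show ?thesis by (simp add: euclidean_product_topology compact_space_def)
qed

text \<open>
  Two different points are separated by the values of a coordinate in which they differ.
\<close>

lemma compact_imp_closed_Cantor_space:
  fixes S :: "(nat \<Rightarrow> bool) set"
  assumes "compact S" shows "closed S"
proof -
  have "Hausdorff_space (euclidean :: (nat \<Rightarrow> bool) topology)"
    unfolding Hausdorff_space_def
  proof (intro allI impI)
    fix p q :: "nat \<Rightarrow> bool"
    assume "p \<in> topspace euclidean \<and> q \<in> topspace euclidean \<and> p \<noteq> q"
    then obtain i where "p i \<noteq> q i" by auto
    then have "openin euclidean {r. r i = p i}" "openin euclidean {r. r i = q i}"
      "p \<in> {r. r i = p i}" "q \<in> {r. r i = q i}" "disjnt {r. r i = p i} {r. r i = q i}"
      by (auto simp: open_coordinate disjnt_def open_openin[symmetric])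
    then show "\<exists>U V. openin euclidean U \<and> openin euclidean V \<and> p \<in> U \<and> q \<in> V \<and> disjnt U V"
      by (intro exI[of _ "{r. r i = p i}"] exI[of _ "{r. r i = q i}"] conjI)
  qed
  then have "closedin euclidean S" by (rule compactin_imp_closedin) (simp add: assms)
  then show ?thesis by (simp only: closed_closedin)
qed

text \<open>
  Later blocks lie arbitrarily far out since \<open>n \<le> f n\<close>.
\<close>

lemma infinite_if_meets_infinitely_many_blocks:
  assumes "strict_mono (f :: nat \<Rightarrow> nat)" "infinite N" "\<And>n. n \<in> N \<Longrightarrow> \<exists>i\<in>{f n..<f (Suc n)}. i \<in> A"
  shows "infinite A"
  unfolding infinite_nat_iff_unbounded_le
proof
  fix m
  obtain n where "n \<ge> m" "n \<in> N" using assms(2) unfolding infinite_nat_iff_unbounded_le by blast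
  moreover from this obtain i where "i \<ge> f n" "i \<in> A" using assms(3)[of n] by auto
  moreover have "f n \<ge> n" using assms(1) by (rule strict_mono_imp_increasing)
  ultimately show "\<exists>i\<ge>m. i \<in> A" by (meson order_trans)
qed

text \<open>
  Take a pattern of pairs that avoids \<open>M\<close>, and let every block be assigned a pair of words \<open>(u, v)\<close>,
  each pair to infinitely many blocks. The set coded by a sequence \<open>x\<close> follows, on such a block, the
  first coordinate of the pattern if \<open>x\<close> begins with \<open>u\<close>, and the second one if \<open>x\<close> begins with \<open>v\<close>.
  Two different sequences begin with different words of equal length, so the two sets coded by them
  together match the pattern of pairs on infinitely many blocks. The coding is continuous and
  injective, hence its image of the compact Cantor space is perfect.
\<close>

theorem perfect_set_avoiding_meager:
  fixes M :: "(nat \<Rightarrow> bool \<times> bool) set"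
  assumes "meager M"
  shows "\<exists>P :: nat set set. perfect_set (char_fun ` P) \<and> (\<forall>A\<in>P. infinite A) \<and>
    (\<forall>A\<in>P. \<forall>B\<in>P. A \<noteq> B \<longrightarrow> (\<lambda>i. (i \<in> A, i \<in> B)) \<notin> M)"
proof -
  obtain f a where sm: "strict_mono f" and "f 0 = (0::nat)"
    and a: "\<And>n c. \<exists>i\<in>{f n..<f (Suc n)}. a i = c"
    and avoid: "\<And>q. infinite {n. matches f a n q} \<Longrightarrow> q \<notin> M"
    by (rule meager_avoiding_pattern[OF assms]) (rule that)
  define block where "block i = (LEAST n. i < f (Suc n))" for i
  have block: "block i = n" if "i \<in> {f n..<f (Suc n)}" for i n
    unfolding block_def
  proof (rule Least_equality)
    show "i < f (Suc n)" using that by simp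
    fix m assume "i < f (Suc m)"
    then have "f n < f (Suc m)" using that by simp
    then show "n \<le> m" using strict_mono_less[OF sm] by simp
  qed
  define ext where "ext x u \<longleftrightarrow> map x [0..<length u] = u" for x and u :: "bool list"
  define code :: "nat \<Rightarrow> bool list \<times> bool list \<times> nat" where "code = from_nat"
  define g where "g x i = (case code (block i) of (u, v, k) \<Rightarrow>
    if ext x u then fst (a i) else ext x v \<and> snd (a i))" for x i
  have pair: "\<exists>N. infinite N \<and> (\<forall>n\<in>N. \<forall>i\<in>{f n..<f (Suc n)}. g x i = fst (a i) \<and> g y i = snd (a i))"
    if xy: "x \<noteq> y" for x y
  proof -
    obtain m where m: "x m \<noteq> y m" using xy by auto
    let ?u = "map x [0..<Suc m]" and ?v = "map y [0..<Suc m]"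
    let ?N = "range (\<lambda>k. to_nat (?u, ?v, k :: nat))"
    have "inj (\<lambda>k. to_nat (?u, ?v, k :: nat))" by (rule injI) simp
    then have "infinite ?N" by (rule range_inj_infinite)
    moreover have "g x i = fst (a i) \<and> g y i = snd (a i)" if "n \<in> ?N" "i \<in> {f n..<f (Suc n)}" for n i
    proof -
      obtain k :: nat where "n = to_nat (?u, ?v, k)" using \<open>n \<in> ?N\<close> by (rule rangeE) (rule that)
      then have c: "code (block i) = (?u, ?v, k)" using block[OF that(2)] by (simp add: code_def)
      have "ext x ?u" "ext y ?v" "\<not> ext y ?u" using m by (auto simp: ext_def)
      then show ?thesis unfolding g_def c by simp
    qed
    ultimately show ?thesis by blast
  qed
  have g_inf: "infinite {i. g x i}" for x
  proof -
    have "x \<noteq> (\<lambda>i. \<not> x i)" by (auto simp: fun_eq_iff)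
    from pair[OF this] obtain N where N: "infinite N" "\<And>n i. n \<in> N \<Longrightarrow> i \<in> {f n..<f (Suc n)} \<Longrightarrow> g x i = fst (a i)"
      by blast
    show ?thesis
    proof (rule infinite_if_meets_infinitely_many_blocks[OF sm N(1)])
      fix n assume "n \<in> N"
      then show "\<exists>i\<in>{f n..<f (Suc n)}. i \<in> {i. g x i}"
        using a[of n "(True, True)"] N(2) by fastforce
    qed
  qed
  have g_inj: "g x \<noteq> g y" if xy: "x \<noteq> y" for x y
  proof -
    obtain N where N: "infinite N" "\<forall>n\<in>N. \<forall>i\<in>{f n..<f (Suc n)}. g x i = fst (a i) \<and> g y i = snd (a i)"
      using pair[OF xy] by blast
    then obtain n where "n \<in> N" using infinite_imp_nonempty by blast
    then show ?thesis using a[of n "(True, False)"] N(2) by fastforce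
  qed
  have g_avoid: "(\<lambda>i. (g x i, g y i)) \<notin> M" if xy: "x \<noteq> y" for x y
  proof (rule avoid)
    obtain N where N: "infinite N" "\<forall>n\<in>N. \<forall>i\<in>{f n..<f (Suc n)}. g x i = fst (a i) \<and> g y i = snd (a i)"
      using pair[OF xy] by blast
    have "N \<subseteq> {n. matches f a n (\<lambda>i. (g x i, g y i))}"
      using N(2) by (auto simp: matches_def)
    then show "infinite {n. matches f a n (\<lambda>i. (g x i, g y i))}" using N(1) finite_subset by blast
  qed
  have g_local: "\<exists>n. \<forall>y\<in>cylinder n x. g y i = g x i" for x i
  proof -
    obtain u v k where c: "code (block i) = (u, v, k)" by (cases "code (block i)")
    have "g y i = g x i" if "y \<in> cylinder (length u + length v) x" for y
    proof -
      have "map y [0..<length u] = map x [0..<length u]" "map y [0..<length v] = map x [0..<length v]"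
        using that by (simp_all add: cylinder_def)
      then have "ext y u = ext x u" "ext y v = ext x v" by (simp_all only: ext_def)
      then show ?thesis unfolding g_def c by simp
    qed
    then show ?thesis by blast
  qed
  have cont: "continuous_on UNIV g"
  proof (rule continuous_on_coordinatewise_then_product)
    fix i
    have "open ((\<lambda>x. g x i) -` B)" for B
    proof (subst open_subopen, intro ballI)
      fix x assume x: "x \<in> (\<lambda>x. g x i) -` B"
      obtain n where n: "\<And>y. y \<in> cylinder n x \<Longrightarrow> g y i = g x i" using g_local by blast
      have o: "open (cylinder n x)"
        using open_finitely_many_coordinates[of "{..<n}" x] by (simp add: cylinder_def Ball_def)
      show "\<exists>T. open T \<and> x \<in> T \<and> T \<subseteq> (\<lambda>x. g x i) -` B"
      proof (intro exI conjI)
        show "cylinder n x \<subseteq> (\<lambda>x. g x i) -` B"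
        proof
          fix y assume "y \<in> cylinder n x"
          then have "g y i = g x i" by (rule n)
          then show "y \<in> (\<lambda>x. g x i) -` B" using x by simp
        qed
      qed (simp_all add: o)
    qed
    then show "continuous_on UNIV (\<lambda>x. g x i)" by (simp add: continuous_on_open_vimage)
  qed
  let ?P = "range (\<lambda>x. {i. g x i})"
  have P: "char_fun ` ?P = range g" by (simp add: char_fun_def image_image)
  have "perfect_set (range g)"
    unfolding perfect_set_def
  proof (intro conjI ballI)
    show "closed (range g)"
      by (rule compact_imp_closed_Cantor_space[OF compact_continuous_image[OF cont compact_Cantor_space]])
    fix p assume "p \<in> range g"
    then obtain x where p: "p = g x" by blast
    show "p islimpt range g"
    proof (rule islimptI)
      fix U assume "p \<in> U" "open U"
      then have "open (g -` U)" "x \<in> g -` U"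
        using cont p by (auto simp: continuous_on_open_vimage)
      then obtain n where n: "cylinder n x \<subseteq> g -` U" using open_contains_cylinder by blast
      have "x(n := \<not> x n) \<in> cylinder n x" by (simp add: cylinder_def)
      moreover have "x(n := \<not> x n) \<noteq> x" by (metis fun_upd_same)
      ultimately show "\<exists>y\<in>range g. y \<in> U \<and> y \<noteq> p"
        using n g_inj p by blast
    qed
  qed simp
  then have "perfect_set (char_fun ` ?P)" by (simp only: P)
  moreover have "\<forall>A\<in>?P. infinite A" using g_inf by blast
  moreover have "\<forall>A\<in>?P. \<forall>B\<in>?P. A \<noteq> B \<longrightarrow> (\<lambda>i. (i \<in> A, i \<in> B)) \<notin> M"
  proof clarify
    fix x y assume "{i. g x i} \<noteq> {i. g y i}" and M: "(\<lambda>i. (i \<in> {i. g x i}, i \<in> {i. g y i})) \<in> M"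
    then have "x \<noteq> y" by blast
    then show False using g_avoid M by simp
  qed
  ultimately show ?thesis by (intro exI[of _ ?P] conjI)
qed

lemma residual_matching_infinitely_often:
  assumes sm: "strict_mono f"
  shows "residual {q :: nat \<Rightarrow> bool. infinite {n. matches f a n q}}"
  unfolding residual_def
proof (intro exI conjI allI)
  let ?U = "\<lambda>n. {q :: nat \<Rightarrow> bool. \<exists>m\<ge>n. matches f a m q}"
  show "open (?U n)" for n
  proof -
    have "open (\<Union>m\<in>{n..}. {q. \<forall>i\<in>{f m..<f (Suc m)}. q i = a i})"
      by (intro open_UN ballI open_finitely_many_coordinates) auto
    also have "(\<Union>m\<in>{n..}. {q. \<forall>i\<in>{f m..<f (Suc m)}. q i = a i}) = ?U n" by (auto simp: matches_def)
    finally show ?thesis .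
  qed
  show "closure (?U n) = UNIV" for n
  proof -
    have "p \<in> closure (?U n)" for p
      unfolding closure_iff_nhds_not_empty
    proof clarify
      fix V V' assume "?U n \<inter> V = {}" "V' \<subseteq> V" "p \<in> V'" "open V'"
      obtain k where "cylinder k p \<subseteq> V'" using open_contains_cylinder[OF \<open>open V'\<close> \<open>p \<in> V'\<close>] ..
      then have k: "cylinder k p \<subseteq> V" using \<open>V' \<subseteq> V\<close> by (rule subset_trans)
      let ?m = "max n k"
      let ?q = "\<lambda>i. if i < f ?m then p i else a i"
      have "k \<le> f ?m" using strict_mono_imp_increasing[OF sm, of ?m] by simp
      then have "?q \<in> cylinder k p" by (simp add: cylinder_def)
      moreover have "?q \<in> ?U n" by (auto simp: matches_def intro!: exI[of _ ?m])
      ultimately show False using k \<open>?U n \<inter> V = {}\<close> by blast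
    qed
    then show ?thesis by blast
  qed
  show "(\<Inter>n. ?U n) \<subseteq> {q. infinite {n. matches f a n q}}"
    by (auto simp: infinite_nat_iff_unbounded_le)
qed


section \<open>Quantitative isomorphisms as linear relations\<close>

text \<open>
  An isomorphism is represented by its graph, a linear relation. Composition and inverse then become
  composition and converse of relations, and an isomorphism given on dense subspaces extends to their
  closures by taking the closure of the graph (\<open>iso_within_closure\<close>). The bounds force the relation
  to be the graph of an injective map.
\<close>

definition iso_within ::
  "real \<Rightarrow> 'a::real_normed_vector set \<Rightarrow> 'b::real_normed_vector set \<Rightarrow> bool" where
  "iso_within K Y Z \<longleftrightarrow> (\<exists>G. subspace G \<and> Domain G = Y \<and> Range G = Z \<and>
     (\<forall>(x, y)\<in>G. norm y \<le> K * norm x \<and> norm x \<le> K * norm y))"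

lemma iso_withinI:
  assumes "subspace G" "Domain G = Y" "Range G = Z"
    "\<And>x y. (x, y) \<in> G \<Longrightarrow> norm y \<le> K * norm x" "\<And>x y. (x, y) \<in> G \<Longrightarrow> norm x \<le> K * norm y"
  shows "iso_within K Y Z"
  using assms unfolding iso_within_def by blast

lemma iso_withinE:
  assumes "iso_within K Y Z"
  obtains G where "subspace G" "Domain G = Y" "Range G = Z"
    "\<And>x y. (x, y) \<in> G \<Longrightarrow> norm y \<le> K * norm x" "\<And>x y. (x, y) \<in> G \<Longrightarrow> norm x \<le> K * norm y"
  using assms unfolding iso_within_def by blast

lemma iso_within_sym: "iso_within K Y Z \<Longrightarrow> iso_within K Z Y"
proof (elim iso_withinE)
  fix G assume G: "subspace G" "Domain G = Y" "Range G = Z"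
    "\<And>x y. (x, y) \<in> G \<Longrightarrow> norm y \<le> K * norm x" "\<And>x y. (x, y) \<in> G \<Longrightarrow> norm x \<le> K * norm y"
  have "subspace (G\<inverse>)"
    using G(1) by (fastforce simp: subspace_def zero_prod_def)
  then show ?thesis by (rule iso_withinI) (use G in auto)
qed

lemma iso_within_mono: 
  fixes Y :: "'a::real_normed_vector set" and Z :: "'b::real_normed_vector set"
  assumes "iso_within K Y Z" "K \<le> L" shows "iso_within L Y Z"
proof (rule iso_withinE[OF assms(1)])
  fix G assume G: "subspace G" "Domain G = Y" "Range G = Z"
    "\<And>x y. (x, y) \<in> G \<Longrightarrow> norm y \<le> K * norm x" "\<And>x y. (x, y) \<in> G \<Longrightarrow> norm x \<le> K * norm y"
  have le: "K * norm x \<le> L * norm x" "K * norm y \<le> L * norm y" for x :: 'a and y :: 'b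
    using assms(2) by (auto intro: mult_right_mono)
  show ?thesis
    by (intro iso_withinI[OF G(1-3)] order_trans[OF _ le(1)] order_trans[OF _ le(2)] G(4,5))
qed

lemma iso_within_refl:
  assumes "subspace Y" shows "iso_within 1 Y Y"
  by (rule iso_withinI[of "Id_on Y"]) 
    (use assms in \<open>auto simp: subspace_def zero_prod_def\<close>)

lemma iso_within_trans:
  assumes "iso_within K Y Z" "iso_within L Z W" "0 \<le> K" "0 \<le> L"
  shows "iso_within (K * L) Y W"
proof -
  obtain G where G: "subspace G" "Domain G = Y" "Range G = Z"
    "\<And>x y. (x, y) \<in> G \<Longrightarrow> norm y \<le> K * norm x" "\<And>x y. (x, y) \<in> G \<Longrightarrow> norm x \<le> K * norm y"
    by (rule iso_withinE[OF assms(1)]) (rule that, assumption+)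
  obtain H where H: "subspace H" "Domain H = Z" "Range H = W"
    "\<And>x y. (x, y) \<in> H \<Longrightarrow> norm y \<le> L * norm x" "\<And>x y. (x, y) \<in> H \<Longrightarrow> norm x \<le> L * norm y"
    by (rule iso_withinE[OF assms(2)]) (rule that, assumption+)
  show ?thesis
  proof (rule iso_withinI[of "G O H"])
    show "subspace (G O H)"
      unfolding subspace_def
    proof (intro conjI ballI allI)
      show "0 \<in> G O H"
        using subspace_0[OF G(1)] subspace_0[OF H(1)] by (auto simp: zero_prod_def)
      show "p + q \<in> G O H" if pq: "p \<in> G O H" "q \<in> G O H" for p q
      proof -
        obtain x y z where p: "p = (x, z)" "(x, y) \<in> G" "(y, z) \<in> H" using pq(1) by blast
        obtain x' y' z' where q: "q = (x', z')" "(x', y') \<in> G" "(y', z') \<in> H" using pq(2) by blast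
        have "(x + x', y + y') \<in> G" "(y + y', z + z') \<in> H"
          using subspace_add[OF G(1) p(2) q(2)] subspace_add[OF H(1) p(3) q(3)] by simp_all
        then show ?thesis using p(1) q(1) by auto
      qed
      show "c *\<^sub>R p \<in> G O H" if p: "p \<in> G O H" for c p
      proof -
        obtain x y z where p: "p = (x, z)" "(x, y) \<in> G" "(y, z) \<in> H" using p by blast
        have "(c *\<^sub>R x, c *\<^sub>R y) \<in> G" "(c *\<^sub>R y, c *\<^sub>R z) \<in> H"
          using subspace_scale[OF G(1) p(2), of c] subspace_scale[OF H(1) p(3), of c] by simp_all
        then show ?thesis using p(1) by auto
      qed
    qed
    show "Domain (G O H) = Y" "Range (G O H) = W" using G H by blast+
    fix x z assume "(x, z) \<in> G O H"
    then obtain y where y: "(x, y) \<in> G" "(y, z) \<in> H" by blast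
    have "norm z \<le> L * (K * norm x)"
      using H(4)[OF y(2)] G(4)[OF y(1)] assms(4) by (meson mult_left_mono order_trans)
    then show "norm z \<le> K * L * norm x" by (simp add: ac_simps)
    have "norm x \<le> K * (L * norm z)"
      using G(5)[OF y(1)] H(5)[OF y(2)] assms(3) by (meson mult_left_mono order_trans)
    then show "norm x \<le> K * L * norm z" by (simp add: ac_simps)
  qed
qed

lemma norm_Pair_le_scale:
  assumes "norm x \<le> K * norm y" "norm x' \<le> K * norm y'" "0 \<le> K"
  shows "norm (x, x') \<le> K * norm (y, y')"
proof -
  have "sqrt ((norm x)\<^sup>2 + (norm x')\<^sup>2) \<le> sqrt ((K * norm y)\<^sup>2 + (K * norm y')\<^sup>2)"
    using assms by (intro real_sqrt_le_mono add_mono power_mono) auto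
  also have "\<dots> = K * sqrt ((norm y)\<^sup>2 + (norm y')\<^sup>2)"
    using assms(3) by (simp add: power_mult_distrib distrib_left[symmetric] real_sqrt_mult)
  finally show ?thesis by (simp add: norm_Pair)
qed

lemma iso_within_Times:
  assumes "iso_within K Y Z" "iso_within K Y' Z'" "0 \<le> K"
  shows "iso_within K (Y \<times> Y') (Z \<times> Z')"
proof -
  obtain G where G: "subspace G" "Domain G = Y" "Range G = Z"
    "\<And>x y. (x, y) \<in> G \<Longrightarrow> norm y \<le> K * norm x" "\<And>x y. (x, y) \<in> G \<Longrightarrow> norm x \<le> K * norm y"
    by (rule iso_withinE[OF assms(1)]) (rule that, assumption+)
  obtain H where H: "subspace H" "Domain H = Y'" "Range H = Z'"
    "\<And>x y. (x, y) \<in> H \<Longrightarrow> norm y \<le> K * norm x" "\<And>x y. (x, y) \<in> H \<Longrightarrow> norm x \<le> K * norm y"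
    by (rule iso_withinE[OF assms(2)]) (rule that, assumption+)
  show ?thesis
  proof (rule iso_withinI)
    let ?P = "{((x, x'), (y, y')) |x x' y y'. (x, y) \<in> G \<and> (x', y') \<in> H}"
    show "subspace ?P"
      unfolding subspace_def
    proof (intro conjI ballI allI)
      show "0 \<in> ?P"
        using subspace_0[OF G(1)] subspace_0[OF H(1)] by (auto simp: zero_prod_def)
      show "p + q \<in> ?P" if "p \<in> ?P" "q \<in> ?P" for p q
        using that subspace_add[OF G(1)] subspace_add[OF H(1)] by fastforce
      show "c *\<^sub>R p \<in> ?P" if "p \<in> ?P" for c p
        using that subspace_scale[OF G(1)] subspace_scale[OF H(1)] by fastforce
    qed
    show "Domain ?P = Y \<times> Y'" "Range ?P = Z \<times> Z'" unfolding G(2,3)[symmetric] H(2,3)[symmetric] by (auto simp: Domain_iff Range_iff)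
    show "norm q \<le> K * norm p" "norm p \<le> K * norm q" if "(p, q) \<in> ?P" for p q
      using that G(4,5) H(4,5) assms(3) by (auto intro!: norm_Pair_le_scale)
  qed
qed

lemma iso_within_Times_assoc:
  assumes "subspace Y" "subspace Z" "subspace W"
  shows "iso_within 1 ((Y \<times> Z) \<times> W) (Y \<times> (Z \<times> W))"
proof (rule iso_withinI)
  let ?P = "{(((x, y), z), (x, (y, z))) |x y z. x \<in> Y \<and> y \<in> Z \<and> z \<in> W}"
  show "subspace ?P"
    using assms by (fastforce simp: subspace_def zero_prod_def)
  show "Domain ?P = (Y \<times> Z) \<times> W" "Range ?P = Y \<times> (Z \<times> W)" by auto
  show "norm q \<le> 1 * norm p" "norm p \<le> 1 * norm q" if "(p, q) \<in> ?P" for p q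
    using that by (auto simp: norm_Pair)
qed

lemma closure_of_subspace:
  fixes S :: "'a::real_normed_vector set"
  assumes "subspace S" shows "subspace (closure S)"
  unfolding subspace_def
proof (intro conjI ballI allI)
  show "0 \<in> closure S" using subspace_0[OF assms] closure_subset by blast
  show "x + y \<in> closure S" if xy: "x \<in> closure S" "y \<in> closure S" for x y
  proof -
    obtain u v where u: "\<And>n. u n \<in> S" "u \<longlonglongrightarrow> x" and v: "\<And>n. v n \<in> S" "v \<longlonglongrightarrow> y"
      using xy unfolding closure_sequential by blast
    have "(\<lambda>n. u n + v n) \<longlonglongrightarrow> x + y" using u v by (intro tendsto_add)
    then show ?thesis unfolding closure_sequential
      using subspace_add[OF assms u(1) v(1)] by (intro exI[of _ "\<lambda>n. u n + v n"]) auto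
  qed
  show "c *\<^sub>R x \<in> closure S" if x: "x \<in> closure S" for c x
  proof -
    obtain u where u: "\<And>n. u n \<in> S" "u \<longlonglongrightarrow> x" using x unfolding closure_sequential by blast
    have "(\<lambda>n. c *\<^sub>R u n) \<longlonglongrightarrow> c *\<^sub>R x" using u by (intro tendsto_intros)
    then show ?thesis unfolding closure_sequential
      using subspace_scale[OF assms u(1)] by (intro exI[of _ "\<lambda>n. c *\<^sub>R u n"]) auto
  qed
qed

text \<open>
  If the first components of a sequence in \<open>S\<close> converge, the bound makes the second components a
  Cauchy sequence.
\<close>

lemma fst_closure_bounded_below:
  fixes S :: "('a::banach \<times> 'b::banach) set"
  assumes S: "subspace S" and le: "\<And>x y. (x, y) \<in> S \<Longrightarrow> norm y \<le> K * norm x"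
  shows "fst ` closure S = closure (fst ` S)"
proof
  show "fst ` closure S \<subseteq> closure (fst ` S)"
    by (intro image_closure_subset continuous_on_fst continuous_on_id closure_subset closed_closure)
  show "closure (fst ` S) \<subseteq> fst ` closure S"
  proof
    fix x assume "x \<in> closure (fst ` S)"
    then obtain u where u: "\<And>n. u n \<in> fst ` S" "u \<longlonglongrightarrow> x"
      by (auto simp: closure_sequential)
    then have "\<exists>y. (u n, y) \<in> S" for n by force
    then obtain v where v: "\<And>n. (u n, v n) \<in> S" by metis
    have d: "norm (v m - v n) \<le> K * norm (u m - u n)" for m n
      using subspace_diff[OF S v[of m] v[of n]] le by auto
    have "Cauchy v"
    proof (rule CauchyI)
      fix e :: real assume "e > 0"
      then have "e / (\<bar>K\<bar> + 1) > 0" by (simp add: add_nonneg_pos)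
      moreover have "Cauchy u" using u(2) by (rule LIMSEQ_imp_Cauchy)
      ultimately obtain M where M: "\<And>m n. m \<ge> M \<Longrightarrow> n \<ge> M \<Longrightarrow> norm (u m - u n) < e / (\<bar>K\<bar> + 1)"
        using CauchyD by blast
      have "norm (v m - v n) < e" if "m \<ge> M" "n \<ge> M" for m n
      proof -
        have "norm (v m - v n) \<le> (\<bar>K\<bar> + 1) * norm (u m - u n)"
          by (rule order_trans[OF d]) (auto intro!: mult_right_mono)
        also have "\<dots> < e" using M[OF that] by (simp add: pos_less_divide_eq add_nonneg_pos mult.commute)
        finally show ?thesis .
      qed
      then show "\<exists>M. \<forall>m\<ge>M. \<forall>n\<ge>M. norm (v m - v n) < e" by blast
    qed
    then obtain y where "v \<longlonglongrightarrow> y" by (auto simp: Cauchy_convergent_iff convergent_def)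
    then have "(\<lambda>n. (u n, v n)) \<longlonglongrightarrow> (x, y)" using u(2) by (intro tendsto_Pair)
    then have "(x, y) \<in> closure S" unfolding closure_sequential using v by (intro exI[of _ "\<lambda>n. (u n, v n)"]) auto
    then show "x \<in> fst ` closure S" by force
  qed
qed

lemma iso_within_closure:
  fixes S :: "('a::banach \<times> 'b::banach) set"
  assumes S: "subspace S"
    and le: "\<And>x y. (x, y) \<in> S \<Longrightarrow> norm y \<le> K * norm x" "\<And>x y. (x, y) \<in> S \<Longrightarrow> norm x \<le> K * norm y"
  shows "iso_within K (closure (fst ` S)) (closure (snd ` S))"
proof (rule iso_withinI[of "closure S"])
  show "subspace (closure S)" using S by (rule closure_of_subspace)
  show "Domain (closure S) = closure (fst ` S)"
    by (simp add: Domain_fst fst_closure_bounded_below[OF S le(1)])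
  have swap: "prod.swap ` closure V \<subseteq> closure (prod.swap ` V)" for V :: "('c::topological_space \<times> 'd::topological_space) set"
    by (intro image_closure_subset continuous_on_swap closure_subset closed_closure)
  have "closure (snd ` S) = fst ` closure (prod.swap ` S)"
  proof (subst fst_closure_bounded_below)
    show "subspace (prod.swap ` S)"
      by (intro linear_subspace_image S) (auto intro!: linearI)
  qed (use le in \<open>auto simp: image_image\<close>)
  also have "\<dots> = snd ` prod.swap ` closure (prod.swap ` S)"
    by (simp add: image_image)
  also have "\<dots> \<subseteq> snd ` closure S"
    using swap[of "prod.swap ` S"] by (intro image_mono) (simp add: image_image)
  finally have "closure (snd ` S) \<subseteq> snd ` closure S" .
  moreover have "snd ` closure S \<subseteq> closure (snd ` S)"
    by (intro image_closure_subset continuous_on_snd continuous_on_id closure_subset closed_closure)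
  ultimately show "Range (closure S) = closure (snd ` S)"
    by (auto simp: Range_snd)
  have cl: "closed {p::'a\<times>'b. norm (snd p) \<le> K * norm (fst p)}" "closed {p::'a\<times>'b. norm (fst p) \<le> K * norm (snd p)}"
    by (intro closed_Collect_le continuous_intros)+
  have "closure S \<subseteq> {p. norm (snd p) \<le> K * norm (fst p)}" "closure S \<subseteq> {p. norm (fst p) \<le> K * norm (snd p)}"
    by (intro closure_minimal cl; use le in auto)+
  then show "norm y \<le> K * norm x" "norm x \<le> K * norm y" if "(x, y) \<in> closure S" for x y
    using that by auto
qed

lemma linear_continuous_on_imp_bounded:
  assumes "subspace Y" "linear_map_on Y T" "continuous_on Y T"
  shows "\<exists>K>0. \<forall>x\<in>Y. norm (T x) \<le> K * norm x"
proof -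
  have T0: "T 0 = 0"
  proof -
    have "T (0 *\<^sub>R 0) = 0 *\<^sub>R T 0" using assms(1,2) unfolding linear_map_on_def by (metis subspace_0)
    then show ?thesis by simp
  qed
  obtain d where d: "d > 0" "\<And>x. x \<in> Y \<Longrightarrow> dist x 0 < d \<Longrightarrow> dist (T x) (T 0) < 1"
    using assms(3) subspace_0[OF assms(1)] unfolding continuous_on_iff by (metis zero_less_one)
  have "norm (T x) \<le> (2 / d) * norm x" if x: "x \<in> Y" for x
  proof (cases "x = 0")
    case False
    let ?c = "d / (2 * norm x)"
    have "?c *\<^sub>R x \<in> Y" using x assms(1) by (rule subspace_scale[rotated])
    moreover have "norm (?c *\<^sub>R x) < d" using d(1) False by simp
    ultimately have "norm (T (?c *\<^sub>R x)) < 1" using d(2)[of "?c *\<^sub>R x"] T0 by simp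
    moreover have "T (?c *\<^sub>R x) = ?c *\<^sub>R T x" using assms(2) x unfolding linear_map_on_def by blast
    ultimately have "?c * norm (T x) < 1" using d(1) by simp
    then show ?thesis using d(1) False by (simp add: field_simps)
  qed (simp add: T0)
  then show ?thesis using d(1) by (intro exI[of _ "2 / d"]) auto
qed

lemma isomorphism_pair_inverse_linear:
  assumes "subspace Y" "isomorphism_pair Y Z T T'"
  shows "subspace Z" "linear_map_on Z T'"
proof -
  have T: "\<And>x y. x \<in> Y \<Longrightarrow> y \<in> Y \<Longrightarrow> T (x + y) = T x + T y" "\<And>c x. x \<in> Y \<Longrightarrow> T (c *\<^sub>R x) = c *\<^sub>R T x"
    and h: "T ` Y = Z" "T' ` Z = Y" "\<And>x. x \<in> Y \<Longrightarrow> T' (T x) = x" "\<And>y. y \<in> Z \<Longrightarrow> T (T' y) = y"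
    using assms(2) by (auto simp: isomorphism_pair_def linear_map_on_def homeomorphism_def)
  have Y: "0 \<in> Y" "\<And>x y. x \<in> Y \<Longrightarrow> y \<in> Y \<Longrightarrow> x + y \<in> Y" "\<And>c x. x \<in> Y \<Longrightarrow> c *\<^sub>R x \<in> Y"
    using assms(1) by (auto simp: subspace_def)
  have add: "T' (u + v) = T' u + T' v \<and> u + v \<in> Z" if "u \<in> Z" "v \<in> Z" for u v
  proof -
    obtain x y where "x \<in> Y" "y \<in> Y" "u = T x" "v = T y" using \<open>u \<in> Z\<close> \<open>v \<in> Z\<close> h(1) by blast
    then show ?thesis using h Y T(1)[symmetric] by auto
  qed
  have scale: "T' (c *\<^sub>R u) = c *\<^sub>R T' u \<and> c *\<^sub>R u \<in> Z" if "u \<in> Z" for c u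
  proof -
    have "u \<in> T ` Y" using that h(1) by simp
    then obtain x where "x \<in> Y" "u = T x" by blast
    then show ?thesis using h Y T(2)[symmetric] by auto
  qed
  show "linear_map_on Z T'" using add scale by (auto simp: linear_map_on_def)
  have "0 \<in> Z" using scale[of "T 0" 0] Y(1) h(1) by auto
  then show "subspace Z" using add scale by (auto simp: subspace_def)
qed

text \<open>
  The only content is that a continuous linear map on a subspace is bounded.
\<close>

lemma isomorphic_imp_iso_within:
  assumes "subspace Y" "isomorphic Y Z"
  shows "\<exists>K\<ge>1. iso_within K Y Z"
proof -
  obtain T T' where TT: "isomorphism_pair Y Z T T'" using assms(2) by (auto simp: isomorphic_def)
  have T: "linear_map_on Y T" "continuous_on Y T" "continuous_on Z T'"
    and h: "T ` Y = Z" "T' ` Z = Y" "\<And>x. x \<in> Y \<Longrightarrow> T' (T x) = x"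
    using TT by (auto simp: isomorphism_pair_def homeomorphism_def)
  obtain K where K: "K > 0" "\<And>x. x \<in> Y \<Longrightarrow> norm (T x) \<le> K * norm x"
    using linear_continuous_on_imp_bounded[OF assms(1) T(1,2)] by blast
  obtain L where L: "L > 0" "\<And>x. x \<in> Z \<Longrightarrow> norm (T' x) \<le> L * norm x"
    using linear_continuous_on_imp_bounded[OF isomorphism_pair_inverse_linear[OF assms(1) TT] T(3)] by blast
  let ?M = "max 1 (max K L)"
  have "iso_within ?M Y Z"
  proof (rule iso_withinI)
    let ?G = "(\<lambda>x. (x, T x)) ` Y"
    have "T 0 = 0" using K(2)[OF subspace_0[OF assms(1)]] by simp
    then show "subspace ?G"
      using assms(1) T(1) unfolding subspace_def linear_map_on_def
      by (force simp: zero_prod_def image_iff)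
    show "Domain ?G = Y" "Range ?G = Z" using h(1) by auto
    fix x y assume "(x, y) \<in> ?G"
    then have x: "x \<in> Y" "y = T x" by auto
    have le: "K * norm v \<le> ?M * norm v" "L * norm w \<le> ?M * norm w" for v :: 'a and w :: 'b
      by (intro mult_right_mono; simp)+
    show "norm y \<le> ?M * norm x"
      using K(2)[OF x(1)] x(2) le(1)[of x] by simp
    have "norm (T' (T x)) \<le> L * norm (T x)" using x h(1) by (intro L) auto
    then show "norm x \<le> ?M * norm y"
      using h(3)[OF x(1)] x(2) le(2)[of y] by simp
  qed
  then show ?thesis by (intro exI[of _ ?M]) auto
qed

lemma iso_within_imp_isomorphism_pair:
  assumes "iso_within K Y Z" "0 \<le> K"
  obtains T T' where "isomorphism_pair Y Z T T'" "\<And>x. x \<in> Y \<Longrightarrow> norm (T x) \<le> K * norm x"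
    "\<And>y. y \<in> Z \<Longrightarrow> norm (T' y) \<le> K * norm y"
proof -
  obtain G where G: "subspace G" "Domain G = Y" "Range G = Z"
    "\<And>x y. (x, y) \<in> G \<Longrightarrow> norm y \<le> K * norm x" "\<And>x y. (x, y) \<in> G \<Longrightarrow> norm x \<le> K * norm y"
    by (rule iso_withinE[OF assms(1)]) (rule that, assumption+)
  have uniq: "y = y'" if "(x, y) \<in> G" "(x, y') \<in> G" for x y y'
    using G(4)[of 0 "y - y'"] subspace_diff[OF G(1) that] by simp
  have uniq': "x = x'" if "(x, y) \<in> G" "(x', y) \<in> G" for x x' y
    using G(5)[of "x - x'" 0] subspace_diff[OF G(1) that] by simp
  obtain T where T: "\<And>x. x \<in> Y \<Longrightarrow> (x, T x) \<in> G" using bchoice[of Y "\<lambda>x y. (x, y) \<in> G"] G(2) by (metis Domain.cases)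
  obtain T' where T': "\<And>y. y \<in> Z \<Longrightarrow> (T' y, y) \<in> G" using bchoice[of Z "\<lambda>y x. (x, y) \<in> G"] G(3) by (metis Range.cases)
  have YZ: "(x, y) \<in> G \<Longrightarrow> x \<in> Y" "(x, y) \<in> G \<Longrightarrow> y \<in> Z" for x y using G(2,3) by auto
  have lin: "T (x + y) = T x + T y" "T (c *\<^sub>R x) = c *\<^sub>R T x" if "x \<in> Y" "y \<in> Y" for x y c
  proof -
    have "(x + y, T x + T y) \<in> G" "(c *\<^sub>R x, c *\<^sub>R T x) \<in> G"
      using subspace_add[OF G(1) T T, OF that] subspace_scale[OF G(1) T, OF that(1), of c] by auto
    then show "T (x + y) = T x + T y" "T (c *\<^sub>R x) = c *\<^sub>R T x" using T YZ uniq by metis+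
  qed
  have bd: "norm (T x - T y) \<le> K * norm (x - y)" if "x \<in> Y" "y \<in> Y" for x y
    using subspace_diff[OF G(1) T T, OF that] G(4) by auto
  have bd': "norm (T' x - T' y) \<le> K * norm (x - y)" if "x \<in> Z" "y \<in> Z" for x y
    using subspace_diff[OF G(1) T' T', OF that] G(5) by auto
  have "homeomorphism Y Z T T'"
    unfolding homeomorphism_def
  proof (intro conjI ballI)
    show "T' (T x) = x" if "x \<in> Y" for x using that T T' YZ uniq' by metis
    show "T (T' y) = y" if "y \<in> Z" for y using that T T' YZ uniq by metis
    show "T ` Y = Z"
    proof
      show "T ` Y \<subseteq> Z" using T YZ by blast
      show "Z \<subseteq> T ` Y" using T T' YZ uniq by (metis image_eqI subsetI)
    qed
    show "T' ` Z = Y"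
    proof
      show "T' ` Z \<subseteq> Y" using T' YZ by blast
      show "Y \<subseteq> T' ` Z" using T T' YZ uniq' by (metis image_eqI subsetI)
    qed
    have "K-lipschitz_on Y T" "K-lipschitz_on Z T'"
      using bd bd' assms(2) by (auto intro!: lipschitz_onI simp: dist_norm)
    then show "continuous_on Y T" "continuous_on Z T'" by (auto intro: lipschitz_on_continuous_on)
  qed
  then have "isomorphism_pair Y Z T T'"
    using lin by (auto simp: isomorphism_pair_def linear_map_on_def)
  then show ?thesis using that G(4)[OF T] G(5)[OF T'] by blast
qed

lemma iso_within_imp_isomorphic:
  assumes "iso_within K Y Z" shows "isomorphic Y Z"
  by (rule iso_within_imp_isomorphism_pair[OF iso_within_mono[OF assms, of "max 0 K"]])
    (auto simp: isomorphic_def)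

lemma iso_within_imp_K_isomorphic:
  assumes "iso_within K Y Z" "0 \<le> K"
  shows "K_isomorphic (K * K) Y Z"
proof -
  obtain T T' where T: "isomorphism_pair Y Z T T'" "\<And>x. x \<in> Y \<Longrightarrow> norm (T x) \<le> K * norm x"
    "\<And>y. y \<in> Z \<Longrightarrow> norm (T' y) \<le> K * norm y"
    by (rule iso_within_imp_isomorphism_pair[OF assms]) (rule that, assumption+)
  have onorm: "onorm_on V f \<le> K \<and> 0 \<le> onorm_on V f" if V: "0 \<in> V" "\<And>x. x \<in> V \<Longrightarrow> norm (f x) \<le> K * norm x"
    for V :: "'c::real_normed_vector set" and f :: "'c \<Rightarrow> 'd::real_normed_vector"
  proof -
    have le: "norm (f x) / norm x \<le> K" if "x \<in> V" for x
      using V(2)[OF that] assms(2) by (cases "x = 0") (auto simp: divide_le_eq)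
    then have "(SUP x\<in>V. norm (f x) / norm x) \<le> K" using V(1) by (intro cSUP_least) auto
    moreover have "norm (f 0) / norm (0::'c) \<le> (SUP x\<in>V. norm (f x) / norm x)"
      by (intro cSUP_upper V bdd_aboveI2[OF le])
    ultimately show ?thesis by (simp add: onorm_on_def)
  qed
  obtain G where G: "subspace G" "Domain G = Y" "Range G = Z" by (rule iso_withinE[OF assms(1)]) (rule that, assumption+)
  have "0 \<in> Y" "0 \<in> Z"
    using subspace_0[OF G(1)] G(2,3) by (auto simp: zero_prod_def)
  then have "onorm_on Y T * onorm_on Z T' \<le> K * K"
    using onorm[OF _ T(2)] onorm[OF _ T(3)] assms(2) by (intro mult_mono) auto
  then show ?thesis using T(1) by (auto simp: K_isomorphic_def)
qed

text \<open>
  One constant serves for all pairs of the two families. This relation can be used like an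
  equivalence in calculations, which keeps the constants out of sight.
\<close>

definition uniformly_isomorphic ::
  "'i set \<Rightarrow> ('i \<Rightarrow> 'a::real_normed_vector set) \<Rightarrow> ('i \<Rightarrow> 'b::real_normed_vector set) \<Rightarrow> bool" where
  "uniformly_isomorphic I Y Z \<longleftrightarrow> (\<exists>K\<ge>1. \<forall>i\<in>I. iso_within K (Y i) (Z i))"

lemma uniformly_isomorphic_sym: "uniformly_isomorphic I Y Z \<Longrightarrow> uniformly_isomorphic I Z Y"
  unfolding uniformly_isomorphic_def using iso_within_sym by blast

lemma uniformly_isomorphic_refl: "(\<And>i. i \<in> I \<Longrightarrow> subspace (Y i)) \<Longrightarrow> uniformly_isomorphic I Y Y"
  unfolding uniformly_isomorphic_def using iso_within_refl by (intro exI[of _ 1]) auto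

lemma uniformly_isomorphic_trans [trans]:
  assumes "uniformly_isomorphic I Y Z" "uniformly_isomorphic I Z W"
  shows "uniformly_isomorphic I Y W"
proof -
  obtain K L where K: "K \<ge> 1" "\<forall>i\<in>I. iso_within K (Y i) (Z i)" and L: "L \<ge> 1" "\<forall>i\<in>I. iso_within L (Z i) (W i)"
    using assms unfolding uniformly_isomorphic_def by blast
  have "K * L \<ge> 1" using K(1) L(1) by (metis mult_mono' mult_1 zero_le_one)
  moreover have "\<forall>i\<in>I. iso_within (K * L) (Y i) (W i)"
    using K L by (auto intro!: iso_within_trans[of K])
  ultimately show ?thesis unfolding uniformly_isomorphic_def by blast
qed

lemma uniformly_isomorphic_Times:
  assumes "uniformly_isomorphic I Y Z" "uniformly_isomorphic I Y' Z'"
  shows "uniformly_isomorphic I (\<lambda>i. Y i \<times> Y' i) (\<lambda>i. Z i \<times> Z' i)"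
proof -
  obtain K L where K: "K \<ge> 1" "\<forall>i\<in>I. iso_within K (Y i) (Z i)" and L: "L \<ge> 1" "\<forall>i\<in>I. iso_within L (Y' i) (Z' i)"
    using assms unfolding uniformly_isomorphic_def by blast
  then have "\<forall>i\<in>I. iso_within (max K L) (Y i \<times> Y' i) (Z i \<times> Z' i)"
    by (auto intro!: iso_within_Times intro: iso_within_mono)
  then show ?thesis using K(1) unfolding uniformly_isomorphic_def
    by (intro exI[of _ "max K L"]) auto
qed

lemma uniformly_isomorphic_Times_assoc:
  assumes "\<And>i. i \<in> I \<Longrightarrow> subspace (Y i)" "\<And>i. i \<in> I \<Longrightarrow> subspace (Z i)" "\<And>i. i \<in> I \<Longrightarrow> subspace (W i)"
  shows "uniformly_isomorphic I (\<lambda>i. (Y i \<times> Z i) \<times> W i) (\<lambda>i. Y i \<times> (Z i \<times> W i))"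
  unfolding uniformly_isomorphic_def using assms
  by (intro exI[of _ 1]) (auto intro!: iso_within_Times_assoc)


section \<open>Countably subadditive functionals on Banach spaces\<close>

text \<open>
  Zabreiko's lemma. By Baire's theorem the closure of some set \<open>{x. p x \<le> n}\<close> has interior points, so
  by homogeneity every \<open>x\<close> can be approximated arbitrarily well by points \<open>y\<close> with \<open>p y \<le> C * norm x\<close>.
  Iterating the approximation on the remainders writes \<open>x\<close> as the sum of a series to which countable
  subadditivity applies.
\<close>

lemma countably_subadditive_imp_bounded:
  fixes p :: "'a::banach \<Rightarrow> real"
  assumes nonneg: "\<And>x. 0 \<le> p x"
    and scale: "\<And>c x. p (c *\<^sub>R x) = \<bar>c\<bar> * p x"
    and csub: "\<And>u x. u sums x \<Longrightarrow> summable (\<lambda>k. p (u k)) \<Longrightarrow> p x \<le> (\<Sum>k. p (u k))"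
  shows "\<exists>C>0. \<forall>x. p x \<le> C * norm x"
proof -
  have p0: "p 0 = 0" using scale[of 0 0] by simp
  have add: "p (x + y) \<le> p x + p y" for x y
  proof -
    let ?u = "\<lambda>k::nat. if k = 0 then x else if k = 1 then y else 0"
    have "?u sums (\<Sum>k\<in>{0,1}. ?u k)" by (rule sums_finite) auto
    moreover have s: "(\<lambda>k. p (?u k)) sums (\<Sum>k\<in>{0,1}. p (?u k))" by (rule sums_finite) (auto simp: p0)
    ultimately show ?thesis using csub[of ?u "x + y"] sums_summable[OF s] sums_unique[OF s] by simp
  qed
  have minus: "p (x - y) \<le> p x + p y" for x y
    using add[of x "-y"] scale[of "-1" y] by simp
  define V where "V n = {x. p x \<le> real n}" for n :: nat
  have "\<exists>n. interior (closure (V n)) \<noteq> {}"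
  proof (rule ccontr)
    assume "\<not> ?thesis"
    then have "euclidean interior_of (\<Union> (range (\<lambda>n. closure (V n)))) = {}"
      by (intro Baire_category_alt disjI1 completely_metrizable_space_euclidean)
        (auto simp: closed_closedin[symmetric])
    moreover have "\<Union> (range (\<lambda>n. closure (V n))) = UNIV"
    proof -
      have "x \<in> (\<Union>n. closure (V n))" for x
      proof -
        obtain n where "p x \<le> real n" using real_arch_simple by blast
        then have "x \<in> V n" by (simp add: V_def)
        then show ?thesis using closure_subset by blast
      qed
      then show ?thesis by auto
    qed
    ultimately show False by simp
  qed
  then obtain n x0 where x0: "x0 \<in> interior (closure (V n))" by blast
  then obtain r where r: "r > 0" "ball x0 r \<subseteq> closure (V n)"
    by (metis mem_interior)
  have small: "\<exists>y. p y \<le> 2 * real n \<and> norm (z - y) < \<epsilon>" if z: "norm z < r" "\<epsilon> > 0" for z \<epsilon>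
  proof -
    have "x0 + z \<in> closure (V n)" "x0 \<in> closure (V n)"
      using r z by (auto simp: dist_norm subset_iff)
    then obtain v w where v: "v \<in> V n" "dist v (x0 + z) < \<epsilon> / 2" and w: "w \<in> V n" "dist w x0 < \<epsilon> / 2"
      using z(2) unfolding closure_approachable by (meson half_gt_zero)
    have "norm (z - (v - w)) = norm ((x0 + z - v) + (w - x0))" by (simp add: algebra_simps)
    also have "\<dots> < \<epsilon>"
      using norm_triangle_ineq[of "x0 + z - v" "w - x0"] v(2) w(2) by (simp add: dist_norm norm_minus_commute)
    finally show ?thesis using minus[of v w] v(1) w(1) by (intro exI[of _ "v - w"]) (auto simp: V_def)
  qed
  \<comment> \<open>Points of norm \<open>r / 2\<close> are approximated with value at most \<open>2 * n\<close>; rescaling gives this ratio.\<close>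
  define C where "C = 4 * real n / r"
  have C0: "C \<ge> 0" using r(1) by (simp add: C_def)
  have approx: "\<exists>y. p y \<le> C * norm x \<and> norm (x - y) < \<epsilon>" if "\<epsilon> > 0" for x \<epsilon>
  proof (cases "x = 0")
    case True
    then show ?thesis using that p0 by (intro exI[of _ 0]) auto
  next
    case False
    define s where "s = r / (2 * norm x)"
    have s: "s > 0" using r(1) False by (simp add: s_def)
    have "norm (s *\<^sub>R x) < r" using r(1) False by (simp add: s_def)
    then obtain y where y: "p y \<le> 2 * real n" "norm (s *\<^sub>R x - y) < s * \<epsilon>"
      using small[of "s *\<^sub>R x" "s * \<epsilon>"] mult_pos_pos[OF s \<open>\<epsilon> > 0\<close>] by blast
    have "p (inverse s *\<^sub>R y) \<le> inverse s * (2 * real n)"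
      using s y(1) by (simp add: scale mult_left_mono)
    also have "\<dots> = C * norm x" using False r(1) by (simp add: s_def C_def field_simps)
    finally have 1: "p (inverse s *\<^sub>R y) \<le> C * norm x" .
    have "x - inverse s *\<^sub>R y = inverse s *\<^sub>R (s *\<^sub>R x - y)" using s by (simp add: scaleR_diff_right)
    then have "norm (x - inverse s *\<^sub>R y) = inverse s * norm (s *\<^sub>R x - y)" using s by simp
    also have "\<dots> < \<epsilon>" using y(2) s by (simp add: field_simps)
    finally show ?thesis using 1 by blast
  qed
  have "p x \<le> 2 * C * norm x" for x
  proof (cases "x = 0")
    case True
    then show ?thesis using p0 by simp
  next
    case False
    define g where "g x \<epsilon> = (SOME y. p y \<le> C * norm x \<and> norm (x - y) < \<epsilon>)" for x \<epsilon>
    have g: "p (g x \<epsilon>) \<le> C * norm x \<and> norm (x - g x \<epsilon>) < \<epsilon>" if "\<epsilon> > 0" for x \<epsilon>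
      unfolding g_def by (rule someI_ex[OF approx[OF that]])
    define \<epsilon> where "\<epsilon> k = norm x * (1/2) ^ k" for k :: nat
    define R where "R = rec_nat x (\<lambda>k y. y - g y (\<epsilon> (Suc k)))"
    define u where "u k = g (R k) (\<epsilon> (Suc k))" for k
    have R: "R 0 = x" "\<And>k. R (Suc k) = R k - u k" by (simp_all add: R_def u_def)
    have pos: "\<epsilon> k > 0" for k using False by (simp add: \<epsilon>_def)
    have nR: "norm (R k) \<le> \<epsilon> k" for k
    proof (cases k)
      case 0
      then show ?thesis by (simp add: R \<epsilon>_def)
    next
      case (Suc j)
      then show ?thesis using g[OF pos[of "Suc j"], of "R j"] by (simp add: R u_def)
    qed
    have pu: "p (u k) \<le> C * \<epsilon> k" for k
      using g[OF pos[of "Suc k"], of "R k"] mult_left_mono[OF nR[of k] C0] by (simp add: u_def)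
    have sums_e: "(\<lambda>k. C * \<epsilon> k) sums (C * (norm x * 2))"
      unfolding \<epsilon>_def using geometric_sums[of "1/2::real"] by (intro sums_mult) auto
    have sm: "summable (\<lambda>k. p (u k))"
      by (rule summable_comparison_test'[OF sums_summable[OF sums_e]]) (use pu nonneg in auto)
    have partial: "(\<Sum>k<N. u k) = x - R N" for N
      by (induction N) (auto simp: R)
    have "\<epsilon> \<longlonglongrightarrow> norm x * 0"
      unfolding \<epsilon>_def by (intro tendsto_intros LIMSEQ_power_zero) auto
    then have "R \<longlonglongrightarrow> 0" using nR by (intro Lim_null_comparison[of R \<epsilon>]) auto
    then have "(\<lambda>N. x - R N) \<longlonglongrightarrow> x - 0" by (intro tendsto_diff tendsto_const)
    then have "u sums x" unfolding sums_def partial by simp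
    then have "p x \<le> (\<Sum>k. p (u k))" using sm by (rule csub)
    also have "\<dots> \<le> (\<Sum>k. C * \<epsilon> k)" by (rule suminf_le[OF pu sm sums_summable[OF sums_e]])
    also have "\<dots> = 2 * C * norm x" using sums_unique[OF sums_e] by simp
    finally show ?thesis .
  qed
  then have "p x \<le> (2 * C + 1) * norm x" for x
    by (rule order_trans) (simp add: distrib_right)
  then show ?thesis using C0 by (intro exI[of _ "2 * C + 1"]) auto
qed


section \<open>Coordinates and the unconditionality constant\<close>

definition coef :: "(nat \<Rightarrow> 'a::real_normed_vector) \<Rightarrow> 'a \<Rightarrow> nat \<Rightarrow> real" where
  "coef e x = (THE a. (\<lambda>i. a i *\<^sub>R e i) sums x)"

lemma coef_sums: "schauder_basis e \<Longrightarrow> (\<lambda>i. coef e x i *\<^sub>R e i) sums x"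
  unfolding coef_def schauder_basis_def using theI'[of "\<lambda>a. (\<lambda>i. a i *\<^sub>R e i) sums x"] by simp

lemma coef_eqI: "schauder_basis e \<Longrightarrow> (\<lambda>i. a i *\<^sub>R e i) sums x \<Longrightarrow> coef e x = a"
  unfolding coef_def schauder_basis_def by (rule the1_equality) (erule conjE, erule spec)

lemma coef_add: "schauder_basis e \<Longrightarrow> coef e (x + y) = (\<lambda>i. coef e x i + coef e y i)"
  by (rule coef_eqI) (auto simp: scaleR_add_left intro!: sums_add coef_sums)

lemma coef_scaleR: "schauder_basis e \<Longrightarrow> coef e (c *\<^sub>R x) = (\<lambda>i. c * coef e x i)"
  by (rule coef_eqI) (auto simp: scaleR_scaleR[symmetric] simp del: scaleR_scaleR intro!: sums_scaleR_right coef_sums)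

lemma coef_finite_sum:
  assumes "schauder_basis e" "finite F"
  shows "coef e (\<Sum>i\<in>F. c i *\<^sub>R e i) = (\<lambda>i. if i \<in> F then c i else 0)"
proof (rule coef_eqI[OF assms(1)])
  have "(\<lambda>i. (if i \<in> F then c i else 0) *\<^sub>R e i) sums (\<Sum>i\<in>F. (if i \<in> F then c i else 0) *\<^sub>R e i)"
    by (rule sums_finite) (use assms in auto)
  also have "(\<Sum>i\<in>F. (if i \<in> F then c i else 0) *\<^sub>R e i) = (\<Sum>i\<in>F. c i *\<^sub>R e i)"
    by (rule sum.cong) auto
  finally show "(\<lambda>i. (if i \<in> F then c i else 0) *\<^sub>R e i) sums (\<Sum>i\<in>F. c i *\<^sub>R e i)" .
qed

text \<open>
  There is a finite set \<open>F0\<close> such that all sums over larger finite sets have distance less than 1 from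
  the limit, and joining \<open>F0\<close> to a finite set changes the sum by a sum over a part of \<open>F0\<close>.
\<close>

lemma unconditional_sums_bounded:
  fixes f :: "'i \<Rightarrow> 'a::real_normed_vector"
  assumes "(f has_sum x) A"
  shows "\<exists>B. \<forall>F. finite F \<and> F \<subseteq> A \<longrightarrow> norm (sum f F) \<le> B"
proof -
  have "\<forall>\<^sub>F F in finite_subsets_at_top A. dist (sum f F) x < 1"
    using assms unfolding has_sum_def tendsto_iff by simp
  then obtain F0 where F0: "finite F0" "F0 \<subseteq> A"
    "\<forall>F. finite F \<and> F0 \<subseteq> F \<and> F \<subseteq> A \<longrightarrow> dist (sum f F) x < 1"
    unfolding eventually_finite_subsets_at_top by (elim exE conjE) (rule that)
  have "norm (sum f F) \<le> 1 + norm x + (\<Sum>i\<in>F0. norm (f i))" if F: "finite F" "F \<subseteq> A" for F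
  proof -
    have "sum f (F \<union> F0) = sum f F + sum f (F0 - F)"
      using sum.union_disjoint[of F "F0 - F" f] F F0(1) by (simp add: Un_Diff_cancel)
    then have "sum f F = (sum f (F \<union> F0) - x) + x - sum f (F0 - F)" by simp
    also have "norm \<dots> \<le> norm (sum f (F \<union> F0) - x) + norm x + norm (sum f (F0 - F))"
      by (meson norm_triangle_ineq norm_triangle_ineq4 order_trans add_right_mono)
    also have "norm (sum f (F0 - F)) \<le> (\<Sum>i\<in>F0. norm (f i))"
      using F0(1) by (intro order_trans[OF norm_sum] sum_mono2) auto
    also have "norm (sum f (F \<union> F0) - x) \<le> 1"
      using F0(3)[rule_format, of "F \<union> F0"] F F0(1,2) by (simp add: dist_norm less_imp_le)
    finally show ?thesis by simp
  qed
  then show ?thesis by blast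
qed

text \<open>
  The supremum \<open>p x\<close> of the norms of all finite partial sums of the expansion of \<open>x\<close> is finite since
  the expansion converges unconditionally. It is countably subadditive: if \<open>x = (\<Sum>k. u k)\<close> and the
  series of the \<open>p (u k)\<close> converges, the coordinates of the \<open>u k\<close> can be added up, and Tannery's
  theorem shows that the resulting coefficients still give an expansion of \<open>x\<close>. By uniqueness they are
  the coordinates of \<open>x\<close>.
\<close>

theorem unconditional_basis_bounded_partial_sums:
  fixes e :: "nat \<Rightarrow> 'a::banach"
  assumes "unconditional_basis e"
  shows "\<exists>C>0. \<forall>x F. finite F \<longrightarrow> norm (\<Sum>i\<in>F. coef e x i *\<^sub>R e i) \<le> C * norm x"
proof -
  have sb: "schauder_basis e" and hs: "\<And>x. ((\<lambda>i. coef e x i *\<^sub>R e i) has_sum x) UNIV"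
    using assms coef_sums unfolding unconditional_basis_def by blast+
  define S where "S F x = (\<Sum>i\<in>F. coef e x i *\<^sub>R e i)" for F x
  define p where "p x = (SUP F\<in>Collect finite. norm (S F x))" for x
  have bdd: "bdd_above ((\<lambda>F. norm (S F x)) ` Collect finite)" for x
    using unconditional_sums_bounded[OF hs[of x]] unfolding S_def bdd_above_def by auto
  have p_upper: "norm (S F x) \<le> p x" if "finite F" for F x
    unfolding p_def by (rule cSUP_upper[OF _ bdd]) (use that in simp)
  have p_least: "p x \<le> b" if "\<And>F. finite F \<Longrightarrow> norm (S F x) \<le> b" for x b
    unfolding p_def by (rule cSUP_least) (use that in auto)
  have p_nonneg: "0 \<le> p x" for x using p_upper[of "{}" x] by (simp add: S_def)
  have S_scale: "S F (c *\<^sub>R x) = c *\<^sub>R S F x" for F c x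
    by (simp add: S_def coef_scaleR[OF sb] scaleR_sum_right)
  have p_scale_le: "p (c *\<^sub>R x) \<le> \<bar>c\<bar> * p x" for c x
    by (rule p_least) (auto simp: S_scale intro!: mult_left_mono p_upper)
  have p_scale: "p (c *\<^sub>R x) = \<bar>c\<bar> * p x" for c x
  proof (cases "c = 0")
    case True
    then show ?thesis using p_scale_le[of c x] p_nonneg[of 0] by simp
  next
    case False
    then have "\<bar>c\<bar> * p x \<le> p (c *\<^sub>R x)"
      using p_scale_le[of "inverse c" "c *\<^sub>R x"] by (simp add: field_simps)
    then show ?thesis using p_scale_le[of c x] by simp
  qed
  have S_tendsto: "(\<lambda>N. S {..<N} x) \<longlonglongrightarrow> x" for x
    using coef_sums[OF sb, of x] by (simp add: S_def sums_def)
  have norm_le_p: "norm x \<le> p x" for x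
    by (rule LIMSEQ_le_const2[OF tendsto_norm[OF S_tendsto]]) (use p_upper in auto)
  have "p x \<le> (\<Sum>k. p (u k))" if ux: "u sums x" and sm: "summable (\<lambda>k. p (u k))" for u x
  proof -
    have coef_le: "norm (coef e (u k) i) \<le> p (u k) / norm (e i)" for k i
    proof -
      have "norm (e i) > 0" using sb by (simp add: schauder_basis_def)
      then show ?thesis using p_upper[of "{i}" "u k"] by (simp add: S_def pos_le_divide_eq)
    qed
    have sm_coef: "summable (\<lambda>k. coef e (u k) i)" for i
      by (rule summable_comparison_test'[OF summable_divide[OF sm] coef_le])
    define b where "b i = (\<Sum>k. coef e (u k) i)" for i
    have S_b: "(\<lambda>k. S F (u k)) sums (\<Sum>i\<in>F. b i *\<^sub>R e i)" for F
      unfolding S_def b_def by (intro sums_sum sums_scaleR_left summable_sums sm_coef)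
    have "(\<lambda>N. \<Sum>i<N. b i *\<^sub>R e i) \<longlonglongrightarrow> x"
    proof -
      have "(\<lambda>N. \<Sum>k. norm (S {..<N} (u k) - u k)) \<longlonglongrightarrow> (\<Sum>k. (0::real))"
      proof (rule tannerys_theorem[THEN conjunct2, THEN conjunct2])
        show "(\<lambda>N. norm (S {..<N} (u k) - u k)) \<longlonglongrightarrow> 0" for k
          using S_tendsto[of "u k"] by (simp add: LIM_zero tendsto_norm_zero)
        show "summable (\<lambda>k. 2 * p (u k))" using sm by (rule summable_mult)
        have "norm (norm (S {..<N} (u k) - u k)) \<le> 2 * p (u k)" for k N
          using norm_triangle_ineq4[of "S {..<N} (u k)" "u k"] p_upper[of "{..<N}" "u k"] norm_le_p[of "u k"]
          by simp
        then show "\<forall>\<^sub>F (k, N) in sequentially \<times>\<^sub>F sequentially. norm (norm (S {..<N} (u k) - u k)) \<le> 2 * p (u k)"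
          by (simp add: case_prod_unfold)
      qed simp
      moreover have "norm ((\<Sum>i<N. b i *\<^sub>R e i) - x) \<le> (\<Sum>k. norm (S {..<N} (u k) - u k))" for N
      proof -
        have "(\<lambda>k. S {..<N} (u k) - u k) sums ((\<Sum>i<N. b i *\<^sub>R e i) - x)"
          using S_b[of "{..<N}"] ux by (rule sums_diff)
        moreover have "summable (\<lambda>k. norm (S {..<N} (u k) - u k))"
        proof (rule summable_comparison_test'[OF summable_mult[OF sm, of 2]])
          show "norm (norm (S {..<N} (u k) - u k)) \<le> 2 * p (u k)" for k
            using norm_triangle_ineq4[of "S {..<N} (u k)" "u k"] p_upper[of "{..<N}" "u k"] norm_le_p[of "u k"]
            by simp
        qed
        ultimately show ?thesis using summable_norm sums_unique by metis
      qed
      ultimately have "(\<lambda>N. (\<Sum>i<N. b i *\<^sub>R e i) - x) \<longlonglongrightarrow> 0"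
        by (intro Lim_null_comparison[of "\<lambda>N. (\<Sum>i<N. b i *\<^sub>R e i) - x"]) auto
      then show ?thesis by (rule LIM_zero_cancel)
    qed
    then have b: "coef e x = b" using coef_eqI[OF sb] by (simp add: sums_def)
    show "p x \<le> (\<Sum>k. p (u k))"
    proof (rule p_least)
      fix F :: "nat set" assume F: "finite F"
      have "S F x = (\<Sum>k. S F (u k))" using sums_unique[OF S_b[of F]] by (simp add: S_def b)
      also have "norm \<dots> \<le> (\<Sum>k. p (u k))" by (rule norm_suminf_le[OF p_upper[OF F] sm])
      finally show "norm (S F x) \<le> (\<Sum>k. p (u k))" .
    qed
  qed
  from countably_subadditive_imp_bounded[of p, OF p_nonneg p_scale this]
  obtain C where "C > 0" "\<And>x. p x \<le> C * norm x" by blast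
  then show ?thesis using p_upper unfolding S_def by (meson order_trans)
qed

lemma coef_bounded:
  fixes e :: "nat \<Rightarrow> 'a::banach"
  assumes "unconditional_basis e"
  shows "\<exists>C. \<forall>x. \<bar>coef e x i\<bar> \<le> C * norm x"
proof -
  obtain C where C: "\<And>x F. finite F \<Longrightarrow> norm (\<Sum>i\<in>F. coef e x i *\<^sub>R e i) \<le> C * norm x"
    using unconditional_basis_bounded_partial_sums[OF assms] by blast
  have "norm (e i) > 0" using assms by (simp add: unconditional_basis_def schauder_basis_def)
  then have "\<bar>coef e x i\<bar> \<le> (C / norm (e i)) * norm x" for x
    using C[of "{i}" x] by (simp add: field_simps)
  then show ?thesis by blast
qed

lemma bounded_linear_coef:
  fixes e :: "nat \<Rightarrow> 'a::banach"
  assumes "unconditional_basis e"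
  shows "bounded_linear (\<lambda>x. coef e x i)"
proof -
  have sb: "schauder_basis e" using assms by (simp add: unconditional_basis_def)
  obtain C where "\<And>x. \<bar>coef e x i\<bar> \<le> C * norm x" using coef_bounded[OF assms] by blast
  then show ?thesis
    by (intro bounded_linear_intro[of _ C]) (auto simp: coef_add[OF sb] coef_scaleR[OF sb] mult.commute)
qed

text \<open>
  Applied to finite sums, whose coordinates are their coefficients, the bound on partial sums says that
  dropping terms increases the norm by at most a constant factor.
\<close>

lemma suppression_bound:
  fixes e :: "nat \<Rightarrow> 'a::banach"
  assumes "unconditional_basis e"
  shows "\<exists>C\<ge>1. \<forall>F G c. finite G \<and> F \<subseteq> G \<longrightarrow> norm (\<Sum>i\<in>F. c i *\<^sub>R e i) \<le> C * norm (\<Sum>i\<in>G. c i *\<^sub>R e i)"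
proof -
  have sb: "schauder_basis e" using assms by (simp add: unconditional_basis_def)
  obtain C where C: "C > 0" "\<And>x F. finite F \<Longrightarrow> norm (\<Sum>i\<in>F. coef e x i *\<^sub>R e i) \<le> C * norm x"
    using unconditional_basis_bounded_partial_sums[OF assms] by blast
  have "norm (\<Sum>i\<in>F. c i *\<^sub>R e i) \<le> max 1 C * norm (\<Sum>i\<in>G. c i *\<^sub>R e i)" if FG: "finite G" "F \<subseteq> G" for F G c
  proof -
    have "(\<Sum>i\<in>F. c i *\<^sub>R e i) = (\<Sum>i\<in>F. coef e (\<Sum>i\<in>G. c i *\<^sub>R e i) i *\<^sub>R e i)"
      using FG by (intro sum.cong) (auto simp: coef_finite_sum[OF sb])
    then have "norm (\<Sum>i\<in>F. c i *\<^sub>R e i) \<le> C * norm (\<Sum>i\<in>G. c i *\<^sub>R e i)"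
      using C(2)[of F "\<Sum>i\<in>G. c i *\<^sub>R e i"] FG finite_subset by metis
    also have "\<dots> \<le> max 1 C * norm (\<Sum>i\<in>G. c i *\<^sub>R e i)" by (intro mult_right_mono) auto
    finally show ?thesis .
  qed
  then show ?thesis by (intro exI[of _ "max 1 C"]) auto
qed


section \<open>Closed spans of parts of the basis\<close>

text \<open>
  The sums run over sets of indices rather than sets of vectors, since \<open>e\<close> is an arbitrary sequence
  and may repeat a vector.
\<close>

lemma span_image_finite_sum:
  "x \<in> span (e ` A) \<longleftrightarrow> (\<exists>F c. finite F \<and> F \<subseteq> A \<and> x = (\<Sum>i\<in>F. c i *\<^sub>R e i))"
proof
  assume "x \<in> span (e ` A)"
  then show "\<exists>F c. finite F \<and> F \<subseteq> A \<and> x = (\<Sum>i\<in>F. c i *\<^sub>R e i)"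
  proof (induction rule: span_induct_alt)
    case base
    then show ?case by (intro exI[of _ "{}"]) auto
  next
    case (step a x y)
    from step(1) obtain i where i: "i \<in> A" "x = e i" by (elim imageE) simp
    from step(2) obtain F c where F: "finite F" "F \<subseteq> A" "y = (\<Sum>j\<in>F. c j *\<^sub>R e j)" by blast
    let ?c = "\<lambda>j. (if j = i then a else 0) + (if j \<in> F then c j else 0)"
    have "(\<Sum>j\<in>insert i F. ?c j *\<^sub>R e j)
        = (\<Sum>j\<in>insert i F. (if j = i then a else 0) *\<^sub>R e j) + (\<Sum>j\<in>insert i F. (if j \<in> F then c j else 0) *\<^sub>R e j)"
      by (simp only: scaleR_add_left sum.distrib)
    also have "(\<Sum>j\<in>insert i F. (if j = i then a else 0) *\<^sub>R e j) = a *\<^sub>R x"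
      using F(1) by (subst sum.mono_neutral_right[of _ "{i}"]) (auto simp: i)
    also have "(\<Sum>j\<in>insert i F. (if j \<in> F then c j else 0) *\<^sub>R e j) = y"
      using F(1) unfolding F(3) by (subst sum.mono_neutral_right[of _ F]) auto
    finally have "a *\<^sub>R x + y = (\<Sum>j\<in>insert i F. ?c j *\<^sub>R e j)" by simp
    then show ?case using i F by (intro exI[of _ "insert i F"] exI[of _ ?c]) auto
  qed
next
  assume "\<exists>F c. finite F \<and> F \<subseteq> A \<and> x = (\<Sum>i\<in>F. c i *\<^sub>R e i)"
  then show "x \<in> span (e ` A)"
    by (elim exE conjE, hypsubst, intro span_sum span_scale span_base) blast
qed

lemma subspace_closed_span [simp]: "subspace (closed_span e A)"
  unfolding closed_span_def by (intro closure_of_subspace subspace_span)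

lemma closed_closed_span [simp]: "closed (closed_span e A)"
  by (simp add: closed_span_def)

lemma closed_span_mono: "A \<subseteq> B \<Longrightarrow> closed_span e A \<subseteq> closed_span e B"
  unfolding closed_span_def by (intro closure_mono span_mono image_mono)

lemma in_closed_span: "i \<in> A \<Longrightarrow> e i \<in> closed_span e A"
  unfolding closed_span_def by (rule subsetD[OF closure_subset], rule span_base, rule imageI)

lemma closed_span_iff_coef:
  fixes e :: "nat \<Rightarrow> 'a::banach"
  assumes "unconditional_basis e"
  shows "x \<in> closed_span e A \<longleftrightarrow> (\<forall>i. i \<notin> A \<longrightarrow> coef e x i = 0)"
proof
  have sb: "schauder_basis e" using assms by (simp add: unconditional_basis_def)
  have cont: "continuous_on UNIV (\<lambda>x. coef e x i)" for i
    using bounded_linear_coef[OF assms] by (rule linear_continuous_on)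
  have "closed_span e A \<subseteq> {x. \<forall>i. i \<notin> A \<longrightarrow> coef e x i = 0}"
    unfolding closed_span_def
  proof (rule closure_minimal)
    show "span (e ` A) \<subseteq> {x. \<forall>i. i \<notin> A \<longrightarrow> coef e x i = 0}"
      by (force simp: span_image_finite_sum coef_finite_sum[OF sb])
    show "closed {x. \<forall>i. i \<notin> A \<longrightarrow> coef e x i = 0}"
      by (intro closed_Collect_all closed_Collect_imp closed_Collect_eq cont continuous_on_const) auto
  qed
  then show "\<forall>i. i \<notin> A \<longrightarrow> coef e x i = 0" if "x \<in> closed_span e A" using that by blast
  show "x \<in> closed_span e A" if x: "\<forall>i. i \<notin> A \<longrightarrow> coef e x i = 0"
  proof (rule closed_sequentially[OF closed_closed_span])
    show "(\<lambda>N. \<Sum>i<N. coef e x i *\<^sub>R e i) \<longlonglongrightarrow> x" using coef_sums[OF sb, of x] by (simp add: sums_def)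
    show "(\<Sum>i<N. coef e x i *\<^sub>R e i) \<in> closed_span e A" for N
    proof (rule subspace_sum[OF subspace_closed_span])
      fix i
      show "coef e x i *\<^sub>R e i \<in> closed_span e A"
        using x by (cases "i \<in> A") (auto intro: subspace_scale subspace_0 in_closed_span)
    qed
  qed
qed

lemma closed_span_UNIV: "unconditional_basis (e :: nat \<Rightarrow> 'a::banach) \<Longrightarrow> closed_span e UNIV = UNIV"
  using closed_span_iff_coef by blast

lemma iso_within_equivalent_sequences:
  fixes e :: "nat \<Rightarrow> 'a::banach" and y :: "nat \<Rightarrow> 'b::banach"
  assumes "\<And>F c. finite F \<Longrightarrow> F \<subseteq> A \<Longrightarrow> norm (\<Sum>i\<in>F. c i *\<^sub>R y i) \<le> K * norm (\<Sum>i\<in>F. c i *\<^sub>R e i)"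
    and "\<And>F c. finite F \<Longrightarrow> F \<subseteq> A \<Longrightarrow> norm (\<Sum>i\<in>F. c i *\<^sub>R e i) \<le> K * norm (\<Sum>i\<in>F. c i *\<^sub>R y i)"
  shows "iso_within K (closed_span e A) (closed_span y A)"
proof -
  let ?S = "span ((\<lambda>i. (e i, y i)) ` A)"
  have "fst ` ?S = span (e ` A)" "snd ` ?S = span (y ` A)"
    by (simp_all add: linear_span_image[symmetric] linear_fst linear_snd image_image)
  moreover have "norm v \<le> K * norm u \<and> norm u \<le> K * norm v" if "(u, v) \<in> ?S" for u v
  proof -
    obtain F c where F: "finite F" "F \<subseteq> A" "(u, v) = (\<Sum>i\<in>F. c i *\<^sub>R (e i, y i))"
      using \<open>(u, v) \<in> ?S\<close> unfolding span_image_finite_sum by (elim exE conjE) (rule that)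
    have "u = (\<Sum>i\<in>F. c i *\<^sub>R e i)" "v = (\<Sum>i\<in>F. c i *\<^sub>R y i)"
      using arg_cong[OF F(3), of fst] arg_cong[OF F(3), of snd] by (simp_all add: fst_sum snd_sum)
    then show ?thesis using assms F(1,2) by simp
  qed
  ultimately show ?thesis
    using iso_within_closure[of ?S K] by (simp add: closed_span_def)
qed

text \<open>
  The map \<open>(x, y) \<mapsto> x + y\<close> is bounded, and bounded below by the suppression constant, on the linear
  spans; this passes to the closures.
\<close>

lemma iso_within_closed_span_Un:
  fixes e :: "nat \<Rightarrow> 'a::banach"
  assumes "unconditional_basis e"
  shows "\<exists>K\<ge>1. \<forall>A B. A \<inter> B = {} \<longrightarrow> iso_within K (closed_span e A \<times> closed_span e B) (closed_span e (A \<union> B))"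
proof -
  obtain C where C: "C \<ge> 1" and
    *: "\<forall>F G c. finite G \<and> F \<subseteq> G \<longrightarrow> norm (\<Sum>i\<in>F. c i *\<^sub>R e i) \<le> C * norm (\<Sum>i\<in>G. c i *\<^sub>R e i)"
    using suppression_bound[OF assms] by (elim exE conjE) (rule that)
  have C_le: "norm (\<Sum>i\<in>F. c i *\<^sub>R e i) \<le> C * norm (\<Sum>i\<in>G. c i *\<^sub>R e i)"
    if "finite G" "F \<subseteq> G" for F G and c :: "nat \<Rightarrow> real"
    using * that by simp
  have "iso_within (2 * C) (closed_span e A \<times> closed_span e B) (closed_span e (A \<union> B))"
    if AB: "A \<inter> B = {}" for A B
  proof -
    let ?S = "(\<lambda>p. (p, fst p + snd p)) ` (span (e ` A) \<times> span (e ` B))"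
    have S: "subspace ?S"
      by (intro linear_subspace_image subspace_Times subspace_span) (auto intro!: linearI simp: scaleR_add_right)
    have "v \<in> snd ` ?S \<longleftrightarrow> v \<in> span (e ` (A \<union> B))" for v
      unfolding image_Un span_Un by (auto simp: image_iff)
    then have snd: "snd ` ?S = span (e ` (A \<union> B))" by blast
    have le: "norm (x + y) \<le> 2 * C * norm (x, y) \<and> norm (x, y) \<le> 2 * C * norm (x + y)"
      if "x \<in> span (e ` A)" "y \<in> span (e ` B)" for x y
    proof
      obtain F a where F: "finite F" "F \<subseteq> A" "x = (\<Sum>i\<in>F. a i *\<^sub>R e i)"
        using \<open>x \<in> _\<close> unfolding span_image_finite_sum by blast
      obtain G b where G: "finite G" "G \<subseteq> B" "y = (\<Sum>i\<in>G. b i *\<^sub>R e i)"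
        using \<open>y \<in> _\<close> unfolding span_image_finite_sum by blast
      \<comment> \<open>Both combinations are written with the same coefficients, as parts of their sum.\<close>
      let ?c = "\<lambda>i. if i \<in> F then a i else b i"
      have x: "x = (\<Sum>i\<in>F. ?c i *\<^sub>R e i)" unfolding F(3) by (intro sum.cong) auto
      have y: "y = (\<Sum>i\<in>G. ?c i *\<^sub>R e i)" unfolding G(3) using F(2) G(2) AB by (intro sum.cong) auto
      have xy: "x + y = (\<Sum>i\<in>F \<union> G. ?c i *\<^sub>R e i)"
        unfolding x y using F G AB by (intro sum.union_disjoint[symmetric]) auto
      have "norm x \<le> C * norm (x + y)" "norm y \<le> C * norm (x + y)"
        unfolding xy by (subst x y; intro C_le; use F G in auto)+
      moreover have "norm (x, y) \<le> norm x + norm y" by (simp add: norm_Pair sqrt_sum_squares_le_sum)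
      ultimately show "norm (x, y) \<le> 2 * C * norm (x + y)" by simp
      have "norm (x + y) \<le> norm x + norm y" by (rule norm_triangle_ineq)
      also have "\<dots> \<le> 2 * norm (x, y)"
        using norm_fst_le[of x y] norm_snd_le[of y x] by simp
      also have "\<dots> \<le> 2 * C * norm (x, y)" using C by (intro mult_right_mono) auto
      finally show "norm (x + y) \<le> 2 * C * norm (x, y)" .
    qed
    have "iso_within (2 * C) (closure (fst ` ?S)) (closure (snd ` ?S))"
      by (rule iso_within_closure[OF S]) (use le in auto)
    then show ?thesis unfolding snd by (simp add: image_image closed_span_def closure_Times)
  qed
  then show ?thesis using C by (intro exI[of _ "2 * C"]) auto
qed

text \<open>
  Rescaling the basis vectors turns the obvious map into an isometry.
\<close>

lemma iso_within_singletons: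
  fixes e :: "nat \<Rightarrow> 'a::banach"
  assumes "\<And>i. e i \<noteq> 0"
  shows "iso_within 1 (closed_span e {i}) (closed_span e {j})"
proof -
  let ?y = "\<lambda>_::nat. (norm (e i) / norm (e j)) *\<^sub>R e j"
  have "iso_within 1 (closed_span e {i}) (closed_span ?y {i})"
    by (rule iso_within_equivalent_sequences) (use assms in \<open>auto simp: subset_singleton_iff abs_mult\<close>)
  moreover have "closed_span ?y {i} = closed_span e {j}"
    using assms span_image_scale[of "{e j}" "\<lambda>_. norm (e i) / norm (e j)"] by (simp add: closed_span_def)
  ultimately show ?thesis by simp
qed

text \<open>
  The constant depends on the cardinality only: exchange one basis vector after the other.
\<close>

lemma iso_within_finite:
  fixes e :: "nat \<Rightarrow> 'a::banach"
  assumes "unconditional_basis e"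
  shows "\<exists>K\<ge>1. \<forall>F G. finite F \<and> finite G \<and> card F = card G \<and> card G \<le> n \<longrightarrow>
    iso_within K (closed_span e F) (closed_span e G)"
proof (induction n)
  case 0
  then show ?case by (intro exI[of _ 1]) (auto intro!: iso_within_refl)
next
  case (Suc n)
  then obtain L where L: "L \<ge> 1" "\<And>F G. finite F \<Longrightarrow> finite G \<Longrightarrow> card F = card G \<Longrightarrow> card G \<le> n \<Longrightarrow>
    iso_within L (closed_span e F) (closed_span e G)" by blast
  obtain C where C: "C \<ge> 1" "\<And>A B. A \<inter> B = {} \<Longrightarrow> iso_within C (closed_span e A \<times> closed_span e B) (closed_span e (A \<union> B))"
    using iso_within_closed_span_Un[OF assms] by blast
  have nz: "e i \<noteq> 0" for i using assms by (simp add: unconditional_basis_def schauder_basis_def)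
  have CLC: "L \<le> C * L * C"
  proof -
    have "L * 1 \<le> C * L * 1" using mult_right_mono[of 1 C L] C(1) L(1) by simp
    also have "\<dots> \<le> C * L * C" using C(1) L(1) by (intro mult_left_mono) auto
    finally show ?thesis by simp
  qed
  have "iso_within (C * L * C) (closed_span e F) (closed_span e G)"
    if FG: "finite F" "finite G" "card F = card G" "card G \<le> Suc n" for F G
  proof (cases "card G \<le> n")
    case True
    then show ?thesis using L(2)[OF FG(1-3)] CLC iso_within_mono by blast
  next
    case False
    then have cards: "card F = Suc n" "card G = Suc n" using FG by auto
    obtain i F' where F': "F = insert i F'" "i \<notin> F'" "card F' = n" using cards(1) by (auto simp: card_Suc_eq)
    obtain j G' where G': "G = insert j G'" "j \<notin> G'" "card G' = n" using cards(2) by (auto simp: card_Suc_eq)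
    have "iso_within C (closed_span e F) (closed_span e F' \<times> closed_span e {i})"
      using C(2)[of F' "{i}"] F' by (simp add: iso_within_sym)
    moreover have "iso_within L (closed_span e F' \<times> closed_span e {i}) (closed_span e G' \<times> closed_span e {j})"
      using L F' G' FG iso_within_singletons[of e i j, OF nz]
      by (intro iso_within_Times) (auto intro: iso_within_mono)
    moreover have "iso_within C (closed_span e G' \<times> closed_span e {j}) (closed_span e G)"
      using C(2)[of G' "{j}"] G' by simp
    ultimately show ?thesis using C(1) L(1) by (meson iso_within_trans order_trans zero_le_one mult_nonneg_nonneg)
  qed
  moreover have "1 \<le> C * L * C" using L(1) CLC by (rule order_trans)
  ultimately show ?case by blast
qed


section \<open>The isomorphism relation as a projection\<close>

definition rat_comb :: "(nat \<Rightarrow> 'a::real_vector) \<Rightarrow> rat list \<Rightarrow> 'a" where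
  "rat_comb e l = (\<Sum>i<length l. real_of_rat (l ! i) *\<^sub>R e i)"

definition supported_in :: "rat list \<Rightarrow> nat set \<Rightarrow> bool" where
  "supported_in l A \<longleftrightarrow> (\<forall>i<length l. l ! i \<noteq> 0 \<longrightarrow> i \<in> A)"

lemma rat_comb_in_span: "supported_in l A \<Longrightarrow> rat_comb e l \<in> span (e ` A)"
  unfolding rat_comb_def supported_in_def
proof (rule span_sum)
  fix i assume l: "\<forall>i<length l. l ! i \<noteq> 0 \<longrightarrow> i \<in> A" "i \<in> {..<length l}"
  show "real_of_rat (l ! i) *\<^sub>R e i \<in> span (e ` A)"
    using l by (cases "l ! i = 0") (auto intro: span_scale span_base simp: span_zero)
qed

lemma rat_comb_dense:
  fixes e :: "nat \<Rightarrow> 'a::real_normed_vector"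
  assumes "z \<in> closed_span e A" "\<epsilon> > 0"
  shows "\<exists>l. supported_in l A \<and> norm (rat_comb e l - z) < \<epsilon>"
proof -
  obtain v where v: "v \<in> span (e ` A)" "dist v z < \<epsilon> / 2"
    using assms unfolding closed_span_def closure_approachable by (meson half_gt_zero)
  obtain F c where F: "finite F" "F \<subseteq> A" "v = (\<Sum>i\<in>F. c i *\<^sub>R e i)"
    using v(1) unfolding span_image_finite_sum by (elim exE conjE) (rule that)
  define s where "s = 1 + (\<Sum>i\<in>F. norm (e i))"
  have s: "s > 0" by (simp add: s_def add_pos_nonneg sum_nonneg)
  \<comment> \<open>An error \<open>\<delta>\<close> in each coefficient moves the sum by less than \<open>\<epsilon> / 2\<close>.\<close>
  define \<delta> where "\<delta> = \<epsilon> / 2 / s"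
  have "\<delta> > 0" using s assms(2) by (simp add: \<delta>_def)
  have "\<exists>q. \<bar>real_of_rat q - c i\<bar> < \<delta>" for i
  proof -
    obtain q where "c i < real_of_rat q" "real_of_rat q < c i + \<delta>"
      using of_rat_dense[of "c i" "c i + \<delta>"] \<open>\<delta> > 0\<close> by auto
    then show ?thesis by (intro exI[of _ q]) auto
  qed
  then obtain q where q: "\<And>i. \<bar>real_of_rat (q i) - c i\<bar> < \<delta>" by metis
  obtain N where N: "F \<subseteq> {..<N}" using F(1) finite_nat_iff_bounded by blast
  define l where "l = map (\<lambda>i. if i \<in> F then q i else 0) [0..<N]"
  have "supported_in l A" using F(2) by (auto simp: supported_in_def l_def split: if_splits)
  moreover have "norm (rat_comb e l - z) < \<epsilon>"
  proof -
    have "rat_comb e l = (\<Sum>i<N. (if i \<in> F then real_of_rat (q i) else 0) *\<^sub>R e i)"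
      unfolding rat_comb_def l_def by (intro sum.cong) auto
    also have "\<dots> = (\<Sum>i\<in>F. real_of_rat (q i) *\<^sub>R e i)"
      using N by (subst sum.mono_neutral_right[of "{..<N}" F]) auto
    finally have "rat_comb e l - v = (\<Sum>i\<in>F. (real_of_rat (q i) - c i) *\<^sub>R e i)"
      by (simp add: F(3) sum_subtractf scaleR_left_diff_distrib)
    also have "norm \<dots> \<le> (\<Sum>i\<in>F. \<delta> * norm (e i))"
    proof (rule order_trans[OF norm_sum], rule sum_mono)
      fix i
      have "\<bar>real_of_rat (q i) - c i\<bar> * norm (e i) \<le> \<delta> * norm (e i)"
        using q[of i] by (intro mult_right_mono) auto
      then show "norm ((real_of_rat (q i) - c i) *\<^sub>R e i) \<le> \<delta> * norm (e i)" by simp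
    qed
    also have "\<dots> = \<delta> * (\<Sum>i\<in>F. norm (e i))" by (simp add: sum_distrib_left)
    also have "\<dots> \<le> \<delta> * s" using \<open>\<delta> > 0\<close> by (simp add: s_def)
    also have "\<dots> = \<epsilon> / 2" using s by (simp add: \<delta>_def)
    finally show ?thesis
      using v(2) norm_triangle_ineq[of "rat_comb e l - v" "v - z"] by (simp add: dist_norm)
  qed
  ultimately show ?thesis by blast
qed

lemma linear_map_on_sum:
  assumes "linear_map_on Y T" "subspace Y" "finite F" "\<And>i. i \<in> F \<Longrightarrow> v i \<in> Y"
  shows "T (\<Sum>i\<in>F. c i *\<^sub>R v i) = (\<Sum>i\<in>F. c i *\<^sub>R T (v i))"
  using assms(3,4)
proof (induction F)
  case empty
  have "T (0 *\<^sub>R 0) = 0 *\<^sub>R T 0" using assms(1) subspace_0[OF assms(2)] unfolding linear_map_on_def by metis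
  then show ?case by simp
next
  case (insert i F)
  have "(\<Sum>i\<in>F. c i *\<^sub>R v i) \<in> Y" using insert.prems by (intro subspace_sum subspace_scale assms(2)) auto
  moreover have "c i *\<^sub>R v i \<in> Y" using insert.prems by (intro subspace_scale assms(2)) auto
  ultimately have "T (c i *\<^sub>R v i + (\<Sum>i\<in>F. c i *\<^sub>R v i)) = c i *\<^sub>R T (v i) + T (\<Sum>i\<in>F. c i *\<^sub>R v i)"
    using assms(1) insert.prems unfolding linear_map_on_def by auto
  then show ?case using insert by simp
qed

abbreviation left_set :: "(nat \<Rightarrow> bool \<times> bool) \<Rightarrow> nat set" where
  "left_set p \<equiv> {i. fst (p i)}"

abbreviation right_set :: "(nat \<Rightarrow> bool \<times> bool) \<Rightarrow> nat set" where
  "right_set p \<equiv> {i. snd (p i)}"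

definition approx_image :: "(nat \<Rightarrow> 'a::real_vector) \<Rightarrow> (nat \<Rightarrow> rat list \<times> rat list) \<Rightarrow> nat \<Rightarrow> nat \<Rightarrow> 'a" where
  "approx_image e x i n = rat_comb e (fst (x (prod_encode (i, n))))"

text \<open>
  Witness for an isomorphism with constant \<open>K\<close> from the closed span over \<open>A\<close> onto that over \<open>B\<close>,
  written as a family of conditions. The first component of \<open>x\<close> at \<open>(i, n)\<close> is a rational
  combination of basis vectors that approximates the image of \<open>e i\<close> up to \<open>(1/2) ^ n\<close>, and the second
  one is a rational combination whose image approximates \<open>e i\<close>, for \<open>i \<in> B\<close>, up to \<open>(1/2) ^ n\<close>. The
  conditions say that the approximations converge and lie in the span over \<open>B\<close>, that the limit map is
  bounded and bounded below by \<open>K\<close>, up to errors that tend to zero with \<open>n\<close>, and that its range is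
  dense. Every single condition involves finitely many entries of \<open>x\<close> and only asks whether finitely
  many numbers belong to \<open>A\<close> or \<open>B\<close>.
\<close>

definition codes_isomorphism ::
  "(nat \<Rightarrow> 'a::real_normed_vector) \<Rightarrow> real \<Rightarrow> nat set \<Rightarrow> nat set \<Rightarrow>
   (nat \<times> nat \<times> nat \<times> nat set \<times> (nat \<Rightarrow> real)) \<Rightarrow> (nat \<Rightarrow> rat list \<times> rat list) \<Rightarrow> bool" where
  "codes_isomorphism e K A B = (\<lambda>(i, n, m, F, c) x.
     norm (approx_image e x i n - approx_image e x i m) \<le> (1/2) ^ n + (1/2) ^ m \<and>
     (i \<in> A \<longrightarrow> supported_in (fst (x (prod_encode (i, n)))) B) \<and>
     (finite F \<and> F \<subseteq> A \<longrightarrow>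
        norm (\<Sum>k\<in>F. c k *\<^sub>R approx_image e x k n)
          \<le> K * norm (\<Sum>k\<in>F. c k *\<^sub>R e k) + (1/2) ^ n * (\<Sum>k\<in>F. \<bar>c k\<bar>) \<and>
        norm (\<Sum>k\<in>F. c k *\<^sub>R e k)
          \<le> K * (norm (\<Sum>k\<in>F. c k *\<^sub>R approx_image e x k n) + (1/2) ^ n * (\<Sum>k\<in>F. \<bar>c k\<bar>))) \<and>
     (i \<in> B \<longrightarrow>
        supported_in (snd (x (prod_encode (i, n)))) A \<and>
        (let w = snd (x (prod_encode (i, n))) in
         norm ((\<Sum>k<length w. real_of_rat (w ! k) *\<^sub>R approx_image e x k m) - e i)
           \<le> (1/2) ^ n + (1/2) ^ m * (\<Sum>k<length w. \<bar>real_of_rat (w ! k)\<bar>))))"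

lemma half_power_tendsto: "(\<lambda>n. (1/2) ^ n) \<longlonglongrightarrow> (0::real)"
  by (rule LIMSEQ_power_zero) auto

text \<open>
  In the limit the error terms disappear: the limits \<open>y i\<close> of the approximations form a sequence
  equivalent to the \<open>e i\<close> with \<open>i \<in> A\<close>, and its closed span contains every \<open>e j\<close> with \<open>j \<in> B\<close>.
\<close>

lemma codes_isomorphism_imp_iso_within:
  fixes e :: "nat \<Rightarrow> 'a::banach"
  assumes "\<And>j. codes_isomorphism e K A B j x"
  shows "iso_within K (closed_span e A) (closed_span e B)"
proof -
  define Y where "Y = approx_image e x"
  define w where "w i n = snd (x (prod_encode (i, n)))" for i n
  have Cau: "norm (Y i n - Y i m) \<le> (1/2) ^ n + (1/2) ^ m" for i n m
    using assms[of "(i, n, m, {}, \<lambda>_. 0)"] by (simp add: codes_isomorphism_def Y_def)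
  have supp: "supported_in (fst (x (prod_encode (i, n)))) B" if "i \<in> A" for i n
    using assms[of "(i, n, 0, {}, \<lambda>_. 0)"] that by (simp add: codes_isomorphism_def)
  have up: "norm (\<Sum>k\<in>F. c k *\<^sub>R Y k n) \<le> K * norm (\<Sum>k\<in>F. c k *\<^sub>R e k) + (1/2) ^ n * (\<Sum>k\<in>F. \<bar>c k\<bar>)"
    and low: "norm (\<Sum>k\<in>F. c k *\<^sub>R e k) \<le> K * (norm (\<Sum>k\<in>F. c k *\<^sub>R Y k n) + (1/2) ^ n * (\<Sum>k\<in>F. \<bar>c k\<bar>))"
    if "finite F" "F \<subseteq> A" for F c n
    using assms[of "(0, n, 0, F, c)"] that by (simp_all add: codes_isomorphism_def Y_def)
  have wsupp: "supported_in (w i n) A" if "i \<in> B" for i n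
    using assms[of "(i, n, 0, {}, \<lambda>_. 0)"] that by (simp add: codes_isomorphism_def w_def)
  have w: "norm ((\<Sum>k<length (w i n). real_of_rat (w i n ! k) *\<^sub>R Y k m) - e i)
      \<le> (1/2) ^ n + (1/2) ^ m * (\<Sum>k<length (w i n). \<bar>real_of_rat (w i n ! k)\<bar>)" if "i \<in> B" for i n m
    using assms[of "(i, n, m, {}, \<lambda>_. 0)"] that by (simp add: codes_isomorphism_def Y_def w_def Let_def)
  have "\<exists>y. Y i \<longlonglongrightarrow> y" for i
  proof -
    have "Cauchy (Y i)"
    proof (rule CauchyI)
      fix \<epsilon> :: real assume "\<epsilon> > 0"
      then obtain M where "\<forall>n\<ge>M. norm ((1/2) ^ n - (0::real)) < \<epsilon> / 2"
        using LIMSEQ_D[OF half_power_tendsto, of "\<epsilon> / 2"] by auto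
      then have M: "(1/2) ^ n < \<epsilon> / 2" if "n \<ge> M" for n using that by auto
      show "\<exists>M. \<forall>n\<ge>M. \<forall>m\<ge>M. norm (Y i n - Y i m) < \<epsilon>"
      proof (intro exI allI impI)
        fix n m assume "M \<le> n" "M \<le> m"
        then show "norm (Y i n - Y i m) < \<epsilon>" using Cau[of i n m] M[of n] M[of m] by linarith
      qed
    qed
    then show ?thesis by (simp add: Cauchy_convergent_iff convergent_def)
  qed
  then obtain y where y: "\<And>i. Y i \<longlonglongrightarrow> y i" by metis
  have iso: "iso_within K (closed_span e A) (closed_span y A)"
  proof (rule iso_within_equivalent_sequences)
    fix F and c :: "nat \<Rightarrow> real" assume F: "finite F" "F \<subseteq> A"
    have lim: "(\<lambda>n. norm (\<Sum>k\<in>F. c k *\<^sub>R Y k n)) \<longlonglongrightarrow> norm (\<Sum>k\<in>F. c k *\<^sub>R y k)"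
      by (intro tendsto_intros y)
    have "(\<lambda>n. K * norm (\<Sum>k\<in>F. c k *\<^sub>R e k) + (1/2) ^ n * (\<Sum>k\<in>F. \<bar>c k\<bar>))
        \<longlonglongrightarrow> K * norm (\<Sum>k\<in>F. c k *\<^sub>R e k) + 0 * (\<Sum>k\<in>F. \<bar>c k\<bar>)"
      by (intro tendsto_intros half_power_tendsto)
    from LIMSEQ_le[OF lim this] up[OF F]
    show "norm (\<Sum>i\<in>F. c i *\<^sub>R y i) \<le> K * norm (\<Sum>i\<in>F. c i *\<^sub>R e i)" by auto
    have "(\<lambda>n. K * (norm (\<Sum>k\<in>F. c k *\<^sub>R Y k n) + (1/2) ^ n * (\<Sum>k\<in>F. \<bar>c k\<bar>)))
        \<longlonglongrightarrow> K * (norm (\<Sum>k\<in>F. c k *\<^sub>R y k) + 0 * (\<Sum>k\<in>F. \<bar>c k\<bar>))"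
      by (intro tendsto_intros half_power_tendsto lim)
    from LIMSEQ_le_const[OF this] low[OF F]
    show "norm (\<Sum>i\<in>F. c i *\<^sub>R e i) \<le> K * norm (\<Sum>i\<in>F. c i *\<^sub>R y i)" by auto
  qed
  have "closed_span y A \<subseteq> closed_span e B"
    unfolding closed_span_def[of y]
  proof (intro closure_minimal span_minimal closed_closed_span subspace_closed_span)
    show "y ` A \<subseteq> closed_span e B"
    proof clarify
      fix i assume i: "i \<in> A"
      have "Y i n \<in> closed_span e B" for n
        using rat_comb_in_span[OF supp[OF i], of e n] closure_subset
        unfolding Y_def approx_image_def closed_span_def by blast
      then show "y i \<in> closed_span e B" using closed_sequentially[OF closed_closed_span _ y] by blast
    qed
  qed
  moreover have "closed_span e B \<subseteq> closed_span y A"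
    unfolding closed_span_def[of e]
  proof (intro closure_minimal span_minimal closed_closed_span subspace_closed_span)
    show "e ` B \<subseteq> closed_span y A"
    proof clarify
      fix j assume j: "j \<in> B"
      let ?v = "\<lambda>n. rat_comb y (w j n)"
      have "norm (?v n - e j) \<le> (1/2) ^ n" for n
      proof -
        have "(\<lambda>m. norm ((\<Sum>k<length (w j n). real_of_rat (w j n ! k) *\<^sub>R Y k m) - e j)) \<longlonglongrightarrow> norm (?v n - e j)"
          unfolding rat_comb_def by (intro tendsto_intros y)
        moreover have "(\<lambda>m. (1/2) ^ n + (1/2) ^ m * (\<Sum>k<length (w j n). \<bar>real_of_rat (w j n ! k)\<bar>))
            \<longlonglongrightarrow> (1/2) ^ n + 0 * (\<Sum>k<length (w j n). \<bar>real_of_rat (w j n ! k)\<bar>)"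
          by (intro tendsto_intros half_power_tendsto)
        ultimately have "norm (?v n - e j) \<le> (1/2) ^ n + 0 * (\<Sum>k<length (w j n). \<bar>real_of_rat (w j n ! k)\<bar>)"
          by (rule LIMSEQ_le) (use w[OF j] in blast)
        then show ?thesis by simp
      qed
      then have "(\<lambda>n. ?v n - e j) \<longlonglongrightarrow> 0"
        by (intro Lim_null_comparison[OF _ half_power_tendsto]) simp
      then have lim: "?v \<longlonglongrightarrow> e j" by (rule LIM_zero_cancel)
      have "?v n \<in> closed_span y A" for n
        using rat_comb_in_span[OF wsupp[OF j], of y n] closure_subset unfolding closed_span_def by blast
      then show "e j \<in> closed_span y A" using closed_sequentially[OF closed_closed_span _ lim] by blast
    qed
  qed
  ultimately show ?thesis using iso by simp
qed

text \<open>
  Choose rational combinations close to the images of the basis vectors and to the preimages of the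
  basis vectors. The error allowed for a preimage is \<open>(1/2) ^ n / K\<close>, since the isomorphism may enlarge
  it by the factor \<open>K\<close>.
\<close>

lemma iso_within_imp_codes_isomorphism:
  fixes e :: "nat \<Rightarrow> 'a::banach"
  assumes iso: "iso_within K (closed_span e A) (closed_span e B)" and K: "K \<ge> 1"
  shows "\<exists>x. \<forall>j. codes_isomorphism e K A B j x"
proof -
  have "0 \<le> K" using K by simp
  then obtain T T' where T: "isomorphism_pair (closed_span e A) (closed_span e B) T T'"
    "\<And>x. x \<in> closed_span e A \<Longrightarrow> norm (T x) \<le> K * norm x"
    "\<And>y. y \<in> closed_span e B \<Longrightarrow> norm (T' y) \<le> K * norm y"
    using iso_within_imp_isomorphism_pair[OF iso] by metis
  have lin: "linear_map_on (closed_span e A) T"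
    and TT: "\<And>v. v \<in> closed_span e A \<Longrightarrow> T' (T v) = v" "\<And>v. v \<in> closed_span e B \<Longrightarrow> T (T' v) = v"
      "\<And>v. v \<in> closed_span e A \<Longrightarrow> T v \<in> closed_span e B" "\<And>v. v \<in> closed_span e B \<Longrightarrow> T' v \<in> closed_span e A"
    using T(1) by (auto simp: isomorphism_pair_def homeomorphism_def)
  have "\<exists>l. i \<in> A \<longrightarrow> supported_in l B \<and> norm (rat_comb e l - T (e i)) < (1/2) ^ n" for i n
    using rat_comb_dense[OF TT(3)[OF in_closed_span[of i A e]], of "(1/2) ^ n"] by (cases "i \<in> A") auto
  then obtain l where l: "\<And>i n. i \<in> A \<Longrightarrow> supported_in (l i n) B"
    "\<And>i n. i \<in> A \<Longrightarrow> norm (rat_comb e (l i n) - T (e i)) < (1/2) ^ n" by metis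
  have "\<exists>l. j \<in> B \<longrightarrow> supported_in l A \<and> norm (rat_comb e l - T' (e j)) < (1/2) ^ n / K" for j n
    using rat_comb_dense[OF TT(4)[OF in_closed_span[of j B e]], of "(1/2) ^ n / K"] K by (cases "j \<in> B") auto
  then obtain w where w: "\<And>j n. j \<in> B \<Longrightarrow> supported_in (w j n) A"
    "\<And>j n. j \<in> B \<Longrightarrow> norm (rat_comb e (w j n) - T' (e j)) < (1/2) ^ n / K" by metis
  define x where "x k = (case prod_decode k of (i, n) \<Rightarrow> (if i \<in> A then l i n else [], w i n))" for k
  have fx: "fst (x (prod_encode (i, n))) = (if i \<in> A then l i n else [])"
    and sx: "snd (x (prod_encode (i, n))) = w i n" for i n
    by (simp_all add: x_def)
  define Y where "Y = approx_image e x"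
  have Y: "Y i n = (if i \<in> A then rat_comb e (l i n) else 0)" for i n
    by (simp add: Y_def approx_image_def fx rat_comb_def)
  have close: "norm (Y i n - T (e i)) \<le> (1/2) ^ n" if "i \<in> A" for i n
    using l(2)[OF that, of n] that by (simp add: Y less_imp_le)
  have T_sum: "T (\<Sum>k\<in>F. c k *\<^sub>R e k) = (\<Sum>k\<in>F. c k *\<^sub>R T (e k))" if "finite F" "F \<subseteq> A" for F c
    using linear_map_on_sum[OF lin subspace_closed_span that(1)] that in_closed_span by blast
  have sum_mem: "(\<Sum>k\<in>F. c k *\<^sub>R e k) \<in> closed_span e A" if "F \<subseteq> A" for F c
    using that by (intro subspace_sum subspace_scale subspace_closed_span in_closed_span) auto
  have err: "norm ((\<Sum>k\<in>F. c k *\<^sub>R Y k n) - T (\<Sum>k\<in>F. c k *\<^sub>R e k)) \<le> (1/2) ^ n * (\<Sum>k\<in>F. \<bar>c k\<bar>)"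
    if F: "finite F" "F \<subseteq> A" for F c n
  proof -
    have "(\<Sum>k\<in>F. c k *\<^sub>R Y k n) - T (\<Sum>k\<in>F. c k *\<^sub>R e k) = (\<Sum>k\<in>F. c k *\<^sub>R (Y k n - T (e k)))"
      by (simp add: T_sum[OF F] sum_subtractf scaleR_diff_right)
    also have "norm \<dots> \<le> (\<Sum>k\<in>F. (1/2) ^ n * \<bar>c k\<bar>)"
    proof (rule order_trans[OF norm_sum], rule sum_mono)
      fix k assume "k \<in> F"
      then have "norm (Y k n - T (e k)) * \<bar>c k\<bar> \<le> (1/2) ^ n * \<bar>c k\<bar>"
        using F(2) by (intro mult_right_mono close) auto
      then show "norm (c k *\<^sub>R (Y k n - T (e k))) \<le> (1/2) ^ n * \<bar>c k\<bar>" by (simp add: mult.commute)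
    qed
    finally show ?thesis by (simp add: sum_distrib_left)
  qed
  have "codes_isomorphism e K A B (i, n, m, F, c) x" for i n m F c
    unfolding codes_isomorphism_def prod.case Y_def[symmetric] fx sx Let_def
  proof (intro conjI impI)
    show "norm (Y i n - Y i m) \<le> (1/2) ^ n + (1/2) ^ m"
    proof (cases "i \<in> A")
      case True
      then show ?thesis using close[of i n] close[of i m]
          norm_triangle_ineq4[of "Y i n - T (e i)" "Y i m - T (e i)"] by simp
    qed (simp add: Y)
    show "supported_in (if i \<in> A then l i n else []) B" if "i \<in> A" using l(1) that by simp
    show "norm (\<Sum>k\<in>F. c k *\<^sub>R Y k n) \<le> K * norm (\<Sum>k\<in>F. c k *\<^sub>R e k) + (1/2) ^ n * (\<Sum>k\<in>F. \<bar>c k\<bar>)"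
      if F: "finite F \<and> F \<subseteq> A"
      using err[of F c n] T(2)[OF sum_mem[of F c]] F
        norm_triangle_sub[of "\<Sum>k\<in>F. c k *\<^sub>R Y k n" "T (\<Sum>k\<in>F. c k *\<^sub>R e k)"] by linarith
    show "norm (\<Sum>k\<in>F. c k *\<^sub>R e k) \<le> K * (norm (\<Sum>k\<in>F. c k *\<^sub>R Y k n) + (1/2) ^ n * (\<Sum>k\<in>F. \<bar>c k\<bar>))"
      if F: "finite F \<and> F \<subseteq> A"
    proof -
      let ?v = "\<Sum>k\<in>F. c k *\<^sub>R e k"
      have v: "?v \<in> closed_span e A" using F sum_mem by blast
      have "norm ?v \<le> K * norm (T ?v)" using T(3)[OF TT(3)[OF v]] TT(1)[OF v] by simp
      also have "\<dots> \<le> K * (norm (\<Sum>k\<in>F. c k *\<^sub>R Y k n) + (1/2) ^ n * (\<Sum>k\<in>F. \<bar>c k\<bar>))"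
        using err[of F c n] F norm_triangle_sub[of "T ?v" "\<Sum>k\<in>F. c k *\<^sub>R Y k n"] K
        by (intro mult_left_mono) (auto simp: norm_minus_commute)
      finally show ?thesis .
    qed
    show "supported_in (w i n) A" if "i \<in> B" using w(1) that by simp
    show "norm ((\<Sum>k<length (w i n). real_of_rat (w i n ! k) *\<^sub>R Y k m) - e i)
        \<le> (1/2) ^ n + (1/2) ^ m * (\<Sum>k<length (w i n). \<bar>real_of_rat (w i n ! k)\<bar>)" if i: "i \<in> B"
    proof -
      \<comment> \<open>Zero entries of the list may have indices outside \<open>A\<close>; they contribute nothing.\<close>
      define G where "G = {k. k < length (w i n) \<and> w i n ! k \<noteq> 0}"
      have G: "finite G" "G \<subseteq> A" "G \<subseteq> {..<length (w i n)}"
        using w(1)[OF i, of n] by (auto simp: G_def supported_in_def)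
      have restrict: "(\<Sum>k<length (w i n). real_of_rat (w i n ! k) *\<^sub>R f k) = (\<Sum>k\<in>G. real_of_rat (w i n ! k) *\<^sub>R f k)"
        for f :: "nat \<Rightarrow> 'a"
        using G by (intro sum.mono_neutral_right) (auto simp: G_def)
      have restrict': "(\<Sum>k<length (w i n). \<bar>real_of_rat (w i n ! k)\<bar>) = (\<Sum>k\<in>G. \<bar>real_of_rat (w i n ! k)\<bar>)"
        using G by (intro sum.mono_neutral_right) (auto simp: G_def)
      let ?v = "\<Sum>k\<in>G. real_of_rat (w i n ! k) *\<^sub>R e k"
      have v: "rat_comb e (w i n) = ?v" by (simp add: rat_comb_def restrict)
      have mem: "?v \<in> closed_span e A" "T' (e i) \<in> closed_span e A"
        by (rule sum_mem[OF G(2)], rule TT(4)[OF in_closed_span[OF i]])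
      have "T (?v + (-1) *\<^sub>R T' (e i)) = T ?v + (-1) *\<^sub>R T (T' (e i))"
        using lin mem subspace_scale[OF subspace_closed_span mem(2), of "-1"] unfolding linear_map_on_def by metis
      then have "T ?v - e i = T (?v - T' (e i))" using TT(2)[OF in_closed_span[OF i]] by simp
      then have "norm (T ?v - e i) \<le> K * norm (?v - T' (e i))"
        using T(2)[OF subspace_diff[OF subspace_closed_span mem]] by simp
      also have "\<dots> \<le> K * ((1/2) ^ n / K)"
        using w(2)[OF i, of n] K by (intro mult_left_mono) (auto simp: v)
      also have "\<dots> = (1/2) ^ n" using K by simp
      finally show ?thesis
        using err[OF G(1,2), of "\<lambda>k. real_of_rat (w i n ! k)" m] unfolding restrict restrict'
        using norm_triangle_ineq[of "(\<Sum>k\<in>G. real_of_rat (w i n ! k) *\<^sub>R Y k m) - T ?v" "T ?v - e i"]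
        by simp
    qed
  qed
  then show ?thesis by (intro exI[of _ x]) auto
qed

lemma cylinder_closed_if_finitely_determined:
  assumes "\<And>p q. q \<in> cylinder N p \<Longrightarrow> q \<in> F \<Longrightarrow> p \<in> F"
  shows "cylinder_closed F"
  unfolding cylinder_closed_def using assms by blast

text \<open>
  A condition asks about membership of the index \<open>i\<close>, the elements of \<open>F\<close> and the places of the two
  lists involved, and of nothing else.
\<close>

lemma codes_isomorphism_finitely_determined:
  "\<exists>N. \<forall>p q. q \<in> cylinder N p \<longrightarrow>
     codes_isomorphism e K (left_set q) (right_set q) j x \<longrightarrow> codes_isomorphism e K (left_set p) (right_set p) j x"
proof -
  obtain i n m F c where j: "j = (i, n, m, F, c)" by (cases j)
  define R where "R = insert i ((if finite F then F else {}) \<union> {..<length (fst (x (prod_encode (i, n))))}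
    \<union> {..<length (snd (x (prod_encode (i, n))))})"
  have "finite R" by (simp add: R_def)
  then obtain N where N: "\<And>k. k \<in> R \<Longrightarrow> k < N" using finite_nat_iff_bounded by (metis lessThan_iff subsetD)
  have "codes_isomorphism e K (left_set p) (right_set p) j x"
    if q: "q \<in> cylinder N p" "codes_isomorphism e K (left_set q) (right_set q) j x" for p q
  proof -
    have eq: "q k = p k" if "k \<in> R" for k using q(1) N[OF that] by (simp add: cylinder_def)
    have i: "q i = p i" by (rule eq) (simp add: R_def)
    have F: "finite F \<and> F \<subseteq> left_set q \<longleftrightarrow> finite F \<and> F \<subseteq> left_set p"
      using eq by (auto simp: R_def subset_iff)
    have s: "supported_in (fst (x (prod_encode (i, n)))) (right_set q) = supported_in (fst (x (prod_encode (i, n)))) (right_set p)"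
      "supported_in (snd (x (prod_encode (i, n)))) (left_set q) = supported_in (snd (x (prod_encode (i, n)))) (left_set p)"
      using eq by (auto simp: supported_in_def R_def)
    show ?thesis using q(2) unfolding j codes_isomorphism_def prod.case F s mem_Collect_eq i .
  qed
  then show ?thesis by blast
qed

text \<open>
  Which entries of \<open>x\<close> a condition reads depends on \<open>x\<close> itself, since the length of the list that
  approximates a preimage determines how many approximate images occur.
\<close>

lemma codes_isomorphism_local:
  "\<exists>M. \<forall>x'\<in>cylinder M x. \<forall>A B. codes_isomorphism e K A B j x' = codes_isomorphism e K A B j x"
proof -
  obtain i n m F c where j: "j = (i, n, m, F, c)" by (cases j)
  define R where "R = {prod_encode (i, n), prod_encode (i, m)}
    \<union> (\<lambda>k. prod_encode (k, n)) ` (if finite F then F else {})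
    \<union> (\<lambda>k. prod_encode (k, m)) ` {..<length (snd (x (prod_encode (i, n))))}"
  have "finite R" by (simp add: R_def)
  then obtain M where M: "\<And>k. k \<in> R \<Longrightarrow> k < M" using finite_nat_iff_bounded by (metis lessThan_iff subsetD)
  have "codes_isomorphism e K A B j x' = codes_isomorphism e K A B j x" if x': "x' \<in> cylinder M x" for x' A B
  proof -
    have eq: "x' k = x k" if "k \<in> R" for k using x' M[OF that] by (simp add: cylinder_def)
    have in': "x' (prod_encode (i, n)) = x (prod_encode (i, n))" "x' (prod_encode (i, m)) = x (prod_encode (i, m))"
      by (rule eq, simp add: R_def)+
    have Y: "approx_image e x' i n = approx_image e x i n" "approx_image e x' i m = approx_image e x i m"
      by (simp_all add: approx_image_def in')
    have sF: "(\<Sum>k\<in>F. c k *\<^sub>R approx_image e x' k n) = (\<Sum>k\<in>F. c k *\<^sub>R approx_image e x k n)"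
    proof (cases "finite F")
      case True
      then show ?thesis by (intro sum.cong) (auto simp: approx_image_def R_def eq)
    qed simp
    have sw: "(\<Sum>k<length w. real_of_rat (w ! k) *\<^sub>R approx_image e x' k m)
        = (\<Sum>k<length w. real_of_rat (w ! k) *\<^sub>R approx_image e x k m)"
      if "w = snd (x (prod_encode (i, n)))" for w
      using that by (intro sum.cong) (auto simp: approx_image_def R_def eq)
    show ?thesis
      unfolding j codes_isomorphism_def prod.case Y sF in' Let_def sw[OF refl] ..
  qed
  then show ?thesis by blast
qed

text \<open>
  Isomorphic pairs are isomorphic with some natural number as constant, so if the relation is not
  meager, then for one constant it is not meager, and for that constant it is a projection of a closed
  set.
\<close>

theorem isomorphism_relation_comeager_in_cylinder:
  fixes e :: "nat \<Rightarrow> 'a::banach"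
  assumes "\<not> meager {p. isomorphic (closed_span e (left_set p)) (closed_span e (right_set p))}"
  obtains K n p where "K \<ge> 1"
    "meager (cylinder n p - {q. iso_within K (closed_span e (left_set q)) (closed_span e (right_set q))})"
proof -
  note goal_that = that
  define E where "E K = {p. iso_within K (closed_span e (left_set p)) (closed_span e (right_set p))}" for K
  have "{p. isomorphic (closed_span e (left_set p)) (closed_span e (right_set p))} \<subseteq> (\<Union>k. E (real (Suc k)))"
  proof
    fix p assume "p \<in> {p. isomorphic (closed_span e (left_set p)) (closed_span e (right_set p))}"
    then obtain K where K: "iso_within K (closed_span e (left_set p)) (closed_span e (right_set p))"
      using isomorphic_imp_iso_within[OF subspace_closed_span] by blast
    obtain k where "K \<le> real k" using real_arch_simple by blast
    then have "p \<in> E (real (Suc k))" using iso_within_mono[OF K] by (simp add: E_def)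
    then show "p \<in> (\<Union>k. E (real (Suc k)))" by blast
  qed
  then have "\<not> meager (\<Union>k. E (real (Suc k)))" using assms meager_subset by blast
  then obtain k where k: "\<not> meager (E (real (Suc k)))" using meager_UN_nat[of "\<lambda>k. E (real (Suc k))"] by blast
  define K where "K = real (Suc k)"
  have K: "K \<ge> 1" by (simp add: K_def)
  define C where "C j x = {p. codes_isomorphism e K (left_set p) (right_set p) j x}" for j x
  have E: "E K = (\<Union>x. \<Inter>j. C j x)"
  proof (rule set_eqI, rule iffI)
    fix p assume "p \<in> E K"
    then obtain x where "\<forall>j. codes_isomorphism e K (left_set p) (right_set p) j x"
      using iso_within_imp_codes_isomorphism[OF _ K] unfolding E_def by blast
    then show "p \<in> (\<Union>x. \<Inter>j. C j x)" unfolding C_def by blast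
  next
    fix p assume "p \<in> (\<Union>x. \<Inter>j. C j x)"
    then obtain x where "\<And>j. codes_isomorphism e K (left_set p) (right_set p) j x" unfolding C_def by blast
    then show "p \<in> E K" unfolding E_def by (intro CollectI codes_isomorphism_imp_iso_within)
  qed
  show ?thesis
  proof (rule projection_comeager_in_cylinder[of C])
    show "cylinder_closed (C j x)" for j x
    proof -
      obtain N where "\<forall>p q. q \<in> cylinder N p \<longrightarrow> q \<in> C j x \<longrightarrow> p \<in> C j x"
        using codes_isomorphism_finitely_determined unfolding C_def by blast
      then show ?thesis by (intro cylinder_closed_if_finitely_determined) blast
    qed
    show "\<exists>m. \<forall>y\<in>cylinder m x. C j y = C j x" for j x
      using codes_isomorphism_local[of x e K j] unfolding C_def by auto
    show "\<not> meager (\<Union>x. \<Inter>j. C j x)" using k unfolding E[symmetric] K_def .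
    show thesis if "meager (cylinder n p - (\<Union>x. \<Inter>j. C j x))" for n p
      using that[unfolded E[symmetric] E_def] by (rule goal_that[OF K])
  qed
qed


section \<open>Hyperplanes\<close>

text \<open>
  The projection onto \<open>H\<close> along \<open>v\<close> is bounded because \<open>v\<close> has positive distance to \<open>H\<close>.
\<close>

lemma complement_line_bounded:
  fixes H :: "'a::real_normed_vector set"
  assumes H: "subspace H" "closed H" and v: "v \<notin> H"
  shows "\<exists>C. \<forall>h\<in>H. \<forall>c. norm h \<le> C * norm (h + c *\<^sub>R v)"
proof -
  define d where "d = infdist v H"
  have "H \<noteq> {}" using subspace_0[OF H(1)] by blast
  then have "d > 0"
    using v H(2) in_closed_iff_infdist_zero[of H v] infdist_nonneg[of v H] by (auto simp: d_def less_le)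
  have "norm h \<le> (1 + norm v / d) * norm (h + c *\<^sub>R v)" if h: "h \<in> H" for h c
  proof -
    have "\<bar>c\<bar> * d \<le> norm (h + c *\<^sub>R v)"
    proof (cases "c = 0")
      case False
      have "(- 1 / c) *\<^sub>R h \<in> H" using h by (rule subspace_scale[OF H(1)])
      then have "d \<le> norm (v - (- 1 / c) *\<^sub>R h)" unfolding d_def dist_norm[symmetric] by (rule infdist_le)
      then have "\<bar>c\<bar> * d \<le> \<bar>c\<bar> * norm (v - (- 1 / c) *\<^sub>R h)" by (rule mult_left_mono) simp
      also have "\<dots> = norm (c *\<^sub>R (v - (- 1 / c) *\<^sub>R h))" by simp
      also have "c *\<^sub>R (v - (- 1 / c) *\<^sub>R h) = h + c *\<^sub>R v" using False by (simp add: scaleR_diff_right scaleR_add_right)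
      finally show ?thesis .
    qed simp
    then have "\<bar>c\<bar> \<le> norm (h + c *\<^sub>R v) / d" using \<open>d > 0\<close> by (simp add: pos_le_divide_eq)
    then have "\<bar>c\<bar> * norm v \<le> norm (h + c *\<^sub>R v) / d * norm v" by (rule mult_right_mono) simp
    moreover have "norm h \<le> norm (h + c *\<^sub>R v) + \<bar>c\<bar> * norm v"
      using norm_triangle_ineq4[of "h + c *\<^sub>R v" "c *\<^sub>R v"] by simp
    ultimately show ?thesis by (simp add: algebra_simps)
  qed
  then show ?thesis by blast
qed

text \<open>
  The isomorphism is the projection along \<open>v\<close> from one hyperplane to the other.
\<close>

lemma iso_within_common_complement:
  fixes H H' :: "'a::real_normed_vector set"
  assumes H: "subspace H" "closed H" "v \<notin> H" "span (insert v H) = UNIV"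
    and H': "subspace H'" "closed H'" "v \<notin> H'" "span (insert v H') = UNIV"
  shows "\<exists>K. iso_within K H H'"
proof -
  obtain C where C: "\<And>h c. h \<in> H \<Longrightarrow> norm h \<le> C * norm (h + c *\<^sub>R v)"
    using complement_line_bounded[OF H(1-3)] by blast
  obtain C' where C': "\<And>h c. h \<in> H' \<Longrightarrow> norm h \<le> C' * norm (h + c *\<^sub>R v)"
    using complement_line_bounded[OF H'(1-3)] by blast
  have split: "\<exists>c. x - c *\<^sub>R v \<in> V" if "subspace V" "span (insert v V) = UNIV" for x V
  proof -
    have "x \<in> span (insert v V)" using that(2) by simp
    then obtain c where "x - c *\<^sub>R v \<in> span V" unfolding span_insert by blast
    then show ?thesis using that(1) by (auto simp: span_eq_iff[THEN iffD2])
  qed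
  let ?G = "{(h, h') |h h'. h \<in> H \<and> h' \<in> H' \<and> (\<exists>c. h = h' + c *\<^sub>R v)}"
  have "iso_within (max C C') H H'"
  proof (rule iso_withinI)
    show "subspace ?G"
      unfolding subspace_def
    proof (intro conjI ballI allI)
      show "0 \<in> ?G"
        using subspace_0[OF H(1)] subspace_0[OF H'(1)] by (auto simp: zero_prod_def intro!: exI[of _ 0])
      show "p + q \<in> ?G" if pq: "p \<in> ?G" "q \<in> ?G" for p q
      proof -
        obtain h h' c where p: "p = (h, h')" "h \<in> H" "h' \<in> H'" "h = h' + c *\<^sub>R v" using pq(1) by blast
        obtain k k' d where q: "q = (k, k')" "k \<in> H" "k' \<in> H'" "k = k' + d *\<^sub>R v" using pq(2) by blast
        have "h + k = (h' + k') + (c + d) *\<^sub>R v" using p(4) q(4) by (simp add: scaleR_add_left)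
        then show ?thesis using p q subspace_add[OF H(1)] subspace_add[OF H'(1)] by auto
      qed
      show "r *\<^sub>R p \<in> ?G" if p: "p \<in> ?G" for r p
      proof -
        obtain h h' c where p: "p = (h, h')" "h \<in> H" "h' \<in> H'" "h = h' + c *\<^sub>R v" using p by blast
        have "r *\<^sub>R h = r *\<^sub>R h' + (r * c) *\<^sub>R v" using p(4) by (simp add: scaleR_add_right)
        then show ?thesis using p(1) subspace_scale[OF H(1) p(2), of r] subspace_scale[OF H'(1) p(3), of r] by auto
      qed
    qed
    show "Domain ?G = H"
    proof
      show "H \<subseteq> Domain ?G"
      proof
        fix h assume h: "h \<in> H"
        obtain c where "h - c *\<^sub>R v \<in> H'" using split[OF H'(1,4)] by blast
        then have "(h, h - c *\<^sub>R v) \<in> ?G" using h by auto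
        then show "h \<in> Domain ?G" by blast
      qed
    qed auto
    show "Range ?G = H'"
    proof
      show "H' \<subseteq> Range ?G"
      proof
        fix h assume h: "h \<in> H'"
        obtain c where "h - c *\<^sub>R v \<in> H" using split[OF H(1,4)] by blast
        then have "(h - c *\<^sub>R v, h) \<in> ?G" using h by (auto intro!: exI[of _ "- c"])
        then show "h \<in> Range ?G" by blast
      qed
    qed auto
    fix h h' assume "(h, h') \<in> ?G"
    then obtain c where h: "h \<in> H" "h' \<in> H'" "h = h' + c *\<^sub>R v" by blast
    then have h': "h' = h + (- c) *\<^sub>R v" by simp
    have "norm h' \<le> C' * norm h" using C'[OF h(2), of c] h(3) by simp
    also have "\<dots> \<le> max C C' * norm h" by (intro mult_right_mono) auto
    finally show "norm h' \<le> max C C' * norm h" .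
    have "norm h \<le> C * norm h'" using C[OF h(1), of "- c"] h' by simp
    also have "\<dots> \<le> max C C' * norm h'" by (intro mult_right_mono) auto
    finally show "norm h \<le> max C C' * norm h'" .
  qed
  then show ?thesis by blast
qed

text \<open>
  A proper closed subspace misses some basis vector \<open>e i\<close>. Then \<open>H\<close> and the closed span of the other
  basis vectors are both complements of the line through \<open>e i\<close>.
\<close>

lemma hyperplane_iso_closed_span:
  fixes e :: "nat \<Rightarrow> 'a::banach" and H :: "'a set"
  assumes e: "unconditional_basis e" and H: "hyperplane H"
  shows "\<exists>i K. iso_within K (closed_span e (- {i})) H"
proof -
  have sb: "schauder_basis e" using e by (simp add: unconditional_basis_def)
  obtain v where v: "subspace H" "closed H" "v \<notin> H" "span (insert v H) = UNIV"
    using H unfolding hyperplane_def by blast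
  obtain i where i: "e i \<notin> H"
  proof (rule ccontr)
    assume "\<not> thesis"
    then have "range e \<subseteq> H" using that by blast
    then have "closed_span e UNIV \<subseteq> H"
      unfolding closed_span_def using v(1,2) by (intro closure_minimal span_minimal)
    then show False using v(3) closed_span_UNIV[OF e] by blast
  qed
  have span_i: "span (insert (e i) H) = UNIV"
  proof -
    have "e i \<in> span (insert v H)" using v(4) by simp
    then obtain c where "e i - c *\<^sub>R v \<in> span H" unfolding span_insert by blast
    then have c: "e i - c *\<^sub>R v \<in> H" using v(1) by (simp add: span_eq_iff[THEN iffD2])
    then have "c \<noteq> 0" using i by auto
    have "v = (1 / c) *\<^sub>R (e i - (e i - c *\<^sub>R v))" using \<open>c \<noteq> 0\<close> by simp
    also have "\<dots> \<in> span (insert (e i) H)" using c by (intro span_scale span_diff span_base) auto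
    finally have "insert v H \<subseteq> span (insert (e i) H)" by (auto intro: span_base)
    then have "span (insert v H) \<subseteq> span (insert (e i) H)" by (intro span_minimal subspace_span)
    then show ?thesis using v(4) by blast
  qed
  have coef_e: "coef e (e i) = (\<lambda>j. if j = i then 1 else 0)"
    using coef_finite_sum[OF sb, of "{i}" "\<lambda>_. 1"] by simp
  have "e i \<notin> closed_span e (- {i})" by (simp add: closed_span_iff_coef[OF e] coef_e)
  moreover have "span (insert (e i) (closed_span e (- {i}))) = UNIV"
  proof -
    have "x \<in> span (insert (e i) (closed_span e (- {i})))" for x
    proof -
      let ?c = "coef e x i"
      have "coef e (x + (- ?c) *\<^sub>R e i) i = 0"
        unfolding coef_add[OF sb] coef_scaleR[OF sb] coef_e by simp
      then have "x + (- ?c) *\<^sub>R e i \<in> closed_span e (- {i})" by (simp add: closed_span_iff_coef[OF e])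
      then have "x - ?c *\<^sub>R e i \<in> span (closed_span e (- {i}))" by (simp add: span_base)
      then show ?thesis unfolding span_insert by blast
    qed
    then show ?thesis by blast
  qed
  ultimately have "\<exists>K. iso_within K (closed_span e (- {i})) H"
    using v i span_i by (intro iso_within_common_complement[of _ "e i"]) auto
  then show ?thesis by blast
qed


section \<open>Schauder decompositions from partitions of the basis\<close>

lemma has_sum_in_closed_subspace:
  fixes V :: "'a::real_normed_vector set"
  assumes "subspace V" "closed V" "\<And>i. i \<in> A \<Longrightarrow> f i \<in> V" "(f has_sum x) A"
  shows "x \<in> V"
proof (rule Lim_in_closed_set[OF assms(2)])
  show "(sum f \<longlongrightarrow> x) (finite_subsets_at_top A)" using assms(4) by (simp add: has_sum_def)
  show "\<forall>\<^sub>F F in finite_subsets_at_top A. sum f F \<in> V"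
    by (rule eventually_finite_subsets_at_top_weakI) (use assms(1,3) in \<open>auto intro!: subspace_sum\<close>)
qed simp

text \<open>
  The component of a vector in the \<open>k\<close>-th part is determined by its coordinates with index in \<open>B k\<close>
  because coordinates are continuous. Conversely, an unconditionally convergent expansion can be summed
  in blocks.
\<close>

lemma closed_spans_schauder_decomposition:
  fixes e :: "nat \<Rightarrow> 'a::banach"
  assumes e: "unconditional_basis e" and B: "disjoint_family B"
  shows "unconditional_schauder_decomposition (\<lambda>k. closed_span e (B k)) (closed_span e (\<Union>k. B k))"
proof -
  have sb: "schauder_basis e" using e by (simp add: unconditional_basis_def)
  have unique: "f = g" if f: "\<And>k. f k \<in> closed_span e (B k)" "f sums y"
    and g: "\<And>k. g k \<in> closed_span e (B k)" "g sums y" for f g y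
  proof -
    have coef: "coef e (h k) = (\<lambda>i. if i \<in> B k then coef e y i else 0)"
      if h: "\<And>k. h k \<in> closed_span e (B k)" "h sums y" for h k
    proof
      fix i
      show "coef e (h k) i = (if i \<in> B k then coef e y i else 0)"
      proof (cases "i \<in> B k")
        case True
        have zero: "coef e (h j) i = 0" if "j \<noteq> k" for j
        proof -
          have "i \<notin> B j" using B True that unfolding disjoint_family_on_def by blast
          then show ?thesis using h(1)[of j] by (simp add: closed_span_iff_coef[OF e])
        qed
        have "(\<lambda>j. coef e (h j) i) sums coef e y i"
          using bounded_linear.sums[OF bounded_linear_coef[OF e] h(2)] .
        moreover have "(\<lambda>j. coef e (h j) i) sums (\<Sum>j\<in>{k}. coef e (h j) i)"
          by (rule sums_finite) (use zero in auto)
        ultimately show ?thesis using sums_unique2 True by fastforce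
      next
        case False
        then show ?thesis using h(1)[of k] by (simp add: closed_span_iff_coef[OF e])
      qed
    qed
    show "f = g"
    proof
      fix k
      have "coef e (f k) = coef e (g k)" using coef[OF f] coef[OF g] by simp
      then show "f k = g k" using coef_sums[OF sb, of "f k"] coef_sums[OF sb, of "g k"] sums_unique2 by metis
    qed
  qed
  have exist: "\<exists>f. (\<forall>k. f k \<in> closed_span e (B k)) \<and> (f has_sum y) UNIV"
    if y: "y \<in> closed_span e (\<Union>k. B k)" for y
  proof -
    let ?t = "\<lambda>i. coef e y i *\<^sub>R e i"
    have "(?t has_sum y) UNIV" using e coef_sums[OF sb] unfolding unconditional_basis_def by blast
    then have hs: "(?t has_sum y) (\<Union>k. B k)"
      using y by (subst (asm) has_sum_cong_neutral[of "\<Union>k. B k" UNIV ?t ?t]) (auto simp: closed_span_iff_coef[OF e])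
    define f where "f k = infsum ?t (B k)" for k
    have f: "(?t has_sum f k) (B k)" for k
    proof -
      have "?t summable_on (\<Union>k. B k)" using hs by (rule has_sum_imp_summable)
      then have "?t summable_on B k" by (rule summable_on_subset_banach) blast
      then show ?thesis unfolding f_def by (rule has_sum_infsum)
    qed
    have bij: "bij_betw snd (Sigma UNIV B) (\<Union>k. B k)"
      unfolding bij_betw_def
    proof
      show "inj_on snd (Sigma UNIV B)"
        using B unfolding disjoint_family_on_def inj_on_def by auto
    qed force
    have "((\<lambda>p. ?t (snd p)) has_sum y) (Sigma UNIV B)"
      using has_sum_reindex_bij_betw[OF bij, of ?t y] hs by simp
    then have "(f has_sum y) UNIV" by (rule has_sum_SigmaD) (use f in simp)
    moreover have "f k \<in> closed_span e (B k)" for k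
      by (rule has_sum_in_closed_subspace[OF _ _ _ f[of k]]) (auto intro: subspace_scale in_closed_span)
    ultimately show ?thesis by blast
  qed
  show ?thesis
    unfolding unconditional_schauder_decomposition_def
  proof (intro conjI allI ballI impI)
    show "closed_span e (B k) \<subseteq> closed_span e (\<Union>k. B k)" for k by (rule closed_span_mono) blast
    fix y assume y: "y \<in> closed_span e (\<Union>k. B k)"
    obtain g where g: "\<And>k. g k \<in> closed_span e (B k)" "(g has_sum y) UNIV" using exist[OF y] by blast
    have gs: "g sums y" using g(2) by (rule has_sum_imp_sums)
    show "\<exists>!f. (\<forall>k. f k \<in> closed_span e (B k)) \<and> f sums y"
      by (rule ex1I[of _ g]) (use g(1) gs unique in blast)+
    show "(f has_sum y) UNIV" if "(\<forall>k. f k \<in> closed_span e (B k)) \<and> f sums y" for f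
      using unique[of f y g] that g gs by simp
  qed auto
qed


section \<open>Generic sets of indices\<close>

lemma uniformly_isomorphic_Un:
  fixes e :: "nat \<Rightarrow> 'a::banach"
  assumes "unconditional_basis e" "\<And>i. i \<in> I \<Longrightarrow> A i \<inter> B i = {}"
  shows "uniformly_isomorphic I (\<lambda>i. closed_span e (A i) \<times> closed_span e (B i)) (\<lambda>i. closed_span e (A i \<union> B i))"
proof -
  obtain K where "K \<ge> 1" "\<forall>A B. A \<inter> B = {} \<longrightarrow> iso_within K (closed_span e A \<times> closed_span e B) (closed_span e (A \<union> B))"
    using iso_within_closed_span_Un[OF assms(1)] by (elim exE conjE) (rule that)
  then show ?thesis unfolding uniformly_isomorphic_def using assms(2) by (intro exI[of _ K]) simp
qed

lemma uniformly_isomorphic_finite: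
  fixes e :: "nat \<Rightarrow> 'a::banach"
  assumes "unconditional_basis e"
    "\<And>i. i \<in> I \<Longrightarrow> finite (F i) \<and> finite (G i) \<and> card (F i) = card (G i) \<and> card (G i) \<le> n"
  shows "uniformly_isomorphic I (\<lambda>i. closed_span e (F i)) (\<lambda>i. closed_span e (G i))"
proof -
  obtain K where "K \<ge> 1" "\<forall>F G. finite F \<and> finite G \<and> card F = card G \<and> card G \<le> n \<longrightarrow>
      iso_within K (closed_span e F) (closed_span e G)"
    using iso_within_finite[OF assms(1), of n] by (elim exE conjE) (rule that)
  then show ?thesis unfolding uniformly_isomorphic_def using assms(2) by (intro exI[of _ K]) simp
qed

lemma uniformly_isomorphic_reindex:
  assumes "uniformly_isomorphic J Y Z" "\<And>i. i \<in> I \<Longrightarrow> h i \<in> J"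
  shows "uniformly_isomorphic I (\<lambda>i. Y (h i)) (\<lambda>i. Z (h i))"
  using assms unfolding uniformly_isomorphic_def by blast

text \<open>
  The pattern is here a single set of indices, given by its characteristic function \<open>a\<close>.
\<close>

definition generic :: "(nat \<Rightarrow> nat) \<Rightarrow> (nat \<Rightarrow> bool) \<Rightarrow> nat set \<Rightarrow> bool" where
  "generic f a B \<longleftrightarrow> infinite {n. matches f a n (char_fun B)}"

lemma genericI:
  assumes "infinite S" "\<And>n i. n \<in> S \<Longrightarrow> f n \<le> i \<Longrightarrow> i < f (Suc n) \<Longrightarrow> i \<in> B \<longleftrightarrow> a i"
  shows "generic f a B"
proof -
  have "S \<subseteq> {n. matches f a n (char_fun B)}" using assms(2) by (auto simp: matches_def char_fun_def)
  then show ?thesis unfolding generic_def using assms(1) finite_subset by blast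
qed

lemma generic_finite_change:
  assumes sm: "strict_mono f" and B: "generic f a B" and fin: "finite (B - B' \<union> (B' - B))"
  shows "generic f a B'"
proof -
  obtain N where N: "B - B' \<union> (B' - B) \<subseteq> {..<N}" using fin finite_nat_iff_bounded by blast
  show ?thesis
  proof (rule genericI)
    show "infinite ({n. matches f a n (char_fun B)} - {..<N})" using B unfolding generic_def by auto
    fix n i assume n: "n \<in> {n. matches f a n (char_fun B)} - {..<N}" "f n \<le> i" "i < f (Suc n)"
    then have "N \<le> i" using strict_mono_imp_increasing[OF sm, of n] by simp
    then have "i \<in> B' \<longleftrightarrow> i \<in> B" using N by fastforce
    then show "i \<in> B' \<longleftrightarrow> a i" using n by (auto simp: matches_def char_fun_def)
  qed
qed

lemma generic_infinite_coinfinite: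
  assumes sm: "strict_mono f" and a: "\<And>n c. \<exists>i\<in>{f n..<f (Suc n)}. a i = c" and B: "generic f a B"
  shows "infinite B" "infinite (- B)"
proof -
  let ?N = "{n. matches f a n (char_fun B)}"
  have N: "infinite ?N" using B by (simp add: generic_def)
  show "infinite B"
    by (rule infinite_if_meets_infinitely_many_blocks[OF sm N])
      (use a[of _ True] in \<open>fastforce simp: matches_def char_fun_def\<close>)
  show "infinite (- B)"
    by (rule infinite_if_meets_infinitely_many_blocks[OF sm N])
      (use a[of _ False] in \<open>fastforce simp: matches_def char_fun_def\<close>)
qed

text \<open>
  To give a generic set the beginning \<open>t\<close>, exchange the elements below \<open>L\<close> for those of \<open>t\<close>. In order
  that equally many elements leave and enter, \<open>card t\<close> further elements are removed and as many new ones
  added as have been removed below \<open>L\<close>, all beyond \<open>L\<close>; this is possible since generic sets are infinite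
  and coinfinite.
\<close>

lemma generic_swap:
  assumes sm: "strict_mono f" and a: "\<And>n c. \<exists>i\<in>{f n..<f (Suc n)}. a i = c" and B: "generic f a B"
    and t: "t \<subseteq> {..<L}"
  shows "\<exists>C D D'. C \<union> D = B \<and> C \<inter> D = {} \<and> C \<inter> D' = {} \<and> finite D \<and> finite D' \<and> card D = card D' \<and>
    card D' \<le> 2 * L \<and> generic f a (C \<union> D') \<and> (C \<union> D') \<inter> {..<L} = t"
proof -
  let ?u = "B \<inter> {..<L}"
  have "infinite (- B - {..<L})" "infinite (B - {..<L})"
    using generic_infinite_coinfinite[OF sm a B] by auto
  then obtain M M' where M: "finite M" "card M = card ?u" "M \<subseteq> - B - {..<L}"
    and M': "finite M'" "card M' = card t" "M' \<subseteq> B - {..<L}"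
    using infinite_arbitrarily_large by meson
  let ?C = "B - {..<L} - M'"
  have fin: "finite ?u" "finite t" using t finite_subset by auto
  have cards: "card (?u \<union> M') = card ?u + card t" "card (t \<union> M) = card t + card ?u"
    using M M' fin t by (subst card_Un_disjoint; auto)+
  have "card ?u \<le> L" "card t \<le> L" using card_mono[of "{..<L}"] t by (metis Int_lower2 card_lessThan finite_lessThan)+
  show ?thesis
  proof (intro exI conjI)
    show "?C \<union> (?u \<union> M') = B" "?C \<inter> (?u \<union> M') = {}" "?C \<inter> (t \<union> M) = {}"
      "(?C \<union> (t \<union> M)) \<inter> {..<L} = t" using M(3) M'(3) t by auto
    show "finite (?u \<union> M')" "finite (t \<union> M)" using fin M M' by auto
    show "card (?u \<union> M') = card (t \<union> M)" "card (t \<union> M) \<le> 2 * L"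
      using cards \<open>card ?u \<le> L\<close> \<open>card t \<le> L\<close> by auto
    show "generic f a (?C \<union> (t \<union> M))"
    proof (rule generic_finite_change[OF sm B])
      show "finite (B - (?C \<union> (t \<union> M)) \<union> (?C \<union> (t \<union> M) - B))"
        by (rule finite_subset[of _ "?u \<union> M' \<union> t \<union> M"]) (use fin M M' in auto)
    qed
  qed
qed

text \<open>
  Only sets with the beginning \<open>t\<close> are assumed to span copies of \<open>Z\<close>. The exchange that produces this
  beginning involves at most \<open>2 * L\<close> elements, which bounds the constant.
\<close>

lemma generic_uniformly_isomorphic:
  fixes e :: "nat \<Rightarrow> 'a::banach"
  assumes e: "unconditional_basis e"
    and sm: "strict_mono f" and a: "\<And>n c. \<exists>i\<in>{f n..<f (Suc n)}. a i = c"
    and t: "t \<subseteq> {..<L}" and K: "K \<ge> 1"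
    and Z: "\<And>B. generic f a B \<Longrightarrow> B \<inter> {..<L} = t \<Longrightarrow> iso_within K (closed_span e B) Z"
  shows "uniformly_isomorphic {B. generic f a B} (closed_span e) (\<lambda>_. Z)"
proof -
  let ?I = "{B. generic f a B}"
  define good where "good B C D D' \<longleftrightarrow> C \<union> D = B \<and> C \<inter> D = {} \<and> C \<inter> D' = {} \<and> finite D \<and> finite D' \<and>
    card D = card D' \<and> card D' \<le> 2 * L \<and> generic f a (C \<union> D') \<and> (C \<union> D') \<inter> {..<L} = t" for B C D D'
  have "\<forall>B. \<exists>C D D'. B \<in> ?I \<longrightarrow> good B C D D'"
    using generic_swap[OF sm a _ t] unfolding good_def by simp
  then obtain C D D' where "\<And>B. B \<in> ?I \<Longrightarrow> good B (C B) (D B) (D' B)" by metis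
  then have CD: "\<And>B. B \<in> ?I \<Longrightarrow> C B \<union> D B = B" "\<And>B. B \<in> ?I \<Longrightarrow> C B \<inter> D B = {}"
    "\<And>B. B \<in> ?I \<Longrightarrow> C B \<inter> D' B = {}"
    "\<And>B. B \<in> ?I \<Longrightarrow> finite (D B) \<and> finite (D' B) \<and> card (D B) = card (D' B) \<and> card (D' B) \<le> 2 * L"
    "\<And>B. B \<in> ?I \<Longrightarrow> generic f a (C B \<union> D' B)" "\<And>B. B \<in> ?I \<Longrightarrow> (C B \<union> D' B) \<inter> {..<L} = t"
    unfolding good_def by simp_all
  have "uniformly_isomorphic ?I (closed_span e) (\<lambda>B. closed_span e (C B \<union> D B))"
    using CD(1) by (simp add: uniformly_isomorphic_def) (intro exI[of _ 1], simp add: iso_within_refl)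
  also have "uniformly_isomorphic ?I (\<lambda>B. closed_span e (C B \<union> D B)) (\<lambda>B. closed_span e (C B) \<times> closed_span e (D B))"
    by (intro uniformly_isomorphic_sym[OF uniformly_isomorphic_Un] e CD)
  also have "uniformly_isomorphic ?I (\<lambda>B. closed_span e (C B) \<times> closed_span e (D B)) (\<lambda>B. closed_span e (C B) \<times> closed_span e (D' B))"
    by (intro uniformly_isomorphic_Times uniformly_isomorphic_refl subspace_closed_span uniformly_isomorphic_finite[OF e CD(4)])
  also have "uniformly_isomorphic ?I (\<lambda>B. closed_span e (C B) \<times> closed_span e (D' B)) (\<lambda>B. closed_span e (C B \<union> D' B))"
    by (intro uniformly_isomorphic_Un e CD)
  also have "uniformly_isomorphic ?I (\<lambda>B. closed_span e (C B \<union> D' B)) (\<lambda>_. Z)"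
    unfolding uniformly_isomorphic_def using K Z[OF CD(5,6)] by (intro exI[of _ K]) simp
  finally show ?thesis .
qed


section \<open>Consequences of a generic isomorphism type\<close>

text \<open>
  In each part the index sets are arranged in such a way that all pieces of a partition are generic,
  where a piece that is allowed to be arbitrary is joined to a generic set that matches the pattern on
  blocks untouched by the piece.
\<close>

theorem generic_uniformly_isomorphic_imp_decomposable:
  fixes e :: "nat \<Rightarrow> 'a::banach" and Z :: "'a set"
  assumes e: "unconditional_basis e" and sm: "strict_mono f" and Z: "subspace Z"
    and unif: "uniformly_isomorphic {B. generic f a B} (closed_span e) (\<lambda>_. Z)"
  shows "(\<exists>R :: nat set set. residual (char_fun ` R) \<and>
        (\<forall>A\<in>R. isomorphic (closed_span e A) (UNIV :: 'a set))) \<and>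
      (\<forall>H :: 'a set. hyperplane H \<longrightarrow> isomorphic (UNIV :: 'a set) H) \<and>
      isomorphic (UNIV :: 'a set) (UNIV :: ('a \<times> 'a) set) \<and>
      (\<exists>K. \<forall>D :: nat set.
         K_isomorphic K ((UNIV :: 'a set) \<times> closed_span e D) (UNIV :: 'a set)) \<and>
      (\<exists>B :: nat \<Rightarrow> nat set. disjoint_family B \<and>
         (\<exists>K'. \<forall>k. K_isomorphic K' (closed_span e (B k)) (UNIV :: 'a set)) \<and>
         isomorphic (UNIV :: 'a set) (closed_span e (\<Union>k. B k)) \<and>
         unconditional_schauder_decomposition
           (\<lambda>k. closed_span e (B k)) (closed_span e (\<Union>k. B k)))"
proof -
  have gen: "uniformly_isomorphic I (\<lambda>i. closed_span e (h i)) (\<lambda>_. Z)"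
    if "\<And>i. i \<in> I \<Longrightarrow> generic f a (h i)" for I :: "'i set" and h
    using uniformly_isomorphic_reindex[OF unif, of I h] that by simp
  define block where "block n = {f n..<f (Suc n)}" for n
  have block_disj: "n = m" if "i \<in> block n" "i \<in> block m" for n m i
  proof (rule ccontr)
    assume "n \<noteq> m"
    then have "f (Suc n) \<le> f m \<or> f (Suc m) \<le> f n"
      using strict_mono_less_eq[OF sm] by (metis Suc_leI linorder_neqE_nat)
    then show False using that by (auto simp: block_def)
  qed
  \<comment> \<open>The set that follows the pattern on the blocks with number in \<open>S\<close> and is empty elsewhere.\<close>
  define copies where "copies S = {i. a i \<and> (\<exists>n\<in>S. i \<in> block n)}" for S
  have copies_generic: "generic f a (copies S \<union> D)"
    if "infinite S" "\<And>n. n \<in> S \<Longrightarrow> D \<inter> block n = {}" for S D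
  proof (rule genericI[OF that(1)])
    fix n i assume n: "n \<in> S" "f n \<le> i" "i < f (Suc n)"
    then have "i \<in> block n" by (simp add: block_def)
    then show "i \<in> copies S \<union> D \<longleftrightarrow> a i" using n(1) that(2) by (auto simp: copies_def)
  qed
  have copies_disj: "copies S \<inter> copies S' = {}" if "S \<inter> S' = {}" for S S'
    using that block_disj unfolding copies_def by blast
  have inf_even: "infinite {n::nat. even n}" and inf_odd: "infinite {n::nat. odd n}"
  proof -
    show "infinite {n::nat. even n}"
      unfolding infinite_nat_iff_unbounded_le by (metis even_Suc le_SucI mem_Collect_eq order_refl)
    show "infinite {n::nat. odd n}"
      unfolding infinite_nat_iff_unbounded_le by (metis even_Suc le_SucI mem_Collect_eq order_refl)
  qed
  have ZZ: "uniformly_isomorphic I (\<lambda>_. Z \<times> Z) (\<lambda>_. Z)" for I :: "'i set"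
  proof -
    let ?A = "copies {n. even n}" and ?B = "copies {n. odd n}"
    have gA: "generic f a ?A" using copies_generic[OF inf_even, of "{}"] by simp
    have gB: "generic f a ?B" using copies_generic[OF inf_odd, of "{}"] by simp
    have disj: "?A \<inter> ?B = {}" by (rule copies_disj) auto
    have gAB: "generic f a (?A \<union> ?B)"
      using copies_generic[of UNIV "{}"] by (rule back_subst[of "generic f a"]) (auto simp: copies_def)
    have "uniformly_isomorphic I (\<lambda>_. Z \<times> Z) (\<lambda>_. closed_span e ?A \<times> closed_span e ?B)"
      by (rule uniformly_isomorphic_sym) (intro uniformly_isomorphic_Times gen gA gB)
    also have "uniformly_isomorphic I (\<lambda>_. closed_span e ?A \<times> closed_span e ?B) (\<lambda>_. closed_span e (?A \<union> ?B))"
      by (intro uniformly_isomorphic_Un e disj)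
    also have "uniformly_isomorphic I (\<lambda>_. closed_span e (?A \<union> ?B)) (\<lambda>_. Z)"
      by (intro gen gAB)
    finally show ?thesis .
  qed
  have cofinite: "uniformly_isomorphic {W. finite (- W)} (closed_span e) (\<lambda>_. Z)"
  proof -
    let ?I = "{W :: nat set. finite (- W)}"
    \<comment> \<open>This set follows the pattern on even blocks, and its complement does so on odd blocks.\<close>
    let ?G = "{i. \<exists>n. i \<in> block n \<and> (a i \<longleftrightarrow> even n)}"
    have iff: "i \<in> ?G \<longleftrightarrow> (a i \<longleftrightarrow> even n)" if "i \<in> block n" for i n
    proof -
      have "m = n" if "i \<in> block m" for m using block_disj that \<open>i \<in> block n\<close> by blast
      then show ?thesis using that by blast
    qed
    have G: "generic f a ?G"
    proof (rule genericI[OF inf_even])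
      fix n i assume "n \<in> {n. even n}" "f n \<le> i" "i < f (Suc n)"
      then show "i \<in> ?G \<longleftrightarrow> a i" using iff[of i n] by (simp add: block_def)
    qed
    have G': "generic f a (- ?G)"
    proof (rule genericI[OF inf_odd])
      fix n i assume "n \<in> {n. odd n}" "f n \<le> i" "i < f (Suc n)"
      then show "i \<in> - ?G \<longleftrightarrow> a i" using iff[of i n] by (simp add: block_def)
    qed
    have trace: "generic f a (W \<inter> A)" if A: "generic f a A" and W: "W \<in> ?I" for W A
    proof (rule generic_finite_change[OF sm A])
      show "finite (A - W \<inter> A \<union> (W \<inter> A - A))" by (rule finite_subset[of _ "- W"]) (use W in auto)
    qed
    have "uniformly_isomorphic ?I (\<lambda>W. closed_span e (W \<inter> ?G \<union> W \<inter> - ?G))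
        (\<lambda>W. closed_span e (W \<inter> ?G) \<times> closed_span e (W \<inter> - ?G))"
      by (intro uniformly_isomorphic_sym[OF uniformly_isomorphic_Un] e) auto
    also have "uniformly_isomorphic ?I (\<lambda>W. closed_span e (W \<inter> ?G) \<times> closed_span e (W \<inter> - ?G)) (\<lambda>_. Z \<times> Z)"
      by (intro uniformly_isomorphic_Times gen trace G G')
    also note ZZ
    finally show ?thesis by (simp add: Int_Un_distrib[symmetric])
  qed
  have XZ: "uniformly_isomorphic I (\<lambda>_. UNIV :: 'a set) (\<lambda>_. Z)" for I :: "'i set"
    using uniformly_isomorphic_reindex[OF cofinite, of I "\<lambda>_. UNIV"] by (simp add: closed_span_UNIV[OF e])
  note ZX = uniformly_isomorphic_sym[OF XZ]
  have gen_X: "uniformly_isomorphic I (\<lambda>i. closed_span e (h i)) (\<lambda>_. UNIV :: 'a set)"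
    if "\<And>i. i \<in> I \<Longrightarrow> generic f a (h i)" for I :: "'i set" and h
    by (rule uniformly_isomorphic_trans[OF gen ZX]) (rule that)
  have K_iso: "\<exists>K. \<forall>i. K_isomorphic K (Y i) (V i)" if YV: "uniformly_isomorphic UNIV Y V"
    for Y :: "'i \<Rightarrow> 'x::real_normed_vector set" and V :: "'i \<Rightarrow> 'y::real_normed_vector set"
  proof -
    obtain K where "K \<ge> 1" "\<forall>i. iso_within K (Y i) (V i)" using YV by (auto simp: uniformly_isomorphic_def)
    then show ?thesis by (intro exI[of _ "K * K"]) (auto intro: iso_within_imp_K_isomorphic)
  qed
  have iso: "isomorphic Y V" if "uniformly_isomorphic (UNIV :: unit set) (\<lambda>_. Y) (\<lambda>_. V)"
    for Y :: "'x::real_normed_vector set" and V :: "'y::real_normed_vector set"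
    using that iso_within_imp_isomorphic by (auto simp: uniformly_isomorphic_def)
  have "\<exists>R :: nat set set. residual (char_fun ` R) \<and> (\<forall>A\<in>R. isomorphic (closed_span e A) (UNIV :: 'a set))"
  proof (intro exI conjI ballI)
    have "char_fun ` {B. generic f a B} = {q. infinite {n. matches f a n q}}"
    proof (rule set_eqI, rule iffI)
      fix q assume q: "q \<in> {q. infinite {n. matches f a n q}}"
      have "q = char_fun {i. q i}" by (simp add: char_fun_def)
      then show "q \<in> char_fun ` {B. generic f a B}" using q by (auto simp: generic_def)
    qed (auto simp: generic_def)
    then show "residual (char_fun ` {B. generic f a B})"
      using residual_matching_infinitely_often[OF sm] by simp
    show "isomorphic (closed_span e B) (UNIV :: 'a set)" if "B \<in> {B. generic f a B}" for B
      using gen_X[of UNIV "\<lambda>_::unit. B"] that by (intro iso) simp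
  qed
  moreover have "isomorphic (UNIV :: 'a set) H" if H: "hyperplane H" for H :: "'a set"
  proof -
    obtain i K where K: "iso_within K (closed_span e (- {i})) H"
      using hyperplane_iso_closed_span[OF e H] by blast
    have "uniformly_isomorphic (UNIV :: unit set) (\<lambda>_. closed_span e (- {i})) (\<lambda>_. Z)"
      using uniformly_isomorphic_reindex[OF cofinite, of UNIV "\<lambda>_. - {i}"] by simp
    then have "uniformly_isomorphic (UNIV :: unit set) (\<lambda>_. UNIV :: 'a set) (\<lambda>_. closed_span e (- {i}))"
      using XZ uniformly_isomorphic_sym uniformly_isomorphic_trans by blast
    moreover have "uniformly_isomorphic (UNIV :: unit set) (\<lambda>_. closed_span e (- {i})) (\<lambda>_. H)"
      unfolding uniformly_isomorphic_def using iso_within_mono[OF K] by (intro exI[of _ "max 1 K"]) auto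
    ultimately show ?thesis by (intro iso) (rule uniformly_isomorphic_trans)
  qed
  moreover have "isomorphic (UNIV :: 'a set) (UNIV :: ('a \<times> 'a) set)"
  proof (rule iso)
    have "uniformly_isomorphic (UNIV :: unit set) (\<lambda>_. UNIV :: 'a set) (\<lambda>_. Z)" by (rule XZ)
    also have "uniformly_isomorphic (UNIV :: unit set) (\<lambda>_. Z) (\<lambda>_. Z \<times> Z)"
      by (rule uniformly_isomorphic_sym[OF ZZ])
    also have "uniformly_isomorphic (UNIV :: unit set) (\<lambda>_. Z \<times> Z) (\<lambda>_. (UNIV :: 'a set) \<times> (UNIV :: 'a set))"
      by (intro uniformly_isomorphic_Times ZX)
    finally show "uniformly_isomorphic (UNIV :: unit set) (\<lambda>_. UNIV :: 'a set) (\<lambda>_. UNIV :: ('a \<times> 'a) set)"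
      by simp
  qed
  moreover have "\<exists>K. \<forall>D :: nat set. K_isomorphic K ((UNIV :: 'a set) \<times> closed_span e D) (UNIV :: 'a set)"
  proof (rule K_iso)
    \<comment> \<open>The part of \<open>D\<close> in \<open>E\<close> leaves odd blocks untouched, and the rest of \<open>D\<close> leaves even blocks untouched.\<close>
    define E where "E = (\<Union>n\<in>{n. even n}. block n)"
    have absorb: "uniformly_isomorphic UNIV (\<lambda>D. Z \<times> closed_span e (h D)) (\<lambda>_. Z)"
      if S: "infinite S" "\<And>D n. n \<in> S \<Longrightarrow> h D \<inter> block n = {}" for S and h :: "nat set \<Rightarrow> nat set"
    proof -
      have disj: "copies S \<inter> h D = {}" for D using S(2) by (auto simp: copies_def)
      have gS: "generic f a (copies S)" using copies_generic[OF S(1), of "{}"] by simp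
      have "uniformly_isomorphic UNIV (\<lambda>D. Z \<times> closed_span e (h D)) (\<lambda>D. closed_span e (copies S) \<times> closed_span e (h D))"
        by (rule uniformly_isomorphic_sym)
          (intro uniformly_isomorphic_Times gen gS uniformly_isomorphic_refl subspace_closed_span)
      also have "uniformly_isomorphic UNIV (\<lambda>D. closed_span e (copies S) \<times> closed_span e (h D)) (\<lambda>D. closed_span e (copies S \<union> h D))"
        by (intro uniformly_isomorphic_Un e disj)
      also have "uniformly_isomorphic UNIV (\<lambda>D. closed_span e (copies S \<union> h D)) (\<lambda>_. Z)"
        by (intro gen copies_generic S)
      finally show ?thesis .
    qed
    have 1: "uniformly_isomorphic UNIV (\<lambda>D. Z \<times> closed_span e (D \<inter> E)) (\<lambda>_. Z)"
      by (rule absorb[OF inf_odd]) (use block_disj in \<open>auto simp: E_def\<close>)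
    have 2: "uniformly_isomorphic UNIV (\<lambda>D. Z \<times> closed_span e (D - E)) (\<lambda>_. Z)"
      by (rule absorb[OF inf_even]) (unfold E_def, blast)
    have "uniformly_isomorphic UNIV (\<lambda>D. (UNIV :: 'a set) \<times> closed_span e D) (\<lambda>D. Z \<times> closed_span e (D \<inter> E \<union> (D - E)))"
      by (intro uniformly_isomorphic_Times XZ) (simp add: Int_Diff_Un uniformly_isomorphic_refl)
    also have "uniformly_isomorphic UNIV (\<lambda>D. Z \<times> closed_span e (D \<inter> E \<union> (D - E)))
        (\<lambda>D. Z \<times> (closed_span e (D \<inter> E) \<times> closed_span e (D - E)))"
      by (intro uniformly_isomorphic_Times uniformly_isomorphic_refl Z uniformly_isomorphic_sym[OF uniformly_isomorphic_Un] e) auto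
    also have "uniformly_isomorphic UNIV (\<lambda>D. Z \<times> (closed_span e (D \<inter> E) \<times> closed_span e (D - E)))
        (\<lambda>D. (Z \<times> closed_span e (D \<inter> E)) \<times> closed_span e (D - E))"
      by (intro uniformly_isomorphic_sym[OF uniformly_isomorphic_Times_assoc] Z subspace_closed_span)
    also have "uniformly_isomorphic UNIV (\<lambda>D. (Z \<times> closed_span e (D \<inter> E)) \<times> closed_span e (D - E)) (\<lambda>D. Z \<times> closed_span e (D - E))"
      by (intro uniformly_isomorphic_Times 1 uniformly_isomorphic_refl subspace_closed_span)
    also note 2
    also note ZX
    finally show "uniformly_isomorphic UNIV (\<lambda>D. (UNIV :: 'a set) \<times> closed_span e D) (\<lambda>_. UNIV :: 'a set)" .
  qed
  moreover have "\<exists>B :: nat \<Rightarrow> nat set. disjoint_family B \<and>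
         (\<exists>K'. \<forall>k. K_isomorphic K' (closed_span e (B k)) (UNIV :: 'a set)) \<and>
         isomorphic (UNIV :: 'a set) (closed_span e (\<Union>k. B k)) \<and>
         unconditional_schauder_decomposition
           (\<lambda>k. closed_span e (B k)) (closed_span e (\<Union>k. B k))"
  proof (rule exI, intro conjI)
    let ?S = "\<lambda>k. range (\<lambda>j. prod_encode (k, j))"
    let ?B = "\<lambda>k. copies (?S k)"
    have infS: "infinite (?S k)" for k by (intro range_inj_infinite injI) simp
    have gB: "generic f a (?B k)" for k using copies_generic[OF infS[of k], of "{}"] by simp
    have "?S k \<inter> ?S l = {}" if "k \<noteq> l" for k l using that by auto
    then show dis: "disjoint_family ?B" unfolding disjoint_family_on_def using copies_disj by blast
    show "\<exists>K'. \<forall>k. K_isomorphic K' (closed_span e (?B k)) (UNIV :: 'a set)"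
      by (intro K_iso gen_X gB)
    have "(\<Union>k. ?B k) = copies (\<Union>k. ?S k)" by (auto simp: copies_def)
    moreover have "infinite (\<Union>k. ?S k)" by (rule infinite_super[OF _ infS[of 0]]) auto
    ultimately have "generic f a (\<Union>k. ?B k)" using copies_generic[of "\<Union>k. ?S k" "{}"] by simp
    then show "isomorphic (UNIV :: 'a set) (closed_span e (\<Union>k. ?B k))"
      by (intro iso uniformly_isomorphic_sym[OF gen_X])
    show "unconditional_schauder_decomposition (\<lambda>k. closed_span e (?B k)) (closed_span e (\<Union>k. ?B k))"
      by (rule closed_spans_schauder_decomposition[OF e dis])
  qed
  ultimately show ?thesis by blast
qed


section \<open>The dichotomy\<close>

theorem theorem8:
  fixes e :: "nat \<Rightarrow> 'a::banach"
  assumes "unconditional_basis e"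
  shows
    "(\<exists>P :: nat set set. perfect_set (char_fun ` P) \<and> (\<forall>A\<in>P. infinite A) \<and>
        (\<forall>A\<in>P. \<forall>B\<in>P. A \<noteq> B \<longrightarrow>
           \<not> isomorphic (closed_span e A) (closed_span e B) \<and>
           \<not> isomorphic (closed_span e A) (closed_span e (- B)) \<and>
           \<not> isomorphic (closed_span e (- A)) (closed_span e (- B))))
     \<or>
     ((\<exists>R :: nat set set. residual (char_fun ` R) \<and>
        (\<forall>A\<in>R. isomorphic (closed_span e A) (UNIV :: 'a set))) \<and>
      (\<forall>H :: 'a set. hyperplane H \<longrightarrow> isomorphic (UNIV :: 'a set) H) \<and>
      isomorphic (UNIV :: 'a set) (UNIV :: ('a \<times> 'a) set) \<and>
      (\<exists>K. \<forall>D :: nat set.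
         K_isomorphic K ((UNIV :: 'a set) \<times> closed_span e D) (UNIV :: 'a set)) \<and>
      (\<exists>B :: nat \<Rightarrow> nat set. disjoint_family B \<and>
         (\<exists>K'. \<forall>k. K_isomorphic K' (closed_span e (B k)) (UNIV :: 'a set)) \<and>
         isomorphic (UNIV :: 'a set) (closed_span e (\<Union>k. B k)) \<and>
         unconditional_schauder_decomposition
           (\<lambda>k. closed_span e (B k)) (closed_span e (\<Union>k. B k))))"
proof (cases "meager {p. isomorphic (closed_span e (left_set p)) (closed_span e (right_set p))}")
  case True
  define E where "E = {p. isomorphic (closed_span e (left_set p)) (closed_span e (right_set p))}"
  \<comment> \<open>Complementing the second set, and complementing both sets, are homeomorphisms of the space of pairs.\<close>
  define h :: "bool \<times> bool \<Rightarrow> bool \<times> bool" where "h = (\<lambda>(b, b'). (b, \<not> b'))"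
  define h' :: "bool \<times> bool \<Rightarrow> bool \<times> bool" where "h' = (\<lambda>(b, b'). (\<not> b, \<not> b'))"
  have "bij h" "bij h'"
    by (rule involuntory_imp_bij; simp add: h_def h'_def split: prod.split)+
  then have "meager (E \<union> ({p. (\<lambda>i. h (p i)) \<in> E} \<union> {p. (\<lambda>i. h' (p i)) \<in> E}))"
    using True by (intro meager_Un meager_vimage_coordinatewise) (auto simp: E_def)
  from perfect_set_avoiding_meager[OF this]
  obtain P :: "nat set set" where P: "perfect_set (char_fun ` P)" "\<forall>A\<in>P. infinite A"
    "\<And>A B. A \<in> P \<Longrightarrow> B \<in> P \<Longrightarrow> A \<noteq> B \<Longrightarrow>
      (\<lambda>i. (i \<in> A, i \<in> B)) \<notin> E \<union> ({p. (\<lambda>i. h (p i)) \<in> E} \<union> {p. (\<lambda>i. h' (p i)) \<in> E})"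
    by (elim exE conjE) (rule that, assumption, assumption, blast)
  have "\<not> isomorphic (closed_span e A) (closed_span e B) \<and>
      \<not> isomorphic (closed_span e A) (closed_span e (- B)) \<and>
      \<not> isomorphic (closed_span e (- A)) (closed_span e (- B))"
    if "A \<in> P" "B \<in> P" "A \<noteq> B" for A B
    using P(3)[OF that] by (simp add: E_def h_def h'_def Compl_eq)
  then show ?thesis using P(1,2) by blast
next
  case False
  then obtain K n p where K: "K \<ge> 1"
    and comeager: "meager (cylinder n p - {q. iso_within K (closed_span e (left_set q)) (closed_span e (right_set q))})"
    by (rule isomorphism_relation_comeager_in_cylinder)
  obtain f a where sm: "strict_mono f" and f0: "f 0 = n" and a: "\<And>m c. \<exists>i\<in>{f m..<f (Suc m)}. a i = c"
    and avoid: "\<And>q. infinite {m. matches f a m q} \<Longrightarrow>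
      q \<notin> cylinder n p - {q. iso_within K (closed_span e (left_set q)) (closed_span e (right_set q))}"
    by (rule meager_avoiding_pattern[OF comeager]) (rule that)
  \<comment> \<open>This first coordinate begins like \<open>p\<close> and follows the pattern on every block, so a pair \<open>(A, B)\<close>
    matches a block as soon as \<open>B\<close> does.\<close>
  define A where "A = {i. if i < n then fst (p i) else fst (a i)}"
  define t where "t = {i. i < n \<and> snd (p i)}"
  define b where "b i = snd (a i)" for i
  have b: "\<exists>i\<in>{f m..<f (Suc m)}. b i = c" for m c
    using a[of m "(True, c)"] unfolding b_def by (metis snd_conv)
  have iso: "iso_within K (closed_span e B) (closed_span e A)"
    if B: "generic f b B" "B \<inter> {..<n} = t" for B
  proof -
    define q where "q i = (i \<in> A, i \<in> B)" for i
    have "q \<in> cylinder n p"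
      unfolding cylinder_def
    proof clarify
      fix i assume i: "i < n"
      then have "i \<in> B \<longleftrightarrow> i \<in> t" using B(2) by blast
      then show "q i = p i" using i by (simp add: q_def A_def t_def)
    qed
    moreover have "{m. matches f b m (char_fun B)} \<subseteq> {m. matches f a m q}"
    proof clarify
      fix m assume m: "matches f b m (char_fun B)"
      show "matches f a m q"
        unfolding matches_def
      proof
        fix i assume i: "i \<in> {f m..<f (Suc m)}"
        have "n \<le> i" using i strict_mono_less_eq[OF sm, of 0 m] by (simp add: f0)
        then show "q i = a i" using m i by (simp add: matches_def char_fun_def q_def A_def b_def)
      qed
    qed
    then have "infinite {m. matches f a m q}" using B(1) finite_subset unfolding generic_def by blast
    ultimately have "iso_within K (closed_span e (left_set q)) (closed_span e (right_set q))"
      using avoid by blast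
    then show ?thesis by (simp add: q_def iso_within_sym)
  qed
  have "uniformly_isomorphic {B. generic f b B} (closed_span e) (\<lambda>_. closed_span e A)"
    by (rule generic_uniformly_isomorphic[OF assms sm b _ K iso, of t n]) (auto simp: t_def)
  from generic_uniformly_isomorphic_imp_decomposable[OF assms sm subspace_closed_span this]
  show ?thesis by (rule disjI2)
qed

end
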